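(* For every $\lambda\in\Lambda$ there are expansions $$R_\lambda(z)=\sum_{\mu\in\mathbb N^n:\ \mu\le[\lambda]}a_{\lambda\mu}z^\mu\qquad\text{and}\qquad \overline R_\lambda(z)=\sum_{\mu\in\mathbb N^n:\ \mu\le[\lambda],\ |\mu|=|[\lambda]|}a_{\lambda\mu}z^\mu$$ with coefficients $a_{\lambda\mu}\in k$.
   Context: Let $k$ be a field of characteristic zero, $n\ge 1$, $\mathcal P=k[z_1,\dots,z_n]$, and let $W\subseteq S_n$ be the group of permutations $\pi$ with $\pi(i)\equiv i \bmod 2$ for all $i$, acting by permuting variables. $\mathbb N$ contains $0$. $\Lambda$ is the set of integer tuples $\lambda=(\lambda_1\ge\dots\ge\lambda_n\ge 0)$ and $|\lambda|_{\rm odd}=\sum_{i\text{ odd}}\lambda_i$. Fix $r\in k$ which is not a negative rational number and put $\rho=((n-1)r,(n-2)r,\dots,r,0)$. For $\lambda\in\Lambda$ let $[\lambda]\in\mathbb N^n$ be given by $[\lambda]_m=\lambda_m-\lambda_{m+1}+\dots+(-1)^{n-m}\lambda_n$. $R_\lambda(z)=R_\lambda(z;r)\in\mathcal P^W$ is the unique $W$-invariant polynomial of degree $|\lambda|_{\rm odd}$ which satisfies $R_\lambda(\rho+\mu)=0$ for all $\mu\in\Lambda$ with $|\mu|_{\rm odd}\le|\lambda|_{\rm odd}$, $\mu\ne\lambda$, and in which the monomial $z^{[\lambda]}$ has coefficient $1$ (it is known that this exists and is unique). $\overline R_\lambda$ is its homogeneous component of highest degree $|\lambda|_{\rm odd}$.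 For $\mu,\nu\in\mathbb N^n$, $|\mu|=\sum_i\mu_i$ and $\mu\le\nu$ denotes the inhomogeneous dominance order: $\mu_1+\dots+\mu_m\le\nu_1+\dots+\nu_m$ for all $m=1,\dots,n$. *)

theory Defs
  imports Complex_Main "HOL-Library.Poly_Mapping" "HOL-Combinatorics.Permutations"
begin

text \<open>Polynomials in variables indexed by natural numbers are finitely supported maps from
  monomials (exponent vectors) to coefficients.  The polynomial ring in \<open>n\<close> variables uses
  the variables with index in \<open>{1..n}\<close>, as in the mathematical text.\<close>

type_synonym 'a mpoly = "(nat \<Rightarrow>\<^sub>0 nat) \<Rightarrow>\<^sub>0 'a"

definition tuples :: "nat \<Rightarrow> (nat \<Rightarrow>\<^sub>0 nat) set" where
  "tuples n = {\<mu>. Poly_Mapping.keys \<mu> \<subseteq> {1..n}}"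

definition poly_ring :: "nat \<Rightarrow> 'a::zero mpoly set" where
  "poly_ring n = {p. Poly_Mapping.keys p \<subseteq> tuples n}"

definition msize :: "(nat \<Rightarrow>\<^sub>0 nat) \<Rightarrow> nat" where
  "msize \<mu> = (\<Sum>i\<in>Poly_Mapping.keys \<mu>. Poly_Mapping.lookup \<mu> i)"

definition total_degree :: "'a::zero mpoly \<Rightarrow> nat" where
  "total_degree p = Max (insert 0 (msize ` Poly_Mapping.keys p))"

definition hom_component :: "nat \<Rightarrow> 'a::comm_monoid_add mpoly \<Rightarrow> 'a mpoly" where
  "hom_component d p =
     (\<Sum>m\<in>{m \<in> Poly_Mapping.keys p. msize m = d}. Poly_Mapping.single m (Poly_Mapping.lookup p m))"

definition eval_mpoly :: "(nat \<Rightarrow> 'a) \<Rightarrow> 'a::comm_semiring_1 mpoly \<Rightarrow> 'a" where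
  "eval_mpoly x p =
     (\<Sum>m\<in>Poly_Mapping.keys p. Poly_Mapping.lookup p m * (\<Prod>i\<in>Poly_Mapping.keys m. x i ^ Poly_Mapping.lookup m i))"

text \<open>The action of \<open>\<pi>\<close> on polynomials by \<open>z\<^sub>i \<mapsto> z\<^bsub>\<pi>(i)\<^esub>\<close>.\<close>

definition permute_vars :: "(nat \<Rightarrow> nat) \<Rightarrow> 'a::comm_monoid_add mpoly \<Rightarrow> 'a mpoly" where
  "permute_vars \<pi> p =
     (\<Sum>m\<in>Poly_Mapping.keys p.
        Poly_Mapping.single
          (\<Sum>i\<in>Poly_Mapping.keys m. Poly_Mapping.single (\<pi> i) (Poly_Mapping.lookup m i)) (Poly_Mapping.lookup p m))"

definition W :: "nat \<Rightarrow> (nat \<Rightarrow> nat) set" where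
  "W n = {\<pi>. \<pi> permutes {1..n} \<and> (\<forall>i\<in>{1..n}. \<pi> i mod 2 = i mod 2)}"

definition W_invariants :: "nat \<Rightarrow> 'a::comm_monoid_add mpoly set" where
  "W_invariants n = {p \<in> poly_ring n. \<forall>\<pi>\<in>W n. permute_vars \<pi> p = p}"

definition Lam :: "nat \<Rightarrow> (nat \<Rightarrow>\<^sub>0 nat) set" where
  "Lam n = {lam \<in> tuples n. \<forall>i\<in>{1..<n}. Poly_Mapping.lookup lam (Suc i) \<le> Poly_Mapping.lookup lam i}"

definition odd_size :: "nat \<Rightarrow> (nat \<Rightarrow>\<^sub>0 nat) \<Rightarrow> nat" where
  "odd_size n lam = (\<Sum>i\<in>{i\<in>{1..n}. odd i}. Poly_Mapping.lookup lam i)"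

text \<open>The tuple \<open>[\<lambda>]\<close>; on \<open>Lam n\<close> the alternating sums are nonnegative, so that \<open>nat\<close>
  does not truncate (see \<open>lookup_bracket\<close> below).\<close>

definition bracket :: "nat \<Rightarrow> (nat \<Rightarrow>\<^sub>0 nat) \<Rightarrow> nat \<Rightarrow>\<^sub>0 nat" where
  "bracket n lam =
     (\<Sum>m = 1..n. Poly_Mapping.single m (nat (\<Sum>j = m..n. (-1) ^ (j - m) * int (Poly_Mapping.lookup lam j))))"

definition rho :: "nat \<Rightarrow> 'a::comm_semiring_1 \<Rightarrow> nat \<Rightarrow> 'a" where
  "rho n r i = of_nat (n - i) * r"

definition dominated :: "nat \<Rightarrow> (nat \<Rightarrow>\<^sub>0 nat) \<Rightarrow> (nat \<Rightarrow>\<^sub>0 nat) \<Rightarrow> bool" where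
  "dominated n \<mu> \<nu> \<longleftrightarrow> (\<forall>m\<in>{1..n}. (\<Sum>i = 1..m. Poly_Mapping.lookup \<mu> i) \<le> (\<Sum>i = 1..m. Poly_Mapping.lookup \<nu> i))"

text \<open>The conditions which determine the polynomial \<open>R\<^sub>\<lambda>(z; r)\<close> uniquely.\<close>

definition is_R :: "nat \<Rightarrow> 'a::field_char_0 \<Rightarrow> (nat \<Rightarrow>\<^sub>0 nat) \<Rightarrow> 'a mpoly \<Rightarrow> bool" where
  "is_R n r lam R \<longleftrightarrow>
     R \<in> W_invariants n \<and>
     total_degree R = odd_size n lam \<and>
     (\<forall>\<mu>\<in>Lam n. odd_size n \<mu> \<le> odd_size n lam \<and> \<mu> \<noteq> lam \<longrightarrow>
        eval_mpoly (\<lambda>i. rho n r i + of_nat (Poly_Mapping.lookup \<mu> i)) R = 0) \<and>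
     Poly_Mapping.lookup R (bracket n lam) = 1"

lemma lookup_bracket_nat:
  "Poly_Mapping.lookup (bracket n lam) m =
     (if m \<in> {1..n} then nat (\<Sum>j = m..n. (-1) ^ (j - m) * int (Poly_Mapping.lookup lam j)) else 0)"
  by (simp add: bracket_def lookup_sum lookup_single when_def)

lemma lookup_bracket:
  assumes "lam \<in> Lam n" "m \<in> {1..n}"
  shows "int (Poly_Mapping.lookup (bracket n lam) m) = (\<Sum>j = m..n. (-1) ^ (j - m) * int (Poly_Mapping.lookup lam j))"
proof -
  define g where "g m = (\<Sum>j = m..n. (-1) ^ (j - m) * int (Poly_Mapping.lookup lam j))" for m
  have "m \<le> n" "1 \<le> m" using assms(2) by auto
  then have "0 \<le> g m \<and> g m \<le> int (Poly_Mapping.lookup lam m)"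
  proof (induction rule: inc_induct)
    case base
    then show ?case by (simp add: g_def)
  next
    case (step k)
    have "g k = int (Poly_Mapping.lookup lam k) + (\<Sum>j = Suc k..n. (-1) ^ (j - k) * int (Poly_Mapping.lookup lam j))"
      using step.hyps by (simp add: g_def sum.atLeast_Suc_atMost)
    also have "(\<Sum>j = Suc k..n. (-1) ^ (j - k) * int (Poly_Mapping.lookup lam j)) = - g (Suc k)"
      unfolding g_def sum_negf[symmetric]
    proof (rule sum.cong)
      fix j assume "j \<in> {Suc k..n}"
      then have "j - k = Suc (j - Suc k)" by auto
      then show "(- 1) ^ (j - k) * int (Poly_Mapping.lookup lam j) =
          - ((- 1) ^ (j - Suc k) * int (Poly_Mapping.lookup lam j))" by simp
    qed simp
    finally have "g k = int (Poly_Mapping.lookup lam k) - g (Suc k)" by simp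
    moreover have "Poly_Mapping.lookup lam (Suc k) \<le> Poly_Mapping.lookup lam k"
      using assms(1) step by (auto simp: Lam_def)
    ultimately show ?case using step by auto
  qed
  then show ?thesis using assms(2) by (simp add: lookup_bracket_nat g_def)
qed

lemma finite_dominated: "finite {\<mu> \<in> tuples n. dominated n \<mu> \<nu>}"
proof (rule finite_imageD)
  let ?A = "{\<mu> \<in> tuples n. dominated n \<mu> \<nu>}"
  let ?N = "\<Sum>i = 1..n. Poly_Mapping.lookup \<nu> i"
  have "\<forall>i. (i \<in> {1..n} \<longrightarrow> Poly_Mapping.lookup \<mu> i \<in> {..?N}) \<and>
      (i \<notin> {1..n} \<longrightarrow> Poly_Mapping.lookup \<mu> i = 0)" if mu: "\<mu> \<in> ?A" for \<mu>
  proof (intro allI conjI impI)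
    fix i assume i: "i \<in> {1..n}"
    have "Poly_Mapping.lookup \<mu> i \<le> (\<Sum>j = 1..n. Poly_Mapping.lookup \<mu> j)"
      by (rule member_le_sum[OF i]) simp_all
    also have "\<dots> \<le> ?N"
      using mu i unfolding dominated_def by fastforce
    finally show "Poly_Mapping.lookup \<mu> i \<in> {..?N}" by simp
  next
    fix i assume "i \<notin> {1..n}"
    then have "i \<notin> Poly_Mapping.keys \<mu>" using mu unfolding tuples_def by blast
    then show "Poly_Mapping.lookup \<mu> i = 0" by (simp add: in_keys_iff)
  qed
  then have "Poly_Mapping.lookup ` ?A \<subseteq>
      {f. \<forall>i. (i \<in> {1..n} \<longrightarrow> f i \<in> {..?N}) \<and> (i \<notin> {1..n} \<longrightarrow> f i = 0)}"
    by (intro image_subsetI CollectI)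
  then show "finite (Poly_Mapping.lookup ` ?A)"
    by (rule finite_subset) (rule finite_set_of_finite_funs, rule finite_atLeastAtMost, rule finite_atMost)
  show "inj_on Poly_Mapping.lookup ?A" by (rule inj_onI) (rule poly_mapping_eqI, simp)
qed

end

theory Submission
  imports Defs "HOL-Computational_Algebra.Polynomial"
begin

text \<open>A parity-symmetric polynomial of degree \<open>\<le> d\<close> that vanishes at all shifted weights of size
  \<open>\<le> d\<close> is zero.  Hence \<open>R\<^sub>\<lambda>\<close> is an eigenfunction of every difference operator which preserves
  parity-symmetric polynomials and their degrees and which only removes boxes from the weight:
  either one box in an odd row, or one box in an odd row together with one in an even row.
  There is such an operator with eigenvalue \<open>|\<lambda>|\<^sub>o\<^sub>d\<^sub>d\<close>.  Evaluating the eigenvalue equation at a shifted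
  weight \<open>\<mu>\<close> with \<open>|\<mu>|\<^sub>o\<^sub>d\<^sub>d > |\<lambda>|\<^sub>o\<^sub>d\<^sub>d\<close> shows by induction that \<open>R\<^sub>\<lambda>\<close> vanishes there unless
  \<open>\<lambda> \<subseteq> \<mu>\<close>.  Finally let \<open>g\<close> be the leading part of \<open>R\<^sub>\<lambda>\<close> in the first \<open>m\<close> variables, of degree \<open>b\<close>.
  As a polynomial in the remaining variables it has degree at most \<open>|\<lambda>|\<^sub>o\<^sub>d\<^sub>d - b\<close>, and it vanishes
  at the shifted weights \<open>\<kappa>\<close> not containing the tail \<open>(\<lambda>\<^sub>m\<^sub>+\<^sub>1, \<dots>, \<lambda>\<^sub>n)\<close>.  If \<open>b\<close> exceeded
  \<open>[\<lambda>]\<^sub>1 + \<dots> + [\<lambda>]\<^sub>m\<close>, which is \<open>|\<lambda>|\<^sub>o\<^sub>d\<^sub>d\<close> minus the size of the tail, this would force \<open>g = 0\<close>.\<close>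

subsection \<open>Polynomial functions\<close>

text \<open>The obstacle is that the defining conditions control \<open>R\<close> only at weights of
  odd size at most that of \<open>\<lambda>\<close>, whereas the degree in the first
  \<open>m\<close> variables is read off on slices: the last \<open>n - m\<close> coordinates are
  fixed at a short tail while the first \<open>m\<close> rows become arbitrarily long. Vanishing at
  such long weights can only come from containment, and this is what the operator is for. A tail too
  small to contain that of \<open>\<lambda>\<close> makes \<open>R\<close> vanish on the whole
  slice, by uniqueness in the first \<open>m\<close> variables; so does each homogeneous part in
  these variables, and uniqueness is used once more in the remaining ones. The operator has
  denominators \<open>z i - z k\<close>. Its sum is polynomial as an iterated divided difference,
  but for \<open>r = 0\<close> denominators vanish at shifted weights with equal rows, so values
  there are limits in the direction of \<open>rho\<close>. Polynomials are handled as functions with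
  a degree bound. Over an infinite field nothing is lost, and translation, specialisation and
  permutation of variables become compositions.\<close>

inductive polyfun :: "nat set \<Rightarrow> nat \<Rightarrow> ((nat \<Rightarrow> 'k::field_char_0) \<Rightarrow> 'k) \<Rightarrow> bool" for I where
  const: "polyfun I d (\<lambda>_. c)"
| var: "i \<in> I \<Longrightarrow> polyfun I (Suc d) (\<lambda>z. z i)"
| add: "polyfun I d f \<Longrightarrow> polyfun I d g \<Longrightarrow> polyfun I d (\<lambda>z. f z + g z)"
| mult: "polyfun I a f \<Longrightarrow> polyfun I b g \<Longrightarrow> a + b \<le> d \<Longrightarrow> polyfun I d (\<lambda>z. f z * g z)"

lemma polyfun_mono: "polyfun I d f \<Longrightarrow> d \<le> e \<Longrightarrow> polyfun I e f"
proof (induction arbitrary: e rule: polyfun.induct)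
  case (const d c) show ?case by (rule polyfun.const)
next
  case (var i d)
  then obtain e' where "e = Suc e'" by (cases e) auto
  then show ?case using var by (auto intro: polyfun.var)
next
  case (add d f g) then show ?case by (simp add: polyfun.add)
next
  case (mult a f b g d)
  show ?case by (rule polyfun.mult[OF mult.hyps(1,2)]) (use mult in simp)
qed

lemma polyfun_uminus: "polyfun I d f \<Longrightarrow> polyfun I d (\<lambda>z. - f z)"
  using polyfun.mult[OF polyfun.const[of I 0 "-1"], of d f d] by simp

lemma polyfun_diff: "polyfun I d f \<Longrightarrow> polyfun I d g \<Longrightarrow> polyfun I d (\<lambda>z. f z - g z)"
  using polyfun.add[OF _ polyfun_uminus, of I d f g] by simp

lemma polyfun_sum: "(\<And>a. a \<in> A \<Longrightarrow> polyfun I d (f a)) \<Longrightarrow> polyfun I d (\<lambda>z. \<Sum>a\<in>A. f a z)"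
  by (induction A rule: infinite_finite_induct) (simp_all add: polyfun.const polyfun.add)

lemma polyfun_prod: "(\<And>a. a \<in> A \<Longrightarrow> polyfun I (d a) (f a)) \<Longrightarrow> polyfun I (\<Sum>a\<in>A. d a) (\<lambda>z. \<Prod>a\<in>A. f a z)"
  by (induction A rule: infinite_finite_induct) (simp_all add: polyfun.const polyfun.mult[OF _ _ order_refl])

lemma polyfun_prod_linear: "(\<And>a. a \<in> A \<Longrightarrow> polyfun I 1 (f a)) \<Longrightarrow> polyfun I (card A) (\<lambda>z. \<Prod>a\<in>A. f a z)"
  using polyfun_prod[of A I "\<lambda>_. 1" f] by simp

lemma polyfun_power: "polyfun I d f \<Longrightarrow> polyfun I (k * d) (\<lambda>z. f z ^ k)"
  by (induction k) (simp_all add: polyfun.const polyfun.mult[OF _ _ order_refl])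

text \<open>Restriction to a hyperplane, translation, permutation and freezing of variables are all
  affine substitutions; \<open>J\<close> may differ from \<open>I\<close> because some of them
  eliminate variables.\<close>

lemma polyfun_subst:
  assumes "polyfun I d f" "\<And>i. i \<in> I \<Longrightarrow> polyfun J 1 (\<lambda>z. \<sigma> z i)"
  shows "polyfun J d (\<lambda>z. f (\<sigma> z))"
  using assms
proof (induction rule: polyfun.induct)
  case (const d c) show ?case by (rule polyfun.const)
next
  case (var i d)
  show ?case by (rule polyfun_mono[OF var(2)[OF var(1)]]) simp
next
  case (add d f g) then show ?case by (simp add: polyfun.add)
next
  case (mult a f b g d) then show ?case using polyfun.mult by blast
qed

lemma polyfun_subset: "polyfun I d f \<Longrightarrow> I \<subseteq> J \<Longrightarrow> polyfun J d f"
  using polyfun_subst[of I d f J "\<lambda>z. z"] polyfun.var[of _ J 0] by (auto simp: subset_iff)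

lemma polyfun_cong:
  assumes "polyfun I d f" "\<And>i. i \<in> I \<Longrightarrow> z i = z' i"
  shows "f z = f z'"
  using assms by (induction rule: polyfun.induct) simp_all

lemma polyfun_degree_0:
  assumes "polyfun I 0 f"
  shows "f z = f z'"
proof -
  have "d = 0 \<Longrightarrow> f z = f z'" if "polyfun I d f" for d
    using that by (induction rule: polyfun.induct) auto
  then show ?thesis using assms by blast
qed

lemma polyfun_line:
  assumes "polyfun I d f"
  shows "\<exists>p. \<forall>t. f (\<lambda>i. z i + t * w i) = poly p t"
  using assms
proof (induction rule: polyfun.induct)
  case (const d c) show ?case by (intro exI[of _ "[:c:]"]) simp
next
  case (var i d) then show ?case by (intro exI[of _ "[:z i, w i:]"]) simp
next
  case (add d f g)
  then obtain p q where "\<forall>t. f (\<lambda>i. z i + t * w i) = poly p t" "\<forall>t. g (\<lambda>i. z i + t * w i) = poly q t"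
    by blast
  then show ?case by (intro exI[of _ "p + q"]) simp
next
  case (mult a f b g d)
  then obtain p q where "\<forall>t. f (\<lambda>i. z i + t * w i) = poly p t" "\<forall>t. g (\<lambda>i. z i + t * w i) = poly q t"
    by blast
  then show ?case by (intro exI[of _ "p * q"]) simp
qed

lemma poly_cofinite_eq:
  fixes p q :: "'k::field_char_0 poly"
  assumes "finite S" "\<And>t. t \<notin> S \<Longrightarrow> poly p t = poly q t"
  shows "p = q"
proof (rule ccontr)
  assume "p \<noteq> q"
  then have "finite {t. poly (p - q) t = 0}" by (intro poly_roots_finite) simp
  then have "finite (S \<union> {t. poly (p - q) t = 0})" using assms(1) by simp
  moreover have "UNIV = S \<union> {t. poly (p - q) t = 0}" using assms(2) by auto
  ultimately show False by (metis infinite_UNIV_char_0)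
qed

text \<open>A density argument without topology: on a line \<open>f\<close> is a polynomial in one
  variable, and one with cofinitely many zeros over an infinite field is zero. It extends identities
  from points where denominators are nonzero to all points; \<open>w\<close> can be chosen so that
  the line stays inside a given hyperplane.\<close>

lemma polyfun_line_density:
  assumes "polyfun I d f" "finite S" "\<And>t. t \<notin> S \<Longrightarrow> f (\<lambda>i. z i + t * w i) = 0"
  shows "f z = 0"
proof -
  obtain p where p: "\<And>t. f (\<lambda>i. z i + t * w i) = poly p t" using polyfun_line[OF assms(1)] by blast
  have "p = 0" by (rule poly_cofinite_eq[OF assms(2)]) (simp add: assms(3) flip: p)
  then show ?thesis using p[of 0] by simp
qed

text \<open>Covers both differences (\<open>l = 1\<close>, \<open>\<sigma>\<close> a translation) and division by the linear form \<open>l\<close>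
  (\<open>\<sigma>\<close> a projection onto the hyperplane \<open>l = 0\<close>).\<close>

lemma polyfun_diff_quotient:
  assumes "polyfun I d f"
    and "\<And>i. i \<in> I \<Longrightarrow> polyfun I 1 (\<lambda>z. \<sigma> z i)"
    and "\<And>i z. i \<in> I \<Longrightarrow> z i - \<sigma> z i = l z * \<delta> i"
  shows "\<exists>g. (\<forall>z. f z - f (\<sigma> z) = l z * g z) \<and> (d = 0 \<longrightarrow> g = (\<lambda>_. 0)) \<and> polyfun I (d - 1) g"
  using assms(1)
proof (induction rule: polyfun.induct)
  case (const d c)
  show ?case by (intro exI[of _ "\<lambda>_. 0"]) (auto intro: polyfun.const)
next
  case (var i d)
  then show ?case by (intro exI[of _ "\<lambda>_. \<delta> i"]) (auto intro: polyfun.const simp: assms)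
next
  case (add d f g)
  obtain f1 where
    f: "\<forall>z. f z - f (\<sigma> z) = l z * f1 z" "d = 0 \<longrightarrow> f1 = (\<lambda>_. 0)" "polyfun I (d - 1) f1"
    using add.IH(1) by (elim exE conjE)
  obtain g1 where
    g: "\<forall>z. g z - g (\<sigma> z) = l z * g1 z" "d = 0 \<longrightarrow> g1 = (\<lambda>_. 0)" "polyfun I (d - 1) g1"
    using add.IH(2) by (elim exE conjE)
  have "f z + g z - (f (\<sigma> z) + g (\<sigma> z)) = l z * (f1 z + g1 z)" for z
    using spec[OF f(1), of z] spec[OF g(1), of z] by (simp add: algebra_simps)
  then show ?case using f g by (intro exI[of _ "\<lambda>z. f1 z + g1 z"]) (auto simp: polyfun.add)
next
  case (mult a f b g d)
  obtain f1 where
    f: "\<forall>z. f z - f (\<sigma> z) = l z * f1 z" "a = 0 \<longrightarrow> f1 = (\<lambda>_. 0)" "polyfun I (a - 1) f1"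
    using mult.IH(1) by (elim exE conjE)
  obtain g1 where
    g: "\<forall>z. g z - g (\<sigma> z) = l z * g1 z" "b = 0 \<longrightarrow> g1 = (\<lambda>_. 0)" "polyfun I (b - 1) g1"
    using mult.IH(2) by (elim exE conjE)
  have eq: "f z * g z - f (\<sigma> z) * g (\<sigma> z) = l z * (f1 z * g z + f (\<sigma> z) * g1 z)" for z
  proof -
    have "f z * g z - f (\<sigma> z) * g (\<sigma> z) = (f z - f (\<sigma> z)) * g z + f (\<sigma> z) * (g z - g (\<sigma> z))"
      by (simp add: algebra_simps)
    then show ?thesis unfolding spec[OF f(1)] spec[OF g(1)] by (simp add: algebra_simps)
  qed
  \<comment> \<open>For \<open>a = 0\<close> truncated subtraction only bounds the degree of
    \<open>f1\<close> by \<open>0\<close>, one more than wanted, and the product would get the bound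
    \<open>d\<close>; the clause that \<open>f1\<close> is then zero closes this gap.\<close>
  have "polyfun I (d - 1) (\<lambda>z. f1 z * g z)"
  proof (cases a)
    case 0 then show ?thesis using f(2) by (simp add: polyfun.const)
  next
    case (Suc a') then show ?thesis
      using polyfun.mult[OF f(3) mult.hyps(2), of "d - 1"] mult.hyps(3) by simp
  qed
  moreover have "polyfun I (d - 1) (\<lambda>z. f (\<sigma> z) * g1 z)"
  proof (cases b)
    case 0 then show ?thesis using g(2) by (simp add: polyfun.const)
  next
    case (Suc b') 
    have "polyfun I a (\<lambda>z. f (\<sigma> z))" by (rule polyfun_subst[OF mult.hyps(1) assms(2)])
    from polyfun.mult[OF this g(3), of "d - 1"] show ?thesis using mult.hyps(3) Suc by simp
  qed
  moreover have "d = 0 \<longrightarrow> (\<lambda>z. f1 z * g z + f (\<sigma> z) * g1 z) = (\<lambda>_. 0)"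
    using f(2) g(2) mult.hyps(3) by auto
  ultimately show ?case using eq by (intro exI[of _ "\<lambda>z. f1 z * g z + f (\<sigma> z) * g1 z"]) (simp add: polyfun.add)
qed

lemma polyfun_translate_diff:
  assumes "polyfun I (Suc d) f"
  shows "polyfun I d (\<lambda>z. f z - f (\<lambda>l. z l - \<delta> l))"
proof -
  have "polyfun I 1 (\<lambda>z. z i - \<delta> i)" if "i \<in> I" for i
    using polyfun_diff[OF polyfun.var[OF that, of 0] polyfun.const] by simp
  from polyfun_diff_quotient[OF assms, of "\<lambda>z l. z l - \<delta> l" "\<lambda>_. 1" \<delta>, OF this]
  obtain g where "\<And>z. f z - f (\<lambda>l. z l - \<delta> l) = g z" "polyfun I d g" by auto
  then show ?thesis by simp
qed

lemma polyfun_divide_hyperplane: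
  assumes "polyfun I d f" "i \<in> I" "polyfun I 1 w"
    and "\<And>z. f (z(i := w z)) = 0"
  shows "\<exists>g. (\<forall>z. f z = (z i - w z) * g z) \<and> (d = 0 \<longrightarrow> g = (\<lambda>_. 0)) \<and> polyfun I (d - 1) g"
proof -
  have "polyfun I 1 (\<lambda>z. (z(i := w z)) l)" if "l \<in> I" for l
    using that assms polyfun.var[OF that, of 0] by (cases "l = i") simp_all
  from polyfun_diff_quotient[OF assms(1), of "\<lambda>z. z(i := w z)" "\<lambda>z. z i - w z" "\<lambda>l. of_bool (l = i)", OF this]
  show ?thesis using assms(4) by simp
qed

subsection \<open>Functions vanishing on the shifted weights\<close>

text \<open>The linear forms \<open>z l - c\<close> are divided off one at a time, each costing one
  degree; with more forms than degrees only zero is left.\<close>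

lemma polyfun_divide_hyperplanes:
  assumes "finite L" "L \<subseteq> I" "polyfun I d f"
    and "\<And>l z. l \<in> L \<Longrightarrow> z l = c \<Longrightarrow> f z = 0"
  shows "\<exists>g. (\<forall>z. f z = (\<Prod>l\<in>L. z l - c) * g z) \<and> (d < card L \<longrightarrow> g = (\<lambda>_. 0)) \<and> polyfun I (d - card L) g"
  using assms(1,2,4)
proof (induction L rule: finite_induct)
  case empty
  show ?case by (intro exI[of _ f]) (simp add: assms(3))
next
  case (insert i L)
  have sub: "L \<subseteq> I" "i \<in> I" using insert.prems(1) by auto
  have "\<exists>g. (\<forall>z. f z = (\<Prod>l\<in>L. z l - c) * g z) \<and> (d < card L \<longrightarrow> g = (\<lambda>_. 0)) \<and> polyfun I (d - card L) g"
    by (rule insert.IH[OF sub(1)]) (use insert.prems(2) in blast)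
  then obtain g where gg: "\<forall>z. f z = (\<Prod>l\<in>L. z l - c) * g z" "d < card L \<longrightarrow> g = (\<lambda>_. 0)"
    "polyfun I (d - card L) g" by (elim exE conjE)
  note g = spec[OF gg(1)] gg(2,3)
  \<comment> \<open>Cancelling the earlier factors is possible only where they are nonzero. The
    direction \<open>?w\<close> moves every coordinate except \<open>i\<close>, so the line stays in
    the hyperplane of \<open>i\<close> and meets each of the others for only one
    \<open>t\<close>.\<close>
  have g0: "g (z(i := c)) = 0" for z
  proof (rule polyfun_line_density[OF g(3)])
    let ?w = "\<lambda>l. of_bool (l \<noteq> i)" let ?S = "(\<lambda>l. c - z l) ` L"
    show "finite ?S" using insert.hyps(1) by simp
    fix t assume t: "t \<notin> ?S"
    let ?z = "\<lambda>l. (z(i := c)) l + t * ?w l"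
    have "f ?z = 0" by (rule insert.prems(2)[of i]) simp_all
    moreover have "?z l - c \<noteq> 0" if l: "l \<in> L" for l
    proof -
      have "t \<noteq> c - z l" using l t by blast
      moreover have "l \<noteq> i" using l insert.hyps by blast
      ultimately show ?thesis by (auto simp: algebra_simps)
    qed
    ultimately show "g ?z = 0" using g(1)[of ?z] insert.hyps(1) by simp
  qed
  obtain h where hh: "\<forall>z. g z = (z i - c) * h z" "d - card L = 0 \<longrightarrow> h = (\<lambda>_. 0)" "polyfun I (d - card L - 1) h"
    using polyfun_divide_hyperplane[OF g(3) sub(2) polyfun.const, OF g0] by (elim exE conjE)
  note h = spec[OF hh(1)] hh(2,3)
  have "f z = (\<Prod>l\<in>insert i L. z l - c) * h z" for z
    using insert.hyps g(1) h(1) by (simp add: mult_ac)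
  moreover have "d < card (insert i L) \<longrightarrow> h = (\<lambda>_. 0)" "polyfun I (d - card (insert i L)) h"
    using h(2,3) insert.hyps by simp_all
  ultimately show ?case by (intro exI[of _ h] conjI allI)
qed

section \<open>Parity symmetry, shifted weights and uniqueness\<close>

definition parity_sym :: "nat set \<Rightarrow> ((nat \<Rightarrow> 'k) \<Rightarrow> 'k) \<Rightarrow> bool" where
  "parity_sym I f \<longleftrightarrow> (\<forall>a\<in>I. \<forall>b\<in>I. even (a + b) \<longrightarrow> (\<forall>z. f (z \<circ> transpose a b) = f z))"

lemma parity_symD:
  "parity_sym I f \<Longrightarrow> a \<in> I \<Longrightarrow> b \<in> I \<Longrightarrow> even (a + b) \<Longrightarrow> f (z \<circ> transpose a b) = f z"
  by (simp add: parity_sym_def)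

definition decreasing :: "nat \<Rightarrow> nat \<Rightarrow> (nat \<Rightarrow> nat) \<Rightarrow> bool" where
  "decreasing m n \<mu> \<longleftrightarrow> (\<forall>i\<in>{Suc m..<n}. \<mu> (Suc i) \<le> \<mu> i)"

text \<open>Parity is counted from row \<open>m + 1\<close>, so that for \<open>m = 0\<close> this
  is the odd size and for larger \<open>m\<close> the odd size of the tail regarded as a partition
  of its own.\<close>

definition tail_odd_size :: "nat \<Rightarrow> nat \<Rightarrow> (nat \<Rightarrow> nat) \<Rightarrow> nat" where
  "tail_odd_size m n \<mu> = (\<Sum>l | l \<in> {Suc m..n} \<and> odd (l + m). \<mu> l)"

text \<open>The offset \<open>c\<close> makes the family closed under both reductions of the
  uniqueness proof: dropping an empty last row replaces \<open>c\<close> by \<open>c + r\<close>,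
  removing a full column replaces it by \<open>c + 1\<close>.\<close>

definition shifted_point :: "nat \<Rightarrow> 'k::field_char_0 \<Rightarrow> 'k \<Rightarrow> (nat \<Rightarrow> nat) \<Rightarrow> nat \<Rightarrow> 'k" where
  "shifted_point n r c \<mu> l = c + of_nat (n - l) * r + of_nat (\<mu> l)"

text \<open>The condition that \<open>r\<close> is not a negative rational number, with the fraction
  cleared: the form in which it meets differences of coordinates.\<close>

definition regular_parameter :: "'k::field_char_0 \<Rightarrow> bool" where
  "regular_parameter r \<longleftrightarrow> (\<forall>a b::nat. b > 0 \<longrightarrow> of_nat a * r + of_nat b \<noteq> 0)"

lemma decreasing_le:
  assumes "decreasing m n \<mu>" "m < a" "a \<le> b" "b \<le> n"
  shows "\<mu> b \<le> \<mu> a"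
  using assms(3,4)
proof (induction b rule: dec_induct)
  case (step k)
  have "k \<in> {Suc m..<n}" using step assms(2) by auto
  then have "\<mu> (Suc k) \<le> \<mu> k" using assms(1) unfolding decreasing_def by blast
  then show ?case using step by simp
qed simp

text \<open>The reflection \<open>l \<mapsto> n + m + 1 - l\<close> of the row indices. In the
  uniqueness proof the hyperplanes belong to the parity class of \<open>n\<close>, the size to that
  of \<open>m + 1\<close>; the equality makes removal of a column lower size and degree by the same
  amount.\<close>

lemma card_same_parity:
  assumes "m \<le> n"
  shows "card {l \<in> {Suc m..n}. even (l + n)} = card {l \<in> {Suc m..n}. odd (l + m)}"
proof (rule bij_betw_same_card[of "\<lambda>l. n + Suc m - l"], rule bij_betwI[of _ _ _ "\<lambda>l. n + Suc m - l"])
  show "(\<lambda>l. n + Suc m - l) \<in> {l \<in> {Suc m..n}. even (l + n)} \<rightarrow> {l \<in> {Suc m..n}. odd (l + m)}"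
    by auto
  show "(\<lambda>l. n + Suc m - l) \<in> {l \<in> {Suc m..n}. odd (l + m)} \<rightarrow> {l \<in> {Suc m..n}. even (l + n)}"
    by auto
qed auto

text \<open>Weights with last row zero are weights with one row less, so the outer induction on
  \<open>n\<close> gives vanishing on \<open>z n = c\<close>. Symmetry spreads this to all
  \<open>z l = c\<close> with \<open>l\<close> of the parity of \<open>n\<close>. The quotient by
  these forms vanishes at the weights without an empty row, which become arbitrary weights after
  removal of a column, and the inner induction on the degree finishes.\<close>

theorem vanishing_unique:
  fixes f :: "(nat \<Rightarrow> 'k::field_char_0) \<Rightarrow> 'k"
  assumes r: "regular_parameter r" and "m \<le> n"
    and "polyfun {Suc m..n} d f" "parity_sym {Suc m..n} f"
    and "\<And>\<mu>. decreasing m n \<mu> \<Longrightarrow> tail_odd_size m n \<mu> \<le> d \<Longrightarrow> f (shifted_point n r c \<mu>) = 0"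
  shows "f z = 0"
  using assms(2-)
proof (induction n arbitrary: c d f z rule: nat_less_induct)
  case (1 n)
  note outer = "1.IH" 
  show ?case using "1.prems"
  proof (induction d arbitrary: c f z rule: less_induct)
    case (less d)
    show ?case
    proof (cases "m = n")
      case True
      have "f z = f (shifted_point n r c (\<lambda>_. 0))" by (rule polyfun_cong[OF less.prems(2)]) (use True in auto)
      also have "\<dots> = 0" by (rule less.prems(4)) (auto simp: decreasing_def tail_odd_size_def)
      finally show ?thesis .
    next
      case False
      then obtain n' where n': "n = Suc n'" "m \<le> n'" using less.prems(1) by (cases n) auto
      let ?I = "{Suc m..n}" and ?I' = "{Suc m..n'}"
      have pf1: "polyfun ?I' d (\<lambda>z. f (z(n := c)))"
      proof (rule polyfun_subst[OF less.prems(2)])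
        fix i assume "i \<in> ?I"
        then show "polyfun ?I' 1 (\<lambda>z. (z(n := c)) i)"
          using polyfun.var[of i ?I' 0] by (cases "i = n") (auto simp: polyfun.const n')
      qed
      have f0: "f (z(n := c)) = 0" for z
      proof (rule outer[rule_format, OF _ n'(2) pf1])
        show "n' < n" using n' by simp
        show "parity_sym ?I' (\<lambda>z. f (z(n := c)))"
          unfolding parity_sym_def
        proof (intro ballI impI allI)
          fix a b z assume ab: "a \<in> ?I'" "b \<in> ?I'" "even (a + b)"
          have "(z \<circ> transpose a b)(n := c) = z(n := c) \<circ> transpose a b"
            using ab n' by (auto simp: fun_eq_iff transpose_def)
          moreover have "f (z(n := c) \<circ> transpose a b) = f (z(n := c))"
            using less.prems(3) ab n' unfolding parity_sym_def by auto
          ultimately show "f ((z \<circ> transpose a b)(n := c)) = f (z(n := c))" by simp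
        qed
        fix \<mu> assume mu: "decreasing m n' \<mu>" "tail_odd_size m n' \<mu> \<le> d"
        have "f ((shifted_point n' r (c + r) \<mu>)(n := c)) = f (shifted_point n r c (\<mu>(n := 0)))"
        proof (rule polyfun_cong[OF less.prems(2)])
          fix i assume "i \<in> ?I"
          show "((shifted_point n' r (c + r) \<mu>)(n := c)) i = shifted_point n r c (\<mu>(n := 0)) i"
          proof (cases "i = n")
            case False
            then have "n - i = Suc (n' - i)" using \<open>i \<in> ?I\<close> n' by auto
            then show ?thesis using False by (simp add: shifted_point_def algebra_simps)
          qed (simp add: shifted_point_def)
        qed
        also have "\<dots> = 0"
        proof (rule less.prems(4))
          show "decreasing m n (\<mu>(n := 0))" using mu(1) n' by (auto simp: decreasing_def)
          have "tail_odd_size m n (\<mu>(n := 0)) = tail_odd_size m n' \<mu>"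
            unfolding tail_odd_size_def by (rule sum.mono_neutral_cong_right) (auto simp: n' le_Suc_eq)
          then show "tail_odd_size m n (\<mu>(n := 0)) \<le> d" using mu(2) by simp
        qed
        finally show "f ((shifted_point n' r (c + r) \<mu>)(n := c)) = 0" .
      qed
      define L where "L = {l \<in> ?I. even (l + n)}"
      have L: "finite L" "L \<subseteq> ?I" "n \<in> L" using n' by (auto simp: L_def)
      have van: "f z = 0" if "l \<in> L" "z l = c" for l z
      proof -
        have "(z \<circ> transpose l n)(n := c) = z \<circ> transpose l n"
          using that by (auto simp: fun_eq_iff transpose_def)
        then have "f (z \<circ> transpose l n) = 0" using f0[of "z \<circ> transpose l n"] by simp
        moreover have "f (z \<circ> transpose l n) = f z"
          using less.prems(3) that L unfolding parity_sym_def L_def by auto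
        ultimately show ?thesis by simp
      qed
      have "\<exists>g. (\<forall>z. f z = (\<Prod>l\<in>L. z l - c) * g z) \<and> (d < card L \<longrightarrow> g = (\<lambda>_. 0)) \<and> polyfun ?I (d - card L) g"
        by (rule polyfun_divide_hyperplanes[OF L(1,2) less.prems(2)]) (rule van)
      then obtain g where gg: "\<forall>z. f z = (\<Prod>l\<in>L. z l - c) * g z" "d < card L \<longrightarrow> g = (\<lambda>_. 0)"
        "polyfun ?I (d - card L) g" by (elim exE conjE)
      note g = spec[OF gg(1)] gg(2,3)
      have cL: "card L > 0" using L by (auto simp: card_gt_0_iff)
      have "g z = 0" for z
      proof (cases "d < card L")
        case True then show ?thesis using g(2) by simp
      next
        case dL: False
        show ?thesis
        proof (rule less.IH[OF _ less.prems(1) g(3)])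
          show "d - card L < d" using cL dL by simp
          show "parity_sym ?I g"
            unfolding parity_sym_def
          proof (intro ballI impI allI)
            fix a b z assume ab: "a \<in> ?I" "b \<in> ?I" "even (a + b)"
            \<comment> \<open>\<open>g\<close> inherits the symmetry directly only where the product
              of the linear forms is nonzero; the line in the direction of all ones leaves the
              exceptional set.\<close>
            let ?h = "\<lambda>z. g (z \<circ> transpose a b) - g z"
            have "polyfun ?I 1 (\<lambda>z. (z \<circ> transpose a b) i)" if "i \<in> ?I" for i
              using that ab polyfun.var[of _ ?I 0] by (auto simp: transpose_def)
            then have "polyfun ?I (d - card L) ?h" by (intro polyfun_diff g(3) polyfun_subst[OF g(3)])
            then have "?h z = 0"
            proof (rule polyfun_line_density)
              let ?S = "(\<lambda>l. c - z l) ` L"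
              show "finite ?S" using L by simp
              fix t assume t: "t \<notin> ?S"
              let ?z = "\<lambda>l. z l + t * (\<lambda>_. 1) l"
              have ne: "(\<Prod>l\<in>L. ?z l - c) \<noteq> 0"
              proof -
                have "?z l - c \<noteq> 0" if "l \<in> L" for l
                proof
                  assume "?z l - c = 0"
                  then have "t = c - z l" by (simp add: algebra_simps)
                  then show False using that t by blast
                qed
                then show ?thesis using L(1) by simp
              qed
              have "even (a + n) \<longleftrightarrow> even (b + n)" using ab(3) by simp
              then have "a \<in> L \<longleftrightarrow> b \<in> L" using ab(1,2) by (simp add: L_def)
              then have bij: "bij_betw (transpose a b) L L" by (simp add: bij_betw_def)
              have "f (?z \<circ> transpose a b) = f ?z"
                by (rule parity_symD[OF less.prems(3) ab])
              moreover have "(\<Prod>l\<in>L. (?z \<circ> transpose a b) l - c) = (\<Prod>l\<in>L. ?z l - c)"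
                using prod.reindex_bij_betw[OF bij, of "\<lambda>l. ?z l - c"] by simp
              ultimately show "?h ?z = 0" using ne unfolding g(1) by simp
            qed
            then show "g (z \<circ> transpose a b) = g z" by simp
          qed
          fix \<mu> assume mu: "decreasing m n \<mu>" "tail_odd_size m n \<mu> \<le> d - card L"
          have p: "shifted_point n r (c + 1) \<mu> = shifted_point n r c (\<lambda>l. Suc (\<mu> l))" by (simp add: shifted_point_def fun_eq_iff)
          have "f (shifted_point n r c (\<lambda>l. Suc (\<mu> l))) = 0"
          proof (rule less.prems(4))
            show "decreasing m n (\<lambda>l. Suc (\<mu> l))" using mu by (simp add: decreasing_def)
            have "tail_odd_size m n (\<lambda>l. Suc (\<mu> l)) = tail_odd_size m n \<mu> + card L"
              unfolding L_def card_same_parity[OF less.prems(1)] by (simp only: tail_odd_size_def Suc_eq_plus1[of "\<mu> _"] sum.distrib) simp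
            then show "tail_odd_size m n (\<lambda>l. Suc (\<mu> l)) \<le> d" using mu dL by simp
          qed
          \<comment> \<open>A coordinate minus \<open>c\<close> is here \<open>(n - l) * r\<close>
            plus a positive integer, which is nonzero because \<open>r\<close> is regular.\<close>
          moreover have "(\<Prod>l\<in>L. shifted_point n r c (\<lambda>l. Suc (\<mu> l)) l - c) \<noteq> 0"
            using L(1) r[unfolded regular_parameter_def, rule_format, of "Suc _"] by (auto simp: shifted_point_def add.assoc simp del: of_nat_Suc)
          ultimately show "g (shifted_point n r (c + 1) \<mu>) = 0" unfolding p g(1) by simp
        qed
      qed
      then show ?thesis unfolding g(1) by simp
    qed
  qed
qed

subsection \<open>Divided differences and a difference operator\<close>

text \<open>Two coordinates moving at different speeds meet for exactly one \<open>t\<close>.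
  Together with density along lines this allows coordinates to be assumed distinct.\<close>

lemma inj_on_line_cofinite:
  fixes z w :: "nat \<Rightarrow> 'k::field_char_0"
  assumes "finite X" "inj_on w X"
  shows "\<exists>S. finite S \<and> (\<forall>t. t \<notin> S \<longrightarrow> inj_on (\<lambda>i. z i + t * w i) X)"
proof (intro exI[of _ "(\<lambda>(a, b). (z b - z a) / (w a - w b)) ` (X \<times> X)"] conjI allI impI inj_onI)
  show "finite ((\<lambda>(a, b). (z b - z a) / (w a - w b)) ` (X \<times> X))" using assms by simp
  fix t a b assume t: "t \<notin> (\<lambda>(a, b). (z b - z a) / (w a - w b)) ` (X \<times> X)"
    and ab: "a \<in> X" "b \<in> X" and eq: "z a + t * w a = z b + t * w b"
  show "a = b"
  proof (rule ccontr)
    assume "a \<noteq> b"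
    then have "w a - w b \<noteq> 0" using assms(2) ab by (auto dest: inj_onD)
    moreover have "t * (w a - w b) = z b - z a" using eq by (simp add: algebra_simps)
    ultimately have "t = (z b - z a) / (w a - w b)" by (simp add: field_simps)
    then have "t \<in> (\<lambda>(a, b). (z b - z a) / (w a - w b)) ` (X \<times> X)" using ab by (intro image_eqI[of _ _ "(a, b)"]) auto
    then show False using t by blast
  qed
qed

text \<open>Newton's recursion: the sum over \<open>X\<close> is the difference of the sums over
  \<open>X - {q}\<close> and \<open>X - {p}\<close>, divided by \<open>z p - z q\<close>. Agreement
  of \<open>F a\<close> and \<open>F b\<close> on \<open>z a = z b\<close> makes the numerator
  vanish on \<open>z p = z q\<close>, so each step is a polynomial division that costs one
  degree.\<close>

lemma divided_difference:
  fixes F :: "nat \<Rightarrow> (nat \<Rightarrow> 'k::field_char_0) \<Rightarrow> 'k"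
  assumes "finite X" "X \<noteq> {}" "X \<subseteq> I"
    and "\<And>i. i \<in> X \<Longrightarrow> polyfun I (e + (card X - 1)) (F i)"
    and "\<And>a b z. a \<in> X \<Longrightarrow> b \<in> X \<Longrightarrow> z a = z b \<Longrightarrow> F a z = F b z"
  shows "\<exists>h. polyfun I e h \<and> (\<forall>z. inj_on z X \<longrightarrow> h z = (\<Sum>i\<in>X. F i z / (\<Prod>k\<in>X - {i}. z i - z k)))"
  using assms
proof (induction "card X" arbitrary: X e)
  case 0
  have False using "0.hyps" "0.prems"(1,2) by simp
  then show ?case ..
next
  case (Suc c)
  show ?case
  proof (cases "\<exists>p. X = {p}")
    case True
    then obtain p where "X = {p}" by blast
    then show ?thesis using Suc.prems(4)[of p] by (intro exI[of _ "F p"]) simp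
  next
    case False
    then obtain p q where pq: "p \<in> X" "q \<in> X" "p \<noteq> q" using Suc.prems(2) by blast
    define Y where "Y = X - {p, q}"
    have Y: "finite Y" "p \<notin> Y" "q \<notin> Y" "X = insert p (insert q Y)" using Suc.prems(1) pq by (auto simp: Y_def)
    have cX: "card X = Suc (Suc (card Y))" using Y pq by simp
    have IH: "\<exists>h. polyfun I (Suc e) h \<and> (\<forall>z. inj_on z (insert u Y) \<longrightarrow>
        h z = (\<Sum>i\<in>insert u Y. F i z / (\<Prod>k\<in>insert u Y - {i}. z i - z k)))" if u: "u = p \<or> u = q" for u
    proof (rule Suc.hyps(1))
      show "c = card (insert u Y)" using Suc.hyps(2) cX Y(1-3) u by auto
      have sub: "insert u Y \<subseteq> X" using u pq by (auto simp: Y_def)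
      then show "insert u Y \<subseteq> I" using Suc.prems(3) by blast
      show "polyfun I (Suc e + (card (insert u Y) - 1)) (F i)" if "i \<in> insert u Y" for i
      proof -
        have "card (insert u Y) = Suc (card Y)" using u Y by auto
        then show ?thesis using Suc.prems(4)[of i] that sub cX by auto
      qed
      show "F a z = F b z" if "a \<in> insert u Y" "b \<in> insert u Y" "z a = z b" for a b z
        by (rule Suc.prems(5)) (use that sub in auto)
    qed (use Y in auto)
    have form: "(\<Sum>i\<in>insert u Y. F i z / (\<Prod>k\<in>insert u Y - {i}. z i - z k)) =
        F u z / (\<Prod>k\<in>Y. z u - z k) + (\<Sum>i\<in>Y. F i z / (\<Prod>k\<in>Y - {i}. z i - z k) / (z i - z u))"
      if "u = p \<or> u = q" for u and z :: "nat \<Rightarrow> 'k"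
    proof -
      have u: "u \<notin> Y" using that Y by blast
      have "F i z / (\<Prod>k\<in>insert u Y - {i}. z i - z k) = F i z / (\<Prod>k\<in>Y - {i}. z i - z k) / (z i - z u)"
        if "i \<in> Y" for i
      proof -
        have "insert u Y - {i} = insert u (Y - {i})" using u that by auto
        then show ?thesis using u Y(1) by (simp add: mult.commute)
      qed
      moreover have "insert u Y - {u} = Y" using u by auto
      ultimately show ?thesis using u Y(1) by (simp cong: sum.cong del: divide_divide_eq_left)
    qed
    from IH[OF disjI1[OF refl], unfolded form[OF disjI1[OF refl]]] obtain hp where hp: "polyfun I (Suc e) hp" "\<forall>z. inj_on z (insert p Y) \<longrightarrow>
        hp z = F p z / (\<Prod>k\<in>Y. z p - z k) + (\<Sum>i\<in>Y. F i z / (\<Prod>k\<in>Y - {i}. z i - z k) / (z i - z p))"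
      by (elim exE conjE)
    from IH[OF disjI2[OF refl], unfolded form[OF disjI2[OF refl]]] obtain hq where hq: "polyfun I (Suc e) hq" "\<forall>z. inj_on z (insert q Y) \<longrightarrow>
        hq z = F q z / (\<Prod>k\<in>Y. z q - z k) + (\<Sum>i\<in>Y. F i z / (\<Prod>k\<in>Y - {i}. z i - z k) / (z i - z q))"
      by (elim exE conjE)
    have pfd: "polyfun I (Suc e) (\<lambda>z. hp z - hq z)" by (rule polyfun_diff[OF hp(1) hq(1)])
    have pI: "p \<in> I" and qI: "polyfun I 1 (\<lambda>z. z q)" 
      using pq Suc.prems(3) polyfun.var[of q I 0] by auto
    have van: "hp (z(p := z q)) - hq (z(p := z q)) = 0" for z
    proof -
      \<comment> \<open>\<open>p\<close> and \<open>q\<close> get the same speed, so the line stays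
        in the hyperplane \<open>z p = z q\<close>, while the coordinates within each of the two
        smaller sets become distinct.\<close>
      define w :: "nat \<Rightarrow> 'k" where "w l = of_nat (if l = p then q else l)" for l
      have "inj_on w (insert p Y)" "inj_on w (insert q Y)" using Y(2,3) by (auto simp: w_def inj_on_def)
      note inj = inj_on_line_cofinite[OF finite.insertI[OF Y(1)] this(1), of "z(p := z q)"]
        inj_on_line_cofinite[OF finite.insertI[OF Y(1)] this(2), of "z(p := z q)"]
      from inj(1) obtain S where S0: "finite S" "\<forall>t. t \<notin> S \<longrightarrow> inj_on (\<lambda>i. (z(p := z q)) i + t * w i) (insert p Y)"
        by (elim exE conjE)
      from inj(2) obtain S' where S0': "finite S'" "\<forall>t. t \<notin> S' \<longrightarrow> inj_on (\<lambda>i. (z(p := z q)) i + t * w i) (insert q Y)"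
        by (elim exE conjE)
      note S = S0(1) S0(2)[rule_format] and S' = S0'(1) S0'(2)[rule_format]
      show ?thesis
      proof (rule polyfun_line_density[OF pfd, of "S \<union> S'" _ w])
        fix t assume t: "t \<notin> S \<union> S'"
        define z' where "z' = (\<lambda>i. (z(p := z q)) i + t * w i)"
        have eq: "z' p = z' q" by (simp add: w_def z'_def)
        then have "F p z' = F q z'" using pq by (intro Suc.prems(5)) auto
        moreover have "inj_on z' (insert p Y)" unfolding z'_def by (rule S(2)) (use t in blast)
        moreover have "inj_on z' (insert q Y)" unfolding z'_def by (rule S'(2)) (use t in blast)
        ultimately have "hp z' - hq z' = 0" using hp(2) hq(2) eq by simp
        then show "hp (\<lambda>i. (z(p := z q)) i + t * w i) - hq (\<lambda>i. (z(p := z q)) i + t * w i) = 0"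
          unfolding z'_def .
      qed (use S S' in simp)
    qed
    obtain h where h: "\<forall>z. hp z - hq z = (z p - z q) * h z" "Suc e = 0 \<longrightarrow> h = (\<lambda>_. 0)" "polyfun I (Suc e - 1) h"
      using polyfun_divide_hyperplane[OF pfd pI qI van] by (elim exE conjE)
    have "h z = (\<Sum>i\<in>X. F i z / (\<Prod>k\<in>X - {i}. z i - z k))" if inj: "inj_on z X" for z
    proof -
      have inj': "inj_on z (insert p Y)" "inj_on z (insert q Y)" using inj Y(4) by (auto intro: inj_on_subset)
      have ne: "z p - z q \<noteq> 0" using inj pq by (auto dest: inj_onD)
      have ne': "z i - z p \<noteq> 0" "z i - z q \<noteq> 0" if "i \<in> Y" for i
        using inj_onD[OF inj, of i p] inj_onD[OF inj, of i q] that Y by auto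
      have "(\<Sum>i\<in>X. F i z / (\<Prod>k\<in>X - {i}. z i - z k)) = 
         F p z / (\<Prod>k\<in>X - {p}. z p - z k) + F q z / (\<Prod>k\<in>X - {q}. z q - z k)
         + (\<Sum>i\<in>Y. F i z / (\<Prod>k\<in>X - {i}. z i - z k))"
        unfolding Y(4) using Y(1-3) pq(3) by simp
      also have "X - {p} = insert q Y" using Y pq by auto
      also have "X - {q} = insert p Y" using Y pq by auto
      also have "(\<Sum>i\<in>Y. F i z / (\<Prod>k\<in>X - {i}. z i - z k)) =
         (\<Sum>i\<in>Y. (F i z / (\<Prod>k\<in>Y - {i}. z i - z k) / (z i - z p)
                - F i z / (\<Prod>k\<in>Y - {i}. z i - z k) / (z i - z q)) / (z p - z q))"
      proof (rule sum.cong)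
        fix i assume i: "i \<in> Y"
        have "X - {i} = insert p (insert q (Y - {i}))" using Y i by auto
        then have "(\<Prod>k\<in>X - {i}. z i - z k) = (z i - z p) * ((z i - z q) * (\<Prod>k\<in>Y - {i}. z i - z k))"
          using Y pq by simp
        \<comment> \<open>Partial fractions, used with \<open>a = z i - z p\<close> and
          \<open>b = z i - z q\<close>, whose difference \<open>b - a = z p - z q\<close> does not
          depend on \<open>i\<close>.\<close>
        moreover have gen: "c / (a * (b * P)) = (c / P / a - c / P / b) / (b - a)"
          if "a \<noteq> 0" "b \<noteq> 0" "b - a \<noteq> 0" for a b c P :: 'k
          using that by (cases "P = 0") (simp_all add: field_simps)
        ultimately show "F i z / (\<Prod>k\<in>X - {i}. z i - z k) = (F i z / (\<Prod>k\<in>Y - {i}. z i - z k) / (z i - z p)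
                - F i z / (\<Prod>k\<in>Y - {i}. z i - z k) / (z i - z q)) / (z p - z q)"
          using gen[OF ne'[OF i], of "F i z" "\<Prod>k\<in>Y - {i}. z i - z k"] ne by simp
      qed simp
      also have "\<dots> = ((\<Sum>i\<in>Y. F i z / (\<Prod>k\<in>Y - {i}. z i - z k) / (z i - z p))
                - (\<Sum>i\<in>Y. F i z / (\<Prod>k\<in>Y - {i}. z i - z k) / (z i - z q))) / (z p - z q)"
        unfolding sum_divide_distrib[symmetric] sum_subtractf ..
      also have "F p z / (\<Prod>k\<in>insert q Y. z p - z k) + F q z / (\<Prod>k\<in>insert p Y. z q - z k) + \<dots>
        = (hp z - hq z) / (z p - z q)"
      proof -
        have "a / (x * P) + b / (- x * Q) + (u - v) / x = ((a / P + u) - (b / Q + v)) / x" for a b P Q u v x :: 'k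
          by (simp add: add_divide_distrib diff_divide_distrib mult.commute)
        from this[of "F p z" "z p - z q" _ "F q z"] show ?thesis
          unfolding hp(2)[rule_format, OF inj'(1)] hq(2)[rule_format, OF inj'(2)]
          using Y(1-3) by simp
      qed
      finally show ?thesis using spec[OF h(1), of z] ne by simp
    qed
    then show ?thesis using h(3) by auto
  qed
qed

section \<open>The difference operator and its coefficients\<close>

definition odds :: "nat \<Rightarrow> nat set" where "odds n = {i \<in> {Suc 0..n}. odd i}"
definition evens :: "nat \<Rightarrow> nat set" where "evens n = {i \<in> {Suc 0..n}. even i}"

lemma finite_odds [simp]: "finite (odds n)" and finite_evens [simp]: "finite (evens n)"
  by (simp_all add: odds_def evens_def)

lemma card_odds: "card (odds n) = card (evens n) + of_bool (odd n)"
proof (induction n)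
  case 0 show ?case by (simp add: odds_def evens_def)
next
  case (Suc n)
  have "odds (Suc n) = (if even n then insert (Suc n) (odds n) else odds n)"
    "evens (Suc n) = (if odd n then insert (Suc n) (evens n) else evens n)"
    by (auto simp: odds_def evens_def le_Suc_eq)
  moreover have "Suc n \<notin> odds n" "Suc n \<notin> evens n" by (auto simp: odds_def evens_def)
  ultimately show ?case using Suc.IH by simp
qed

text \<open>The variable \<open>z 0\<close> plays the role of the parameter \<open>r\<close>: keeping it variable makes it possible
  to evaluate the operator at \<open>r = 0\<close>, where the denominators vanish at some of the shifted
  weights, as a limit.  The factors \<open>z i - z k - z 0\<close> with \<open>k = Suc i\<close>, and the first factor when
  \<open>n\<close> is one of the indices, kill the terms in which removing boxes from a partition does not leave a partition.\<close>

definition coeff_single :: "nat \<Rightarrow> nat \<Rightarrow> (nat \<Rightarrow> 'k::field_char_0) \<Rightarrow> 'k" where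
  "coeff_single n i z = (if odd n then z i else 1) * (\<Prod>k\<in>evens n. z i - z k - z 0) / (\<Prod>k\<in>odds n - {i}. z i - z k)"

definition coeff_pair :: "nat \<Rightarrow> nat \<Rightarrow> nat \<Rightarrow> (nat \<Rightarrow> 'k::field_char_0) \<Rightarrow> 'k" where
  "coeff_pair n i j z = (if odd n then z i else z j)
     * (\<Prod>k\<in>evens n - {j}. z i - z k - z 0) * (\<Prod>k\<in>odds n - {i}. z j - z k - z 0)
     / ((\<Prod>k\<in>odds n - {i}. z i - z k) * (\<Prod>k\<in>evens n - {j}. z j - z k))"

definition translate :: "nat set \<Rightarrow> (nat \<Rightarrow> 'k::field_char_0) \<Rightarrow> nat \<Rightarrow> 'k" where
  "translate A z l = z l - of_bool (l \<in> A)"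

definition difference_operator :: "nat \<Rightarrow> ((nat \<Rightarrow> 'k::field_char_0) \<Rightarrow> 'k) \<Rightarrow> (nat \<Rightarrow> 'k) \<Rightarrow> 'k" where
  "difference_operator n f z = (\<Sum>i\<in>odds n. coeff_single n i z * (f z - f (translate {i} z)))
     + (\<Sum>i\<in>odds n. \<Sum>j\<in>evens n. coeff_pair n i j z * (f z - f (translate {i, j} z)))"

text \<open>The compatibility needed for divided differences: where \<open>z a = z b\<close>,
  lowering coordinate \<open>a\<close> or coordinate \<open>b\<close> gives points that differ by a
  transposition, which a symmetric function does not see.\<close>

lemma translate_transpose:
  "z a = z b \<Longrightarrow> a \<notin> A \<Longrightarrow> b \<notin> A \<Longrightarrow> translate (insert b A) z = translate (insert a A) z \<circ> transpose a b"
  by (rule ext) (simp add: translate_def transpose_def)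

lemma prod_remove_eq:
  assumes "finite X" "a \<in> X" "b \<in> X" "g a = g b"
  shows "prod g (X - {a}) = prod g (X - {b})"
proof (cases "a = b")
  case False
  define Y where "Y = X - {a, b}"
  have "X - {a} = insert b Y" "X - {b} = insert a Y" "finite Y" "a \<notin> Y" "b \<notin> Y"
    using assms(1-3) False by (auto simp: Y_def)
  then show ?thesis using assms(4) by simp
qed simp

text \<open>Each coefficient has degree one as a rational function: for odd \<open>n\<close> the
  factor \<open>z i\<close> in \<open>coeff_single\<close> makes up for the one extra odd index in
  the denominator. A difference of \<open>f\<close> loses one degree, so the bound \<open>d\<close>
  is preserved. The poles on coinciding coordinates cancel by divided differences, taken for the
  pair terms first over the odd and then over the even indices.\<close>

lemma difference_operator_polynomial:
  fixes f :: "(nat \<Rightarrow> 'k::field_char_0) \<Rightarrow> 'k"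
  assumes "n \<ge> 1" "polyfun {Suc 0..n} d f" "parity_sym {Suc 0..n} f"
  shows "\<exists>h. polyfun {0..n} d h \<and> (\<forall>z. inj_on z (odds n) \<longrightarrow> inj_on z (evens n) \<longrightarrow> h z = difference_operator n f z)"
proof (cases d)
  case 0
  have "f = (\<lambda>_. f undefined)" using polyfun_degree_0[OF assms(2)[unfolded 0]] by (rule ext)
  then obtain c where "f = (\<lambda>_. c)" by (rule that)
  then have "difference_operator n f z = 0" for z by (simp add: difference_operator_def)
  then show ?thesis by (intro exI[of _ "\<lambda>_. 0"]) (simp add: polyfun.const)
next
  case (Suc d')
  let ?X = "odds n" and ?Y = "evens n" and ?I = "{0..n}"
  have XI: "?X \<subseteq> ?I" "?Y \<subseteq> ?I" "?X \<noteq> {}" and zI: "0 \<in> ?I" and dis: "?X \<inter> ?Y = {}"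
    using assms(1) by (auto simp: odds_def evens_def)
  have v: "polyfun ?I 1 (\<lambda>z. z i)" if "i \<in> ?I" for i using polyfun.var[OF that, of 0] by simp
  have lin: "polyfun ?I 1 (\<lambda>z. z i - z k - z 0)" if "i \<in> ?I" "k \<in> ?I" for i k
    by (intro polyfun_diff v that zI)
  have fI: "polyfun ?I (Suc d') f" using polyfun_subset[OF assms(2)] Suc by auto
  have dif: "polyfun ?I d' (\<lambda>z. f z - f (translate A z))" for A
    unfolding translate_def by (rule polyfun_translate_diff[OF fI])
  have fsym: "f (translate (insert a A) z) = f (translate (insert b A) z)"
    if "z a = z b" "a \<notin> A" "b \<notin> A" "a \<in> {Suc 0..n}" "b \<in> {Suc 0..n}" "even (a + b)" for a b A z
    unfolding translate_transpose[OF that(1-3)] by (rule parity_symD[OF assms(3) that(4-6), symmetric])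
  have cXY: "card ?X = card ?Y + of_bool (odd n)" by (rule card_odds)
  have cX: "card ?X > 0" using XI(3) by (simp add: card_gt_0_iff)

  define F1 where "F1 i z = (if odd n then z i else 1) * (\<Prod>k\<in>?Y. z i - z k - z 0) * (f z - f (translate {i} z))" for i z
  have "\<exists>h. polyfun ?I d h \<and> (\<forall>z. inj_on z ?X \<longrightarrow> h z = (\<Sum>i\<in>?X. F1 i z / (\<Prod>k\<in>?X - {i}. z i - z k)))"
  proof (rule divided_difference[OF finite_odds XI(3,1)])
    fix i assume i: "i \<in> ?X"
    have "polyfun ?I (of_bool (odd n)) (\<lambda>z. if odd n then z i else 1)"
      using v[of i] i XI by (cases "odd n") (auto simp: polyfun.const)
    moreover have "polyfun ?I (card ?Y) (\<lambda>z. \<Prod>k\<in>?Y. z i - z k - z 0)"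
      by (rule polyfun_prod_linear, rule lin) (use i XI in auto)
    ultimately have "polyfun ?I (card ?X) (\<lambda>z. (if odd n then z i else 1) * (\<Prod>k\<in>?Y. z i - z k - z 0))"
      by (rule polyfun.mult) (simp add: cXY)
    then show "polyfun ?I (d + (card ?X - 1)) (F1 i)"
      unfolding F1_def by (rule polyfun.mult[OF _ dif]) (use cX Suc in simp)
  next
    fix a b and z :: "nat \<Rightarrow> 'k" assume ab: "a \<in> ?X" "b \<in> ?X" "z a = z b"
    then have "f (translate {a} z) = f (translate {b} z)" by (intro fsym) (auto simp: odds_def)
    then show "F1 a z = F1 b z" by (simp add: F1_def ab(3))
  qed
  then obtain h1 where h1: "polyfun ?I d h1" "\<forall>z. inj_on z ?X \<longrightarrow> h1 z = (\<Sum>i\<in>?X. F1 i z / (\<Prod>k\<in>?X - {i}. z i - z k))"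
    by (elim exE conjE)

  define F2 where "F2 j i z = (if odd n then z i else z j) * (\<Prod>k\<in>?Y - {j}. z i - z k - z 0)
    * (\<Prod>k\<in>?X - {i}. z j - z k - z 0) * (f z - f (translate {i, j} z))" for i j z
  have "\<exists>h. polyfun ?I (d + (card ?Y - 1)) h \<and> (\<forall>z. inj_on z ?X \<longrightarrow> h z = (\<Sum>i\<in>?X. F2 j i z / (\<Prod>k\<in>?X - {i}. z i - z k)))"
    if j: "j \<in> ?Y" for j
  proof (rule divided_difference[OF finite_odds XI(3,1)])
    have cY: "card ?Y > 0" using j by (auto simp: card_gt_0_iff)
    fix i assume i: "i \<in> ?X"
    have ij: "i \<in> ?I" "j \<in> ?I" using i j XI by auto
    have "polyfun ?I 1 (\<lambda>z. if odd n then z i else z j)"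
      using v[OF ij(1)] v[OF ij(2)] by (cases "odd n") auto
    moreover have "polyfun ?I (card ?Y - 1) (\<lambda>z. \<Prod>k\<in>?Y - {j}. z i - z k - z 0)"
    proof -
      have "polyfun ?I (card (?Y - {j})) (\<lambda>z. \<Prod>k\<in>?Y - {j}. z i - z k - z 0)"
        by (rule polyfun_prod_linear, rule lin) (use ij XI in auto)
      then show ?thesis using j by simp
    qed
    ultimately have "polyfun ?I (card ?Y) (\<lambda>z. (if odd n then z i else z j) * (\<Prod>k\<in>?Y - {j}. z i - z k - z 0))"
      by (rule polyfun.mult) (use cY in simp)
    moreover have "polyfun ?I (card ?X - 1) (\<lambda>z. \<Prod>k\<in>?X - {i}. z j - z k - z 0)"
    proof -
      have "polyfun ?I (card (?X - {i})) (\<lambda>z. \<Prod>k\<in>?X - {i}. z j - z k - z 0)"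
        by (rule polyfun_prod_linear, rule lin) (use ij XI in auto)
      then show ?thesis using i by simp
    qed
    ultimately have "polyfun ?I (card ?Y + (card ?X - 1)) (\<lambda>z. (if odd n then z i else z j)
       * (\<Prod>k\<in>?Y - {j}. z i - z k - z 0) * (\<Prod>k\<in>?X - {i}. z j - z k - z 0))"
      by (rule polyfun.mult) simp
    then show "polyfun ?I (d + (card ?Y - 1) + (card ?X - 1)) (F2 j i)"
      unfolding F2_def by (rule polyfun.mult[OF _ dif]) (use cY Suc in simp)
  next
    fix a b and z :: "nat \<Rightarrow> 'k" assume ab: "a \<in> ?X" "b \<in> ?X" "z a = z b"
    then have "f (translate {a, j} z) = f (translate {b, j} z)" using j by (intro fsym) (auto simp: odds_def evens_def)
    moreover have "(\<Prod>k\<in>?X - {a}. z j - z k - z 0) = (\<Prod>k\<in>?X - {b}. z j - z k - z 0)"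
      by (rule prod_remove_eq) (use ab in auto)
    ultimately show "F2 j a z = F2 j b z" by (simp add: F2_def ab(3))
  qed
  then have "\<exists>G. \<forall>j\<in>?Y. polyfun ?I (d + (card ?Y - 1)) (G j) \<and>
      (\<forall>z. inj_on z ?X \<longrightarrow> G j z = (\<Sum>i\<in>?X. F2 j i z / (\<Prod>k\<in>?X - {i}. z i - z k)))"
    by (intro bchoice) blast
  then obtain G where G: "\<forall>j\<in>?Y. polyfun ?I (d + (card ?Y - 1)) (G j) \<and>
      (\<forall>z. inj_on z ?X \<longrightarrow> G j z = (\<Sum>i\<in>?X. F2 j i z / (\<Prod>k\<in>?X - {i}. z i - z k)))"
    by (elim exE)
  have "\<exists>h. polyfun ?I d h \<and> (\<forall>z. inj_on z ?Y \<longrightarrow> h z = (\<Sum>j\<in>?Y. G j z / (\<Prod>k\<in>?Y - {j}. z j - z k)))"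
  proof (cases "?Y = {}")
    case True
    then show ?thesis by (intro exI[of _ "\<lambda>_. 0"]) (simp add: polyfun.const)
  next
    case False
    show ?thesis
    proof (rule divided_difference[OF finite_evens False XI(2)])
      show "polyfun ?I (d + (card ?Y - 1)) (G j)" if "j \<in> ?Y" for j using G that by blast
      fix a b and z :: "nat \<Rightarrow> 'k" assume ab: "a \<in> ?Y" "b \<in> ?Y" "z a = z b"
      \<comment> \<open>Only odd coordinates move, so \<open>z a = z b\<close> persists for the even
        indices \<open>a\<close> and \<open>b\<close>, while the odd coordinates become distinct, as
        the formula for \<open>G\<close> requires.\<close>
      define w :: "nat \<Rightarrow> 'k" where "w l = (if odd l then of_nat l else 0)" for l
      have "inj_on w ?X" by (auto simp: inj_on_def w_def odds_def)
      from inj_on_line_cofinite[OF finite_odds this, of z]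
      obtain S where S0: "finite S" "\<forall>t. t \<notin> S \<longrightarrow> inj_on (\<lambda>i. z i + t * w i) ?X"
        by (elim exE conjE)
      note S = S0(1) S0(2)[rule_format]
      have "G a z - G b z = 0"
      proof (rule polyfun_line_density[where f = "\<lambda>z. G a z - G b z" and w = w, OF _ S(1)])
        show "polyfun ?I (d + (card ?Y - 1)) (\<lambda>z. G a z - G b z)" using G ab by (intro polyfun_diff) auto
        fix t assume t: "t \<notin> S"
        let ?z = "\<lambda>i. z i + t * w i"
        have eq: "?z a = ?z b" using ab by (simp add: w_def evens_def)
        have "F2 a i ?z = F2 b i ?z" if i: "i \<in> ?X" for i
        proof -
          have "f (translate {a, i} ?z) = f (translate {b, i} ?z)"
            using i ab eq by (intro fsym) (auto simp: odds_def evens_def)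
          moreover have "(\<Prod>k\<in>?Y - {a}. ?z i - ?z k - ?z 0) = (\<Prod>k\<in>?Y - {b}. ?z i - ?z k - ?z 0)"
            by (rule prod_remove_eq) (use ab eq in auto)
          ultimately show ?thesis unfolding F2_def insert_commute[of i] eq by simp
        qed
        then show "G a ?z - G b ?z = 0" using G ab S(2)[OF t] by simp
      qed
      then show "G a z = G b z" by simp
    qed
  qed
  then obtain h2 where h2: "polyfun ?I d h2" "\<forall>z. inj_on z ?Y \<longrightarrow> h2 z = (\<Sum>j\<in>?Y. G j z / (\<Prod>k\<in>?Y - {j}. z j - z k))"
    by (elim exE conjE)
  have "h1 z + h2 z = difference_operator n f z" if inj: "inj_on z ?X" "inj_on z ?Y" for z
  proof -
    have "h1 z = (\<Sum>i\<in>?X. coeff_single n i z * (f z - f (translate {i} z)))"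
      using h1(2) inj(1) by (simp add: F1_def coeff_single_def)
    moreover have "h2 z = (\<Sum>i\<in>?X. \<Sum>j\<in>?Y. coeff_pair n i j z * (f z - f (translate {i, j} z)))"
    proof -
      have "h2 z = (\<Sum>j\<in>?Y. G j z / (\<Prod>k\<in>?Y - {j}. z j - z k))" using h2(2) inj(2) by blast
      also have "\<dots> = (\<Sum>j\<in>?Y. \<Sum>i\<in>?X. coeff_pair n i j z * (f z - f (translate {i, j} z)))"
      proof (rule sum.cong[OF refl])
        fix j assume "j \<in> ?Y"
        then have "G j z = (\<Sum>i\<in>?X. F2 j i z / (\<Prod>k\<in>?X - {i}. z i - z k))" using G inj(1) by blast
        then show "G j z / (\<Prod>k\<in>?Y - {j}. z j - z k) = (\<Sum>i\<in>?X. coeff_pair n i j z * (f z - f (translate {i, j} z)))"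
          unfolding F2_def coeff_pair_def by (simp only: sum_divide_distrib divide_divide_eq_left times_divide_eq_left)
      qed
      also have "\<dots> = (\<Sum>i\<in>?X. \<Sum>j\<in>?Y. coeff_pair n i j z * (f z - f (translate {i, j} z)))" by (rule sum.swap)
      finally show ?thesis .
    qed
    ultimately show ?thesis by (simp add: difference_operator_def)
  qed
  then show ?thesis using polyfun.add[OF h1(1) h2(1)] by (intro exI[of _ "\<lambda>z. h1 z + h2 z"]) simp
qed

subsection \<open>Regular values of the coefficients\<close>

text \<open>The field carries no topology, so limits at \<open>0\<close> are taken algebraically, in rational functions.\<close>

definition regular_limit :: "('k::field_char_0 \<Rightarrow> 'k) \<Rightarrow> 'k \<Rightarrow> bool" where
  "regular_limit g c \<longleftrightarrow> (\<exists>P Q S. finite S \<and> (\<forall>s. s \<notin> S \<longrightarrow> g s * poly Q s = poly P s) \<and> poly Q 0 \<noteq> 0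
     \<and> c = poly P 0 / poly Q 0)"

lemma regular_limitI:
  "finite S \<Longrightarrow> (\<And>s. s \<notin> S \<Longrightarrow> g s * poly Q s = poly P s) \<Longrightarrow> poly Q 0 \<noteq> 0 \<Longrightarrow> c = poly P 0 / poly Q 0 \<Longrightarrow> regular_limit g c"
  unfolding regular_limit_def by (intro exI[of _ P] exI[of _ Q] exI[of _ S]) simp

lemma regular_limit_poly: "regular_limit (\<lambda>s. poly p s) (poly p 0)"
  by (rule regular_limitI[of "{}" _ 1]) simp_all

lemma regular_limit_const: "regular_limit (\<lambda>s. c) c"
  using regular_limit_poly[of "[:c:]"] by simp

lemma regular_limit_add:
  assumes "regular_limit f a" "regular_limit g b" shows "regular_limit (\<lambda>s. f s + g s) (a + b)"
proof -
  from assms(1) obtain P Q S where 1: "finite S" "\<forall>s. s \<notin> S \<longrightarrow> f s * poly Q s = poly P s" "poly Q 0 \<noteq> 0"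
    "a = poly P 0 / poly Q 0" unfolding regular_limit_def by (elim exE conjE)
  from assms(2) obtain P' Q' S' where 2: "finite S'" "\<forall>s. s \<notin> S' \<longrightarrow> g s * poly Q' s = poly P' s" "poly Q' 0 \<noteq> 0"
    "b = poly P' 0 / poly Q' 0" unfolding regular_limit_def by (elim exE conjE)
  show ?thesis
  proof (rule regular_limitI[of "S \<union> S'" _ "Q * Q'" "P * Q' + P' * Q"])
    fix s assume "s \<notin> S \<union> S'"
    then have "f s * poly Q s = poly P s" "g s * poly Q' s = poly P' s" using 1 2 by simp_all
    then have "(f s * poly Q s) * poly Q' s + (g s * poly Q' s) * poly Q s = poly (P * Q' + P' * Q) s" by simp
    then show "(f s + g s) * poly (Q * Q') s = poly (P * Q' + P' * Q) s" by (simp add: algebra_simps)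
  qed (use 1 2 in \<open>simp_all add: add_frac_eq\<close>)
qed

lemma regular_limit_mult:
  assumes "regular_limit f a" "regular_limit g b" shows "regular_limit (\<lambda>s. f s * g s) (a * b)"
proof -
  from assms(1) obtain P Q S where 1: "finite S" "\<forall>s. s \<notin> S \<longrightarrow> f s * poly Q s = poly P s" "poly Q 0 \<noteq> 0"
    "a = poly P 0 / poly Q 0" unfolding regular_limit_def by (elim exE conjE)
  from assms(2) obtain P' Q' S' where 2: "finite S'" "\<forall>s. s \<notin> S' \<longrightarrow> g s * poly Q' s = poly P' s" "poly Q' 0 \<noteq> 0"
    "b = poly P' 0 / poly Q' 0" unfolding regular_limit_def by (elim exE conjE)
  show ?thesis
  proof (rule regular_limitI[of "S \<union> S'" _ "Q * Q'" "P * P'"])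
    fix s assume "s \<notin> S \<union> S'"
    then have "f s * poly Q s = poly P s" "g s * poly Q' s = poly P' s" using 1 2 by simp_all
    then have "(f s * poly Q s) * (g s * poly Q' s) = poly (P * P') s" by simp
    then show "(f s * g s) * poly (Q * Q') s = poly (P * P') s" by (simp add: algebra_simps)
  qed (use 1 2 in simp_all)
qed

lemma regular_limit_sum: "(\<And>a. a \<in> A \<Longrightarrow> regular_limit (g a) (c a)) \<Longrightarrow> regular_limit (\<lambda>s. \<Sum>a\<in>A. g a s) (\<Sum>a\<in>A. c a)"
  by (induction A rule: infinite_finite_induct) (simp_all add: regular_limit_const regular_limit_add)

text \<open>Rational functions that agree outside a finite set agree at \<open>0\<close> as well
  when \<open>0\<close> is no pole. This ties the value of the polynomial operator to the limits of
  its terms.\<close>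

lemma regular_limit_unique_poly:
  assumes "regular_limit g c" "finite T" "\<And>s. s \<notin> T \<Longrightarrow> g s = poly p s"
  shows "c = poly p 0"
proof -
  from assms(1) obtain P Q S where 1: "finite S" "\<forall>s. s \<notin> S \<longrightarrow> g s * poly Q s = poly P s" "poly Q 0 \<noteq> 0"
    "c = poly P 0 / poly Q 0" unfolding regular_limit_def by (elim exE conjE)
  have "p * Q = P"
  proof (rule poly_cofinite_eq[of "S \<union> T"])
    fix s assume "s \<notin> S \<union> T"
    then have "g s * poly Q s = poly P s" "g s = poly p s" using 1(2) assms(3) by blast+
    then show "poly (p * Q) s = poly P s" by simp
  qed (use 1 assms in simp)
  then show ?thesis using 1 by auto
qed

text \<open>A factor vanishes at \<open>s = 0\<close> exactly when its constant term does. The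
  slopes \<open>a'\<close> are nonzero, so the denominator has order equal to the number of its
  vanishing factors; the numerator has at least the order given by its own, and the inequality of
  cardinalities excludes a pole.\<close>

lemma regular_limit_prod_ratio:
  fixes a b a' b' :: "'i \<Rightarrow> 'k::field_char_0"
  assumes "finite K" "finite K'" "\<And>k. k \<in> K' \<Longrightarrow> a' k \<noteq> 0"
    and "card {k \<in> K'. b' k = 0} \<le> card {k \<in> K. b k = 0}"
  shows "\<exists>c. regular_limit (\<lambda>s. (\<Prod>k\<in>K. a k * s + b k) / (\<Prod>k\<in>K'. a' k * s + b' k)) c"
proof -
  have split: "(\<Prod>k\<in>A. u k * s + v k)
      = s ^ card {k \<in> A. v k = 0} * poly ((\<Prod>k\<in>{k \<in> A. v k = 0}. [:u k:]) * (\<Prod>k\<in>{k \<in> A. v k \<noteq> 0}. [:v k, u k:])) s"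
    if "finite A" for A :: "'i set" and u v :: "'i \<Rightarrow> 'k" and s
  proof -
    have "(\<Prod>k\<in>A. u k * s + v k) = (\<Prod>k\<in>{k \<in> A. v k = 0} \<union> {k \<in> A. v k \<noteq> 0}. u k * s + v k)"
      by (rule prod.cong) auto
    also have "\<dots> = (\<Prod>k\<in>{k \<in> A. v k = 0}. u k * s + v k) * (\<Prod>k\<in>{k \<in> A. v k \<noteq> 0}. u k * s + v k)"
      by (rule prod.union_disjoint) (use that in auto)
    also have "(\<Prod>k\<in>{k \<in> A. v k = 0}. u k * s + v k) = (\<Prod>k\<in>{k \<in> A. v k = 0}. s * u k)"
      by (rule prod.cong) (auto simp: mult.commute)
    finally show ?thesis by (simp add: prod.distrib poly_prod algebra_simps)
  qed
  define N where "N = (\<Prod>k\<in>{k \<in> K. b k = 0}. [:a k:]) * (\<Prod>k\<in>{k \<in> K. b k \<noteq> 0}. [:b k, a k:])"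
  define D where "D = (\<Prod>k\<in>{k \<in> K'. b' k = 0}. [:a' k:]) * (\<Prod>k\<in>{k \<in> K'. b' k \<noteq> 0}. [:b' k, a' k:])"
  define e where "e = card {k \<in> K. b k = 0} - card {k \<in> K'. b' k = 0}"
  have D0: "poly D 0 \<noteq> 0" using assms(2,3) by (simp add: D_def poly_prod)
  then have "finite {s. poly D s = 0}" by (intro poly_roots_finite) auto
  show ?thesis
  proof (rule exI, rule regular_limitI[of "insert 0 {s. poly D s = 0}" _ D "monom 1 e * N", OF _ _ D0 refl])
    show "finite (insert 0 {s. poly D s = 0})" by (simp add: \<open>finite {s. poly D s = 0}\<close>)
    fix s assume "s \<notin> insert 0 {s. poly D s = 0}"
    then have s: "s \<noteq> 0" "poly D s \<noteq> 0" by auto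
    have "card {k \<in> K. b k = 0} = card {k \<in> K'. b' k = 0} + e" using assms(4) by (simp add: e_def)
    then show "(\<Prod>k\<in>K. a k * s + b k) / (\<Prod>k\<in>K'. a' k * s + b' k) * poly D s = poly (monom 1 e * N) s"
      unfolding split[OF assms(1)] split[OF assms(2)] N_def[symmetric] D_def[symmetric]
      using s by (simp add: power_add poly_monom)
  qed
qed

section \<open>Symmetry of the difference operator\<close>

lemma coeff_transpose:
  fixes z :: "nat \<Rightarrow> 'k::field_char_0"
  assumes "a \<in> {Suc 0..n}" "b \<in> {Suc 0..n}" "even (a + b)"
  shows "coeff_single n i (z \<circ> transpose a b) = coeff_single n (transpose a b i) z"
    and "coeff_pair n i j (z \<circ> transpose a b) = coeff_pair n (transpose a b i) (transpose a b j) z"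
    and "bij_betw (transpose a b) (odds n) (odds n)" "bij_betw (transpose a b) (evens n) (evens n)"
proof -
  let ?\<tau> = "transpose a b"
  have "a \<in> odds n \<longleftrightarrow> b \<in> odds n" "a \<in> evens n \<longleftrightarrow> b \<in> evens n"
    using assms by (auto simp: odds_def evens_def)
  then show bij: "bij_betw ?\<tau> (odds n) (odds n)" "bij_betw ?\<tau> (evens n) (evens n)"
    by (simp_all add: bij_betw_def)
  have bij': "bij_betw ?\<tau> (odds n - {i}) (odds n - {?\<tau> i})" "bij_betw ?\<tau> (evens n - {i}) (evens n - {?\<tau> i})" for i
  proof -
    have "?\<tau> ` (A - {i}) = A - {?\<tau> i}" if "?\<tau> ` A = A" for A
      using that by (simp add: image_set_diff)
    then show "bij_betw ?\<tau> (odds n - {i}) (odds n - {?\<tau> i})" "bij_betw ?\<tau> (evens n - {i}) (evens n - {?\<tau> i})"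
      using bij by (simp_all add: bij_betw_def inj_on_diff)
  qed
  have z0: "?\<tau> 0 = 0" using assms by (auto simp: transpose_def)
  note re = prod.reindex_bij_betw[OF bij'(1)] prod.reindex_bij_betw[OF bij'(2)] prod.reindex_bij_betw[OF bij(2)]
  show "coeff_single n i (z \<circ> ?\<tau>) = coeff_single n (?\<tau> i) z"
    unfolding coeff_single_def o_def z0
    by (simp only: re[of "\<lambda>k. z (?\<tau> i) - z k"] re[of "\<lambda>k. z (?\<tau> i) - z k - z 0"])
  show "coeff_pair n i j (z \<circ> ?\<tau>) = coeff_pair n (?\<tau> i) (?\<tau> j) z"
    unfolding coeff_pair_def o_def z0
    by (simp only: re[of "\<lambda>k. z (?\<tau> i) - z k"] re[of "\<lambda>k. z (?\<tau> i) - z k - z 0"]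
       re[of "\<lambda>k. z (?\<tau> j) - z k"] re[of "\<lambda>k. z (?\<tau> j) - z k - z 0"])
qed

lemma difference_operator_transpose:
  fixes f :: "(nat \<Rightarrow> 'k::field_char_0) \<Rightarrow> 'k"
  assumes f: "parity_sym {Suc 0..n} f" and ab: "a \<in> {Suc 0..n}" "b \<in> {Suc 0..n}" "even (a + b)"
  shows "difference_operator n f (z \<circ> transpose a b) = difference_operator n f z"
proof -
  let ?\<tau> = "transpose a b"
  have sh: "f (translate A (z \<circ> ?\<tau>)) = f (translate (?\<tau> ` A) z)" for A
  proof -
    have "?\<tau> l \<in> ?\<tau> ` A \<longleftrightarrow> l \<in> A" for l by (simp add: inj_image_mem_iff)
    then have "translate A (z \<circ> ?\<tau>) = translate (?\<tau> ` A) z \<circ> ?\<tau>" by (simp add: fun_eq_iff translate_def)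
    then show ?thesis using parity_symD[OF f ab] by simp
  qed
  note ct = coeff_transpose[OF ab]
  have "(\<Sum>i\<in>odds n. coeff_single n i (z \<circ> ?\<tau>) * (f (z \<circ> ?\<tau>) - f (translate {i} (z \<circ> ?\<tau>))))
     = (\<Sum>i\<in>odds n. coeff_single n (?\<tau> i) z * (f z - f (translate {?\<tau> i} z)))"
    by (simp only: ct(1) parity_symD[OF f ab] sh image_insert image_empty)
  moreover have "(\<Sum>i\<in>odds n. \<Sum>j\<in>evens n. coeff_pair n i j (z \<circ> ?\<tau>) * (f (z \<circ> ?\<tau>) - f (translate {i, j} (z \<circ> ?\<tau>))))
     = (\<Sum>i\<in>odds n. \<Sum>j\<in>evens n. coeff_pair n (?\<tau> i) (?\<tau> j) z * (f z - f (translate {?\<tau> i, ?\<tau> j} z)))"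
    by (simp only: ct(2) parity_symD[OF f ab] sh image_insert image_empty)
  ultimately show ?thesis unfolding difference_operator_def
    by (simp only: sum.reindex_bij_betw[OF ct(3), of "\<lambda>i. coeff_single n i z * (f z - f (translate {i} z))"]
      sum.reindex_bij_betw[OF ct(4), of "\<lambda>j. coeff_pair n (?\<tau> _) j z * (f z - f (translate {?\<tau> _, j} z))"]
      sum.reindex_bij_betw[OF ct(3), of "\<lambda>i. \<Sum>j\<in>evens n. coeff_pair n i j z * (f z - f (translate {i, j} z))"])
qed

text \<open>The parameter becomes \<open>r + s\<close> both in the staircase and in slot
  \<open>0\<close>. Hence \<open>z i - z (Suc i) - z 0\<close> equals
  \<open>\<mu> i - \<mu> (Suc i)\<close> for every \<open>s\<close>, and terms that leave the set of
  partitions vanish identically, not only in the limit.\<close>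

definition perturbed_point :: "nat \<Rightarrow> 'k::field_char_0 \<Rightarrow> (nat \<Rightarrow> nat) \<Rightarrow> 'k \<Rightarrow> nat \<Rightarrow> 'k" where
  "perturbed_point n r \<mu> s l = (if l = 0 then r + s else of_nat (n - l) * (r + s) + of_nat (\<mu> l))"

definition lower :: "nat set \<Rightarrow> (nat \<Rightarrow> nat) \<Rightarrow> nat \<Rightarrow> nat" where
  "lower A \<mu> l = \<mu> l - of_bool (l \<in> A)"

text \<open>Positivity is demanded separately because \<open>lower\<close> truncates at
  zero.\<close>

definition admissible :: "nat \<Rightarrow> nat set \<Rightarrow> (nat \<Rightarrow> nat) \<Rightarrow> bool" where
  "admissible n A \<mu> \<longleftrightarrow> (\<forall>l\<in>A. \<mu> l > 0) \<and> decreasing 0 n (lower A \<mu>)"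

lemma admissibleI:
  assumes "decreasing 0 n \<mu>" "A \<subseteq> {Suc 0..n}"
    and "n \<in> A \<Longrightarrow> \<mu> n \<noteq> 0" 
    and "\<And>l. l \<in> A \<Longrightarrow> l < n \<Longrightarrow> Suc l \<notin> A \<Longrightarrow> \<mu> (Suc l) \<noteq> \<mu> l"
  shows "admissible n A \<mu>"
proof -
  have dec: "\<mu> (Suc l) \<le> \<mu> l" if "l \<in> {Suc 0..<n}" for l using assms(1) that by (simp add: decreasing_def)
  \<comment> \<open>Positivity is carried upwards from row \<open>n\<close>: the next row either
    belongs to \<open>A\<close> and is positive, or is strictly shorter.\<close>
  have pos: "\<mu> l > 0" if "l \<in> A" for l
  proof -
    have "l \<le> n" "Suc 0 \<le> l" using that assms(2) by auto
    then show ?thesis using that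
    proof (induction l rule: inc_induct)
      case base then show ?case using assms(3) by simp
    next
      case (step k)
      have "\<mu> (Suc k) \<le> \<mu> k" using dec step by simp
      then show ?case using step assms(4)[of k] by (cases "Suc k \<in> A") auto
    qed
  qed
  moreover have "lower A \<mu> (Suc l) \<le> lower A \<mu> l" if "l \<in> {Suc 0..<n}" for l
    using dec[OF that] assms(4)[of l] pos[of l] that by (auto simp: lower_def)
  ultimately show ?thesis by (simp add: admissible_def decreasing_def)
qed

lemma perturbed_point_diff:
  assumes "a \<in> {Suc 0..n}" "b \<in> {Suc 0..n}"
  shows "perturbed_point n r \<mu> s a - perturbed_point n r \<mu> s b = (of_nat b - of_nat a) * s + ((of_nat b - of_nat a) * r + (of_nat (\<mu> a) - of_nat (\<mu> b)))"
    and "perturbed_point n r \<mu> s a - perturbed_point n r \<mu> s b - perturbed_point n r \<mu> s 0 = 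
      (of_nat b - of_nat a - 1) * s + ((of_nat b - of_nat a - 1) * r + (of_nat (\<mu> a) - of_nat (\<mu> b)))"
  using assms by (simp_all add: perturbed_point_def of_nat_diff algebra_simps)

text \<open>For \<open>a < b\<close> both \<open>b - a\<close> and \<open>\<mu> a - \<mu> b\<close>
  are natural numbers, so regularity leaves only rows of equal length, and then
  \<open>r = 0\<close>. Thus denominators can vanish at a shifted weight only for
  \<open>r = 0\<close>.\<close>

lemma regular_parameter_zero:
  fixes r :: "'k::field_char_0"
  assumes "regular_parameter r" "decreasing 0 n \<mu>" "a \<in> {Suc 0..n}" "b \<in> {Suc 0..n}" "a \<noteq> b"
    and "(of_nat b - of_nat a) * r + (of_nat (\<mu> a) - of_nat (\<mu> b)) = 0"
  shows "r = 0 \<and> \<mu> a = \<mu> b"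
proof -
  have *: "r = 0 \<and> \<mu> a = \<mu> b" if ab: "a < b" "a \<in> {Suc 0..n}" "b \<in> {Suc 0..n}"
    and eq: "(of_nat b - of_nat a) * r + (of_nat (\<mu> a) - of_nat (\<mu> b)) = 0" for a b
  proof -
    have "\<mu> b \<le> \<mu> a" using decreasing_le[OF assms(2)] ab by simp
    then have "of_nat (b - a) * r + of_nat (\<mu> a - \<mu> b) = 0" using eq ab by (simp add: of_nat_diff)
    moreover from this have "\<mu> a - \<mu> b = 0" using assms(1) unfolding regular_parameter_def by blast
    ultimately show ?thesis using ab \<open>\<mu> b \<le> \<mu> a\<close> by simp
  qed
  show ?thesis
  proof (cases "a < b")
    case True then show ?thesis using * assms by blast
  next
    case False
    have "(of_nat a - of_nat b) * r + (of_nat (\<mu> b) - of_nat (\<mu> a)) = 0" 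
      using assms(6) by (simp add: algebra_simps)
    then show ?thesis using *[of b a] False assms by auto
  qed
qed

text \<open>Vanishing denominators come, for \<open>r = 0\<close>, from odd rows \<open>k\<close> as
  long as row \<open>i\<close>. Such a \<open>k\<close> lies above \<open>i\<close>, since row
  \<open>i\<close> can be shortened, and then the even row \<open>Suc k\<close> has the same length
  and gives a vanishing numerator, so there is no pole. If row \<open>i\<close> cannot be shortened,
  one explicit factor is zero.\<close>

lemma coeff_single_perturbed_point:
  fixes r :: "'k::field_char_0"
  assumes "regular_parameter r" "decreasing 0 n \<mu>" "i \<in> odds n"
  shows "admissible n {i} \<mu> \<Longrightarrow> \<exists>c. regular_limit (\<lambda>s. coeff_single n i (perturbed_point n r \<mu> s)) c"
    and "\<not> admissible n {i} \<mu> \<Longrightarrow> coeff_single n i (perturbed_point n r \<mu> s) = 0"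
proof -
  let ?I = "{Suc 0..n}"
  have i: "i \<in> ?I" "odd i" using assms(3) by (auto simp: odds_def)
  have sub: "odds n \<subseteq> ?I" "evens n \<subseteq> ?I" by (auto simp: odds_def evens_def)
  {
    assume adm: "admissible n {i} \<mu>"
    let ?a = "\<lambda>k. of_nat k - of_nat i - 1 :: 'k" and ?a' = "\<lambda>k. of_nat k - of_nat i :: 'k"
    let ?b = "\<lambda>k. ?a k * r + (of_nat (\<mu> i) - of_nat (\<mu> k))" and ?b' = "\<lambda>k. ?a' k * r + (of_nat (\<mu> i) - of_nat (\<mu> k))"
    have "card {k \<in> odds n - {i}. ?b' k = 0} \<le> card {k \<in> evens n. ?b k = 0}"
    proof (rule card_inj_on_le[of Suc])
      show "Suc ` {k \<in> odds n - {i}. ?b' k = 0} \<subseteq> {k \<in> evens n. ?b k = 0}"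
      proof (intro image_subsetI CollectI conjI; elim CollectE conjE)
        fix k assume k: "k \<in> odds n - {i}" "?b' k = 0"
        then have r0: "r = 0" "\<mu> i = \<mu> k" using regular_parameter_zero[OF assms(1,2), of i k] i sub by auto
        have "k < i"
        proof (rule ccontr)
          assume "\<not> k < i"
          then have ki: "i < k" "k \<le> n" using k by (auto simp: odds_def)
          then have "lower {i} \<mu> (Suc i) \<le> lower {i} \<mu> i"
            using adm i by (simp add: admissible_def decreasing_def)
          then have "\<mu> (Suc i) < \<mu> i" using adm by (auto simp: lower_def admissible_def)
          moreover have "\<mu> k \<le> \<mu> (Suc i)" using decreasing_le[OF assms(2)] ki by simp
          ultimately show False using r0 by simp
        qed
        then have "\<mu> i \<le> \<mu> (Suc k)" "\<mu> (Suc k) \<le> \<mu> k" using decreasing_le[OF assms(2)] i k by (auto simp: odds_def)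
        then show "?b (Suc k) = 0" using r0 by simp
        show "Suc k \<in> evens n" using \<open>k < i\<close> i k by (auto simp: odds_def evens_def)
      qed
    qed simp_all
    then have "\<exists>c. regular_limit (\<lambda>s. (\<Prod>k\<in>evens n. ?a k * s + ?b k) / (\<Prod>k\<in>odds n - {i}. ?a' k * s + ?b' k)) c"
      by (intro regular_limit_prod_ratio) auto
    then obtain c where c: "regular_limit (\<lambda>s. (\<Prod>k\<in>evens n. ?a k * s + ?b k) / (\<Prod>k\<in>odds n - {i}. ?a' k * s + ?b' k)) c"
      by (elim exE)
    let ?p = "if odd n then [:of_nat (n - i) * r + of_nat (\<mu> i), of_nat (n - i):] else 1"
    have "coeff_single n i (perturbed_point n r \<mu> s) = 
      poly ?p s * ((\<Prod>k\<in>evens n. ?a k * s + ?b k) / (\<Prod>k\<in>odds n - {i}. ?a' k * s + ?b' k))" for s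
    proof -
      have "(\<Prod>k\<in>evens n. perturbed_point n r \<mu> s i - perturbed_point n r \<mu> s k - perturbed_point n r \<mu> s 0) = (\<Prod>k\<in>evens n. ?a k * s + ?b k)"
        by (rule prod.cong[OF refl], rule perturbed_point_diff) (use i sub in auto)
      moreover have "(\<Prod>k\<in>odds n - {i}. perturbed_point n r \<mu> s i - perturbed_point n r \<mu> s k) = (\<Prod>k\<in>odds n - {i}. ?a' k * s + ?b' k)"
        by (rule prod.cong[OF refl], rule perturbed_point_diff) (use i sub in auto)
      moreover have "(if odd n then perturbed_point n r \<mu> s i else 1) = poly ?p s"
        using i by (simp add: perturbed_point_def algebra_simps)
      ultimately show ?thesis unfolding coeff_single_def by simp
    qed
    note eq = this
    have "regular_limit (\<lambda>s. coeff_single n i (perturbed_point n r \<mu> s)) (poly ?p 0 * c)"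
      unfolding eq by (rule regular_limit_mult[OF regular_limit_poly c])
    then show "\<exists>c. regular_limit (\<lambda>s. coeff_single n i (perturbed_point n r \<mu> s)) c" by (rule exI)
  }
  {
    assume "\<not> admissible n {i} \<mu>"
    then consider "i = n" "\<mu> n = 0" | "i < n" "\<mu> (Suc i) = \<mu> i"
      using admissibleI[OF assms(2), of "{i}"] i by auto
    then show "coeff_single n i (perturbed_point n r \<mu> s) = 0"
    proof cases
      case 1
      then show ?thesis using i by (simp add: coeff_single_def perturbed_point_def)
    next
      case 2
      then have "Suc i \<in> evens n" using i by (simp add: evens_def)
      moreover have "perturbed_point n r \<mu> s i - perturbed_point n r \<mu> s (Suc i) - perturbed_point n r \<mu> s 0 = 0"
        using 2 i by (subst perturbed_point_diff) simp_all
      ultimately have "(\<Prod>k\<in>evens n. perturbed_point n r \<mu> s i - perturbed_point n r \<mu> s k - perturbed_point n r \<mu> s 0) = 0"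
        by (intro prod_zero) auto
      then show ?thesis by (simp add: coeff_single_def)
    qed
  }
qed

lemma coeff_pair_perturbed_point:
  fixes r :: "'k::field_char_0"
  assumes "regular_parameter r" "decreasing 0 n \<mu>" "i \<in> odds n" "j \<in> evens n"
  shows "admissible n {i, j} \<mu> \<Longrightarrow> \<exists>c. regular_limit (\<lambda>s. coeff_pair n i j (perturbed_point n r \<mu> s)) c"
    and "\<not> admissible n {i, j} \<mu> \<Longrightarrow> coeff_pair n i j (perturbed_point n r \<mu> s) = 0"
proof -
  let ?I = "{Suc 0..n}"
  have i: "i \<in> ?I" "odd i" and j: "j \<in> ?I" "even j" using assms(3,4) by (auto simp: odds_def evens_def)
  have ij: "i \<noteq> j" using i j by auto
  have sub: "odds n \<subseteq> ?I" "evens n \<subseteq> ?I" by (auto simp: odds_def evens_def)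
  {
    assume adm: "admissible n {i, j} \<mu>"
    let ?K = "(evens n - {j}) \<union> (odds n - {i})"
    \<comment> \<open>All factors are indexed by one set: \<open>?u' k\<close> is the shortened row
      of the same parity as \<open>k\<close>, met in the denominator, and \<open>?u k\<close> the
      one of opposite parity, met in the numerator.\<close>
    let ?u = "\<lambda>k. if even k then i else j" and ?u' = "\<lambda>k. if odd k then i else j"
    let ?a = "\<lambda>k. of_nat k - of_nat (?u k) - 1 :: 'k" and ?a' = "\<lambda>k. of_nat k - of_nat (?u' k) :: 'k"
    let ?b = "\<lambda>k. ?a k * r + (of_nat (\<mu> (?u k)) - of_nat (\<mu> k))" and ?b' = "\<lambda>k. ?a' k * r + (of_nat (\<mu> (?u' k)) - of_nat (\<mu> k))"
    have fin: "finite ?K" by simp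
    have KI: "k \<in> ?I" "k \<noteq> ?u' k" if "k \<in> ?K" for k using that sub by (auto simp: odds_def evens_def)
    have zero: "r = 0 \<and> \<mu> (?u' k) = \<mu> k" if "k \<in> ?K" "?b' k = 0" for k
      using regular_parameter_zero[OF assms(1,2), of "?u' k" k] KI[OF that(1)] that(2) i j by (auto split: if_splits)
    have nxt: "Suc k \<in> ?K \<and> \<mu> (Suc k) = \<mu> k" if "\<mu> i \<noteq> \<mu> j" "k \<in> ?K" "\<mu> (?u' k) = \<mu> k" for k
    proof -
      let ?l = "?u' k"
      have l: "?l \<in> ?I" "?l \<in> {i, j}" "even (k + ?l)" using i j by auto
      have "k < ?l"
      proof (rule ccontr)
        assume "\<not> k < ?l"
        then have kl: "?l < k" "k \<le> n" using KI[OF that(2)] by auto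
        then have "lower {i, j} \<mu> (Suc ?l) \<le> lower {i, j} \<mu> ?l"
          using adm l(1) by (simp add: admissible_def decreasing_def)
        moreover have "\<mu> ?l > 0" using adm l(2) unfolding admissible_def by blast
        moreover have "\<mu> k \<le> \<mu> (Suc ?l)" using decreasing_le[OF assms(2)] kl by simp
        moreover have "\<mu> (Suc ?l) \<le> \<mu> ?l" using decreasing_le[OF assms(2)] kl l(1) by simp
        moreover have "\<mu> (Suc ?l) \<noteq> \<mu> ?l" if "Suc ?l \<in> {i, j}"
          using that \<open>\<mu> i \<noteq> \<mu> j\<close> by (auto split: if_splits)
        ultimately show False using that(3) l(2) unfolding lower_def
          by (cases "Suc ?l \<in> {i, j}") (simp_all del: insert_iff)
      qed
      moreover have "Suc k \<noteq> ?l" using l(3) by auto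
      ultimately have kl: "Suc k < ?l" by simp
      then have eq: "\<mu> (Suc k) = \<mu> k" 
        using decreasing_le[OF assms(2), of k "Suc k"] decreasing_le[OF assms(2), of "Suc k" ?l] l(1) that(3) KI[OF that(2)]
        by simp
      moreover have "Suc k \<notin> {i, j}" using kl eq that(1,3) by (auto split: if_splits)
      moreover have "Suc k \<in> odds n \<union> evens n" using kl l(1) by (auto simp: odds_def evens_def)
      ultimately show ?thesis by blast
    qed
    \<comment> \<open>If rows \<open>i\<close> and \<open>j\<close> have equal length, a vanishing
      denominator at \<open>k\<close> has a vanishing numerator at the same \<open>k\<close>.
      Otherwise \<open>k\<close> is matched with \<open>Suc k\<close>; for equal lengths this could
      be the other shortened row, which has no factor.\<close>
    have "card {k \<in> ?K. ?b' k = 0} \<le> card {k \<in> ?K. ?b k = 0}"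
    proof (cases "\<mu> i = \<mu> j")
      case True
      have eq: "?b k = 0" if "k \<in> ?K" "?b' k = 0" for k
        using zero[OF that] True by (auto split: if_splits)
      have "{k \<in> ?K. ?b' k = 0} \<subseteq> {k \<in> ?K. ?b k = 0}"
        by (intro subsetI CollectI conjI; elim CollectE conjE) (assumption, rule eq)
      then show ?thesis by (intro card_mono) simp_all
    next
      case False
      show ?thesis
      proof (rule card_inj_on_le[of Suc])
        show "Suc ` {k \<in> ?K. ?b' k = 0} \<subseteq> {k \<in> ?K. ?b k = 0}"
        proof (intro image_subsetI CollectI conjI; elim CollectE conjE)
          fix k assume k: "k \<in> ?K" "?b' k = 0"
          have z: "r = 0" "\<mu> (?u' k) = \<mu> k" using zero[OF k] by auto
          note nx = nxt[OF False k(1) z(2)]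
          show "Suc k \<in> ?K" using nx by blast
          have "?u (Suc k) = ?u' k" by simp
          then show "?b (Suc k) = 0" using z nx by simp
        qed
      qed simp_all
    qed
    moreover have "?a' k \<noteq> 0" if "k \<in> ?K" for k using KI(2)[OF that] by simp
    ultimately have "\<exists>c. regular_limit (\<lambda>s. (\<Prod>k\<in>?K. ?a k * s + ?b k) / (\<Prod>k\<in>?K. ?a' k * s + ?b' k)) c"
      by (intro regular_limit_prod_ratio fin)
    then obtain c where c: "regular_limit (\<lambda>s. (\<Prod>k\<in>?K. ?a k * s + ?b k) / (\<Prod>k\<in>?K. ?a' k * s + ?b' k)) c"
      by (elim exE)
    let ?l = "if odd n then i else j"
    let ?p = "[:of_nat (n - ?l) * r + of_nat (\<mu> ?l), of_nat (n - ?l):]"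
    have "coeff_pair n i j (perturbed_point n r \<mu> s) = 
      poly ?p s * ((\<Prod>k\<in>?K. ?a k * s + ?b k) / (\<Prod>k\<in>?K. ?a' k * s + ?b' k))" for s
    proof -
      have dis: "(evens n - {j}) \<inter> (odds n - {i}) = {}" by (auto simp: odds_def evens_def)
      note un = prod.union_disjoint[OF finite_Diff[OF finite_evens] finite_Diff[OF finite_odds] dis]
      have "(\<Prod>k\<in>evens n - {j}. perturbed_point n r \<mu> s i - perturbed_point n r \<mu> s k - perturbed_point n r \<mu> s 0) = (\<Prod>k\<in>evens n - {j}. ?a k * s + ?b k)"
        by (rule prod.cong[OF refl], subst perturbed_point_diff(2)) (use i sub in \<open>auto simp: evens_def\<close>)
      moreover have "(\<Prod>k\<in>odds n - {i}. perturbed_point n r \<mu> s j - perturbed_point n r \<mu> s k - perturbed_point n r \<mu> s 0) = (\<Prod>k\<in>odds n - {i}. ?a k * s + ?b k)"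
        by (rule prod.cong[OF refl], subst perturbed_point_diff(2)) (use j sub in \<open>auto simp: odds_def\<close>)
      moreover have "(\<Prod>k\<in>odds n - {i}. perturbed_point n r \<mu> s i - perturbed_point n r \<mu> s k) = (\<Prod>k\<in>odds n - {i}. ?a' k * s + ?b' k)"
        by (rule prod.cong[OF refl], subst perturbed_point_diff(1)) (use i sub in \<open>auto simp: odds_def\<close>)
      moreover have "(\<Prod>k\<in>evens n - {j}. perturbed_point n r \<mu> s j - perturbed_point n r \<mu> s k) = (\<Prod>k\<in>evens n - {j}. ?a' k * s + ?b' k)"
        by (rule prod.cong[OF refl], subst perturbed_point_diff(1)) (use j sub in \<open>auto simp: evens_def\<close>)
      moreover have "(if odd n then perturbed_point n r \<mu> s i else perturbed_point n r \<mu> s j) = poly ?p s"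
        using i j by (simp add: perturbed_point_def algebra_simps)
      ultimately show ?thesis unfolding coeff_pair_def un by (simp only: times_divide_eq_right mult.assoc mult.commute[of "prod _ (odds n - {i})" "prod _ (evens n - {j})"])
    qed
    note eq = this
    have "regular_limit (\<lambda>s. coeff_pair n i j (perturbed_point n r \<mu> s)) (poly ?p 0 * c)"
      unfolding eq by (rule regular_limit_mult[OF regular_limit_poly c])
    then show "\<exists>c. regular_limit (\<lambda>s. coeff_pair n i j (perturbed_point n r \<mu> s)) c" by (rule exI)
  }
  {
    assume na: "\<not> admissible n {i, j} \<mu>"
    have "(n \<in> {i, j} \<and> \<mu> n = 0) \<or> (\<exists>l\<in>{i, j}. l < n \<and> Suc l \<notin> {i, j} \<and> \<mu> (Suc l) = \<mu> l)"
      using admissibleI[OF assms(2), of "{i, j}"] i j na by blast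
    then consider "n \<in> {i, j}" "\<mu> n = 0" | "i < n" "Suc i \<noteq> j" "\<mu> (Suc i) = \<mu> i"
      | "j < n" "Suc j \<noteq> i" "\<mu> (Suc j) = \<mu> j" by auto
    then show "coeff_pair n i j (perturbed_point n r \<mu> s) = 0"
    proof cases
      case 1
      then show ?thesis using i j by (auto simp: coeff_pair_def perturbed_point_def)
    next
      case 2
      then have "Suc i \<in> evens n - {j}" using i by (simp add: evens_def)
      moreover have "perturbed_point n r \<mu> s i - perturbed_point n r \<mu> s (Suc i) - perturbed_point n r \<mu> s 0 = 0"
        using 2 i by (subst perturbed_point_diff) simp_all
      ultimately have "(\<Prod>k\<in>evens n - {j}. perturbed_point n r \<mu> s i - perturbed_point n r \<mu> s k - perturbed_point n r \<mu> s 0) = 0"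
        by (intro prod_zero) auto
      then show ?thesis by (simp add: coeff_pair_def)
    next
      case 3
      then have "Suc j \<in> odds n - {i}" using j by (simp add: odds_def)
      moreover have "perturbed_point n r \<mu> s j - perturbed_point n r \<mu> s (Suc j) - perturbed_point n r \<mu> s 0 = 0"
        using 3 j by (subst perturbed_point_diff) simp_all
      ultimately have "(\<Prod>k\<in>odds n - {i}. perturbed_point n r \<mu> s j - perturbed_point n r \<mu> s k - perturbed_point n r \<mu> s 0) = 0"
        by (intro prod_zero) auto
      then show ?thesis by (simp add: coeff_pair_def)
    qed
  }
qed

text \<open>If the boxes can be removed from \<open>\<mu>\<close>, the limit exists, so that \<open>SOME\<close> is not vacuous;
  otherwise the coefficient is zero for all \<open>s\<close>.\<close>

definition limit_coeff_single :: "nat \<Rightarrow> 'k::field_char_0 \<Rightarrow> (nat \<Rightarrow> nat) \<Rightarrow> nat \<Rightarrow> 'k" where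
  "limit_coeff_single n r \<mu> i = (if admissible n {i} \<mu> then SOME c. regular_limit (\<lambda>s. coeff_single n i (perturbed_point n r \<mu> s)) c else 0)"

definition limit_coeff_pair :: "nat \<Rightarrow> 'k::field_char_0 \<Rightarrow> (nat \<Rightarrow> nat) \<Rightarrow> nat \<Rightarrow> nat \<Rightarrow> 'k" where
  "limit_coeff_pair n r \<mu> i j = (if admissible n {i, j} \<mu> then SOME c. regular_limit (\<lambda>s. coeff_pair n i j (perturbed_point n r \<mu> s)) c else 0)"

lemma regular_limit_coeff_single:
  assumes "regular_parameter r" "decreasing 0 n \<mu>" "i \<in> odds n"
  shows "regular_limit (\<lambda>s. coeff_single n i (perturbed_point n r \<mu> s)) (limit_coeff_single n r \<mu> i)"
  using coeff_single_perturbed_point[OF assms] someI_ex[of "regular_limit (\<lambda>s. coeff_single n i (perturbed_point n r \<mu> s))"] regular_limit_const[of 0]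
  by (cases "admissible n {i} \<mu>") (simp_all add: limit_coeff_single_def)

lemma regular_limit_coeff_pair:
  assumes "regular_parameter r" "decreasing 0 n \<mu>" "i \<in> odds n" "j \<in> evens n"
  shows "regular_limit (\<lambda>s. coeff_pair n i j (perturbed_point n r \<mu> s)) (limit_coeff_pair n r \<mu> i j)"
  using coeff_pair_perturbed_point[OF assms] someI_ex[of "regular_limit (\<lambda>s. coeff_pair n i j (perturbed_point n r \<mu> s))"] regular_limit_const[of 0]
  by (cases "admissible n {i, j} \<mu>") (simp_all add: limit_coeff_pair_def)

section \<open>Limits of the operator at shifted weights\<close>

lemma perturbed_point_eq: "perturbed_point n r \<mu> s l = perturbed_point n r \<mu> 0 l + s * (if l = 0 then 1 else of_nat (n - l))"
  by (simp add: perturbed_point_def algebra_simps)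

lemma polyfun_perturbed_point:
  assumes "polyfun I d f"
  shows "\<exists>p. \<forall>s. f (perturbed_point n r \<mu> s) = poly p s"
proof -
  obtain p where "\<forall>t. f (\<lambda>l. perturbed_point n r \<mu> 0 l + t * (if l = 0 then 1 else of_nat (n - l))) = poly p t"
    using polyfun_line[OF assms, of "perturbed_point n r \<mu> 0" "\<lambda>l. if l = 0 then 1 else of_nat (n - l)"] by (elim exE)
  then have "f (perturbed_point n r \<mu> s) = poly p s" for s
    by (subst ext[of "perturbed_point n r \<mu> s", OF perturbed_point_eq]) (rule spec)
  then show ?thesis by (intro exI[of _ p] allI)
qed

lemma regular_limit_perturbed_point:
  assumes "polyfun {Suc 0..n} d f"
  shows "regular_limit (\<lambda>s. f (perturbed_point n r \<mu> s)) (f (shifted_point n r 0 \<mu>))"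
proof -
  obtain p where p: "\<forall>s. f (perturbed_point n r \<mu> s) = poly p s" using polyfun_perturbed_point[OF assms, of n r \<mu>] by (elim exE)
  have "f (shifted_point n r 0 \<mu>) = f (perturbed_point n r \<mu> 0)" by (rule polyfun_cong[OF assms]) (simp add: shifted_point_def perturbed_point_def)
  then show ?thesis using regular_limit_poly[of p] p by simp
qed

lemma regular_limit_translate:
  assumes "polyfun {Suc 0..n} d f" "admissible n A \<mu>"
  shows "regular_limit (\<lambda>s. f (perturbed_point n r \<mu> s) - f (translate A (perturbed_point n r \<mu> s))) (f (shifted_point n r 0 \<mu>) - f (shifted_point n r 0 (lower A \<mu>)))"
proof -
  have "f (translate A (perturbed_point n r \<mu> s)) = f (perturbed_point n r (lower A \<mu>) s)" for s
  proof (rule polyfun_cong[OF assms(1)])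
    fix l assume "l \<in> {Suc 0..n}"
    moreover have "l \<in> A \<Longrightarrow> Suc 0 \<le> \<mu> l" using assms(2) by (auto simp: admissible_def Suc_le_eq)
    ultimately show "translate A (perturbed_point n r \<mu> s) l = perturbed_point n r (lower A \<mu>) s l"
      by (simp add: translate_def perturbed_point_def lower_def of_nat_diff)
  qed
  moreover have "regular_limit (\<lambda>s. f (perturbed_point n r \<mu> s) + (-1) * f (perturbed_point n r (lower A \<mu>) s)) (f (shifted_point n r 0 \<mu>) + (-1) * f (shifted_point n r 0 (lower A \<mu>)))"
    by (intro regular_limit_add regular_limit_mult regular_limit_const regular_limit_perturbed_point[OF assms(1)])
  ultimately show ?thesis by simp
qed

lemma regular_limit_term_single:
  assumes "regular_parameter r" "decreasing 0 n \<mu>" "i \<in> odds n" "polyfun {Suc 0..n} d f"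
  shows "regular_limit (\<lambda>s. coeff_single n i (perturbed_point n r \<mu> s) * (f (perturbed_point n r \<mu> s) - f (translate {i} (perturbed_point n r \<mu> s))))
    (limit_coeff_single n r \<mu> i * (f (shifted_point n r 0 \<mu>) - f (shifted_point n r 0 (lower {i} \<mu>))))"
proof (cases "admissible n {i} \<mu>")
  case True
  then show ?thesis by (intro regular_limit_mult regular_limit_coeff_single regular_limit_translate[OF assms(4)] assms(1-3))
next
  case False
  then show ?thesis using coeff_single_perturbed_point(2)[OF assms(1-3)] regular_limit_const[of 0] by (simp add: limit_coeff_single_def)
qed

lemma regular_limit_term_pair:
  assumes "regular_parameter r" "decreasing 0 n \<mu>" "i \<in> odds n" "j \<in> evens n" "polyfun {Suc 0..n} d f"
  shows "regular_limit (\<lambda>s. coeff_pair n i j (perturbed_point n r \<mu> s) * (f (perturbed_point n r \<mu> s) - f (translate {i, j} (perturbed_point n r \<mu> s))))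
    (limit_coeff_pair n r \<mu> i j * (f (shifted_point n r 0 \<mu>) - f (shifted_point n r 0 (lower {i, j} \<mu>))))"
proof (cases "admissible n {i, j} \<mu>")
  case True
  then show ?thesis by (intro regular_limit_mult regular_limit_coeff_pair regular_limit_translate[OF assms(5)] assms(1-4))
next
  case False
  then show ?thesis using coeff_pair_perturbed_point(2)[OF assms(1-4)] regular_limit_const[of 0] by (simp add: limit_coeff_pair_def)
qed

text \<open>The formula of the operator breaks down where coordinates coincide, but its polynomial
  extension does not: along the perturbed points both agree for almost all \<open>s\<close>, so the
  limits of the terms give the value at \<open>s = 0\<close>.\<close>

lemma difference_operator_at_shifted_points:
  fixes f :: "(nat \<Rightarrow> 'k::field_char_0) \<Rightarrow> 'k"
  assumes "n \<ge> 1" "regular_parameter r" "polyfun {Suc 0..n} d f" "parity_sym {Suc 0..n} f"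
  shows "\<exists>h. polyfun {Suc 0..n} d h \<and> parity_sym {Suc 0..n} h \<and>
    (\<forall>\<mu>. decreasing 0 n \<mu> \<longrightarrow> h (shifted_point n r 0 \<mu>) =
      (\<Sum>i\<in>odds n. limit_coeff_single n r \<mu> i * (f (shifted_point n r 0 \<mu>) - f (shifted_point n r 0 (lower {i} \<mu>))))
      + (\<Sum>i\<in>odds n. \<Sum>j\<in>evens n. limit_coeff_pair n r \<mu> i j * (f (shifted_point n r 0 \<mu>) - f (shifted_point n r 0 (lower {i, j} \<mu>)))))"
proof -
  let ?I = "{Suc 0..n}"
  from difference_operator_polynomial[OF assms(1,3,4)] obtain hb where hb: "polyfun {0..n} d hb"
    "\<forall>z. inj_on z (odds n) \<longrightarrow> inj_on z (evens n) \<longrightarrow> hb z = difference_operator n f z" by (elim exE conjE)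
  \<comment> \<open>Slot \<open>0\<close> is frozen at \<open>r\<close> only in \<open>h\<close>;
    the limit below is taken with \<open>hb\<close>, where this slot still moves.\<close>
  define h where "h z = hb (z(0 := r))" for z
  have pfh: "polyfun ?I d h" unfolding h_def
  proof (rule polyfun_subst[OF hb(1)])
    fix i assume "i \<in> {0..n}"
    then show "polyfun ?I 1 (\<lambda>z. (z(0 := r)) i)" using polyfun.var[of i ?I 0] by (cases "i = 0") (simp_all add: polyfun.const)
  qed
  have sub: "odds n \<subseteq> ?I" "evens n \<subseteq> ?I" by (auto simp: odds_def evens_def)
  have hbs: "hb (z \<circ> transpose a b) = hb z" if ab: "a \<in> ?I" "b \<in> ?I" "even (a + b)" for a b z
  proof -
    let ?\<tau> = "transpose a b"
    have "polyfun {0..n} 1 (\<lambda>z. (z \<circ> ?\<tau>) i)" if "i \<in> {0..n}" for i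
    proof -
      have "?\<tau> i \<in> {0..n}" using that ab(1,2) by (cases "i = a"; cases "i = b") simp_all
      then show ?thesis using polyfun.var[of "?\<tau> i" "{0..n}" 0] by simp
    qed
    then have "polyfun {0..n} d (\<lambda>z. hb (z \<circ> ?\<tau>) - hb z)" by (intro polyfun_diff hb(1) polyfun_subst[OF hb(1)])
    moreover
    have inj: "inj_on (of_nat :: nat \<Rightarrow> 'k) A" for A by (simp add: inj_on_def)
    from inj_on_line_cofinite[OF finite_odds[of n] inj, where z = z]
    obtain S where S: "finite S" "\<forall>t. t \<notin> S \<longrightarrow> inj_on (\<lambda>i. z i + t * of_nat i) (odds n)"
      by (elim exE conjE)
    from inj_on_line_cofinite[OF finite_evens[of n] inj, where z = z]
    obtain S' where S': "finite S'" "\<forall>t. t \<notin> S' \<longrightarrow> inj_on (\<lambda>i. z i + t * of_nat i) (evens n)"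
      by (elim exE conjE)
    have "finite (S \<union> S')" using S S' by simp
    moreover have "hb ((\<lambda>i. z i + t * of_nat i) \<circ> ?\<tau>) - hb (\<lambda>i. z i + t * of_nat i) = 0" if t: "t \<notin> S \<union> S'" for t
    proof -
      define y where "y = (\<lambda>i. z i + t * of_nat i)"
      have y: "inj_on y (odds n)" "inj_on y (evens n)" using S(2) S'(2) t unfolding y_def by blast+
      have "inj_on (y \<circ> ?\<tau>) A" if "bij_betw ?\<tau> A A" "inj_on y A" for A
        using that by (simp add: comp_inj_on bij_betw_def)
      then have "inj_on (y \<circ> ?\<tau>) (odds n)" "inj_on (y \<circ> ?\<tau>) (evens n)"
        using coeff_transpose(3,4)[OF ab] y by blast+
      then have "hb (y \<circ> ?\<tau>) = difference_operator n f (y \<circ> ?\<tau>)" "hb y = difference_operator n f y" using hb(2) y by blast+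
      then show ?thesis using difference_operator_transpose[OF assms(4) ab, of y] by (simp add: y_def)
    qed
    ultimately have "hb (z \<circ> ?\<tau>) - hb z = 0" by (rule polyfun_line_density)
    then show ?thesis by simp
  qed
  have symh: "parity_sym ?I h" unfolding parity_sym_def
  proof (intro ballI impI allI)
    fix a b z assume ab: "a \<in> ?I" "b \<in> ?I" "even (a + b)"
    have "(z \<circ> transpose a b)(0 := r) = z(0 := r) \<circ> transpose a b"
    proof
      fix l show "((z \<circ> transpose a b)(0 := r)) l = (z(0 := r) \<circ> transpose a b) l"
        using ab(1,2) by (cases "l = 0"; cases "l = a"; cases "l = b") simp_all
    qed
    then show "h (z \<circ> transpose a b) = h z" using hbs[OF ab] by (simp add: h_def)
  qed
  have "h (shifted_point n r 0 \<mu>) =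
      (\<Sum>i\<in>odds n. limit_coeff_single n r \<mu> i * (f (shifted_point n r 0 \<mu>) - f (shifted_point n r 0 (lower {i} \<mu>))))
      + (\<Sum>i\<in>odds n. \<Sum>j\<in>evens n. limit_coeff_pair n r \<mu> i j * (f (shifted_point n r 0 \<mu>) - f (shifted_point n r 0 (lower {i, j} \<mu>))))"
    if dec: "decreasing 0 n \<mu>" for \<mu>
  proof -
    obtain p where p: "\<forall>s. hb (perturbed_point n r \<mu> s) = poly p s" using polyfun_perturbed_point[OF hb(1), of n r \<mu>] by (elim exE)
    \<comment> \<open>On the rows the direction of the perturbation is the staircase, whose entries
      \<open>n - l\<close> are distinct. So the perturbed coordinates are distinct for almost all
      \<open>s\<close>, even when \<open>r = 0\<close>.\<close>
    let ?w = "\<lambda>l. if l = 0 then 1 else of_nat (n - l) :: 'k"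
    have inj: "inj_on ?w ?I" by (auto simp: inj_on_def)
    have le: "perturbed_point n r \<mu> s = (\<lambda>l. perturbed_point n r \<mu> 0 l + s * ?w l)" for s by (rule ext) (rule perturbed_point_eq)
    from inj_on_line_cofinite[OF finite_odds inj_on_subset[OF inj sub(1)], of "perturbed_point n r \<mu> 0", folded le]
    obtain S where S: "finite S" "\<forall>t. t \<notin> S \<longrightarrow> inj_on (perturbed_point n r \<mu> t) (odds n)"
      by (elim exE conjE)
    from inj_on_line_cofinite[OF finite_evens inj_on_subset[OF inj sub(2)], of "perturbed_point n r \<mu> 0", folded le]
    obtain S' where S': "finite S'" "\<forall>t. t \<notin> S' \<longrightarrow> inj_on (perturbed_point n r \<mu> t) (evens n)"
      by (elim exE conjE)
    have "regular_limit (\<lambda>s. difference_operator n f (perturbed_point n r \<mu> s)) 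
      ((\<Sum>i\<in>odds n. limit_coeff_single n r \<mu> i * (f (shifted_point n r 0 \<mu>) - f (shifted_point n r 0 (lower {i} \<mu>))))
      + (\<Sum>i\<in>odds n. \<Sum>j\<in>evens n. limit_coeff_pair n r \<mu> i j * (f (shifted_point n r 0 \<mu>) - f (shifted_point n r 0 (lower {i, j} \<mu>)))))"
      unfolding difference_operator_def using dec assms(2,3) by (intro regular_limit_add regular_limit_sum regular_limit_term_single regular_limit_term_pair)
    then have "(\<Sum>i\<in>odds n. limit_coeff_single n r \<mu> i * (f (shifted_point n r 0 \<mu>) - f (shifted_point n r 0 (lower {i} \<mu>))))
      + (\<Sum>i\<in>odds n. \<Sum>j\<in>evens n. limit_coeff_pair n r \<mu> i j * (f (shifted_point n r 0 \<mu>) - f (shifted_point n r 0 (lower {i, j} \<mu>)))) = poly p 0"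
    proof (rule regular_limit_unique_poly)
      show "finite (S \<union> S')" using S S' by simp
      fix s assume "s \<notin> S \<union> S'"
      then have "inj_on (perturbed_point n r \<mu> s) (odds n)" "inj_on (perturbed_point n r \<mu> s) (evens n)" using S S' by blast+
      then have "hb (perturbed_point n r \<mu> s) = difference_operator n f (perturbed_point n r \<mu> s)" using hb(2) by blast
      then show "difference_operator n f (perturbed_point n r \<mu> s) = poly p s" using spec[OF p, of s] by simp
    qed
    moreover have "h (shifted_point n r 0 \<mu>) = hb (perturbed_point n r \<mu> 0)"
      unfolding h_def by (rule polyfun_cong[OF hb(1)]) (auto simp: shifted_point_def perturbed_point_def)
    ultimately show ?thesis using p by simp
  qed
  with pfh symh show ?thesis by (intro exI[of _ h] conjI allI impI)
qed

section \<open>Normalisation of the coefficients\<close>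

lemma admissible_tail_odd_size:
  assumes "admissible n A \<mu>" "i \<in> odds n" "A = {i} \<or> (\<exists>j\<in>evens n. A = {i, j})"
  shows "tail_odd_size 0 n \<mu> = Suc (tail_odd_size 0 n (lower A \<mu>))"
proof -
  have i: "i \<in> {l. l \<in> {Suc 0..n} \<and> odd (l + 0)}" using assms(2) by (simp add: odds_def)
  have "\<mu> l = lower A \<mu> l + (if l = i then 1 else 0)" if "l \<in> {l. l \<in> {Suc 0..n} \<and> odd (l + 0)}" for l
  proof -
    have "l \<in> A \<longleftrightarrow> l = i" using assms(3) that by (auto simp: evens_def)
    moreover have "\<mu> i > 0" using assms(1,3) by (auto simp: admissible_def)
    ultimately show ?thesis by (simp add: lower_def)
  qed
  then have "tail_odd_size 0 n \<mu> = (\<Sum>l | l \<in> {Suc 0..n} \<and> odd (l + 0). lower A \<mu> l + (if l = i then 1 else 0))"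
    unfolding tail_odd_size_def by (intro sum.cong) simp_all
  also have "\<dots> = tail_odd_size 0 n (lower A \<mu>) + (\<Sum>l | l \<in> {Suc 0..n} \<and> odd (l + 0). if l = i then 1 else 0)"
    unfolding tail_odd_size_def by (rule sum.distrib)
  also have "(\<Sum>l | l \<in> {Suc 0..n} \<and> odd (l + 0). if l = i then 1 else 0) = (1::nat)"
    using i by (subst sum.delta) simp_all
  finally show ?thesis by simp
qed

text \<open>The factor of an even \<open>k\<close> is that of the odd index \<open>k - 1\<close>.
  The factor of the index \<open>1\<close> is one, and for odd \<open>n\<close> the prefactor is
  that of \<open>n\<close>, which has no even partner.\<close>

lemma prod_evens_eq_prod_odds:
  fixes q :: "'k::field_char_0"
  assumes "n \<ge> 1"
  shows "(if odd n then (of_nat n - 1) * q + 1 else 1) * (\<Prod>k\<in>evens n. (of_nat k - 1 - 1) * q + 1)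
    = (\<Prod>k\<in>odds n - {1}. (of_nat k - 1) * q + 1)"
  using assms
proof (induction n rule: dec_induct)
  case base
  have e: "evens 1 = {}" "odds 1 - {1} = {}" by (auto simp: evens_def odds_def)
  show ?case unfolding e by simp
next
  case (step n)
  show ?case
  proof (cases "odd n")
    case True
    have e: "evens (Suc n) = insert (Suc n) (evens n)" "odds (Suc n) = odds n" "Suc n \<notin> evens n"
      using True by (auto simp: evens_def odds_def le_Suc_eq)
    show ?thesis using step.IH True unfolding e by (simp add: e(3))
  next
    case False
    have e: "evens (Suc n) = evens n" "odds (Suc n) - {1} = insert (Suc n) (odds n - {1})" "Suc n \<notin> odds n"
      using False step by (auto simp: evens_def odds_def le_Suc_eq)
    show ?thesis using step.IH False unfolding e by (simp add: e(3))
  qed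
qed

text \<open>Every odd index is moved down by two: the factor of \<open>3\<close> becomes one, and
  the prefactor supplies the missing factor of the largest odd index, which is \<open>n\<close> or
  \<open>n - 1\<close>.\<close>

lemma prod_odds_translate:
  fixes q :: "'k::field_char_0"
  assumes "n \<ge> 2"
  shows "(if odd n then (of_nat n - 1) * q + 1 else (of_nat n - 2) * q + 1) * (\<Prod>k\<in>odds n - {1}. (of_nat k - 2 - 1) * q + 1)
    = (\<Prod>k\<in>odds n - {1}. (of_nat k - 1) * q + 1)"
  using assms
proof (induction n rule: dec_induct)
  case base
  have e: "odds 2 - {1} = {}" by (auto simp: odds_def) presburger
  show ?case unfolding e by simp
next
  case (step n)
  show ?case
  proof (cases "odd n")
    case True
    have e: "odds (Suc n) = odds n" using True by (auto simp: odds_def le_Suc_eq)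
    show ?thesis using step.IH True unfolding e by simp
  next
    case False
    have e: "odds (Suc n) - {1} = insert (Suc n) (odds n - {1})" "Suc n \<notin> odds n"
      using False step by (auto simp: odds_def le_Suc_eq)
    have "of_nat (Suc n) - 2 - 1 = (of_nat n - 2 :: 'k)" by simp
    then show ?thesis using step.IH False unfolding e by (simp add: e(2) mult.commute mult.left_commute)
  qed
qed

lemma perturbed_point_diff_alt:
  fixes r :: "'k::field_char_0"
  assumes "a \<in> {Suc 0..n}" "b \<in> {Suc 0..n}"
  shows "perturbed_point n r \<mu> s a - perturbed_point n r \<mu> s b = (of_nat b - of_nat a) * (r + s) + (of_nat (\<mu> a) - of_nat (\<mu> b))"
    and "perturbed_point n r \<mu> s a - perturbed_point n r \<mu> s b - perturbed_point n r \<mu> s 0 = 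
      (of_nat b - of_nat a - 1) * (r + s) + (of_nat (\<mu> a) - of_nat (\<mu> b))"
  using assms by (simp_all add: perturbed_point_def of_nat_diff algebra_simps)

lemma finite_linear_roots:
  assumes "finite K" "\<And>k. k \<in> K \<Longrightarrow> a k \<noteq> (0 :: 'k::field_char_0)"
  shows "finite {s. \<exists>k\<in>K. a k * (r + s) + 1 = 0}"
proof (rule finite_subset)
  show "{s. \<exists>k\<in>K. a k * (r + s) + 1 = 0} \<subseteq> (\<lambda>k. - 1 / a k - r) ` K"
  proof clarify
    fix s k assume k: "k \<in> K" "a k * (r + s) + 1 = 0"
    then have "a k * (r + s) = - 1" by (simp add: eq_neg_iff_add_eq_0)
    then have "s = - 1 / a k - r" using assms(2)[OF k(1)] by (simp add: field_simps)
    then show "s \<in> (\<lambda>k. - 1 / a k - r) ` K" using k by blast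
  qed
qed (use assms in simp)

text \<open>At the weight with a single box the coefficient is identically one in \<open>s\<close>,
  by the product identity with \<open>q = r + s\<close>, away from the finitely many roots of its
  denominator.\<close>

lemma limit_coeff_single_first:
  fixes r :: "'k::field_char_0"
  assumes "regular_parameter r" "decreasing 0 n \<mu>" "n \<ge> 1" "\<mu> 1 = 1" "\<And>k. k \<in> {2..n} \<Longrightarrow> \<mu> k = 0"
  shows "limit_coeff_single n r \<mu> 1 = 1"
proof -
  have o: "1 \<in> odds n" using assms(3) by (simp add: odds_def)
  have ko: "k \<in> {Suc 0..n} \<and> \<mu> k = 0 \<and> k \<noteq> 1" if "k \<in> odds n - {1}" for k using that assms(5)[of k] by (auto simp: odds_def)
  have ke: "k \<in> {Suc 0..n} \<and> \<mu> k = 0" if "k \<in> evens n" for k 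
    using that assms(5)[of k] by (cases "k = 1") (auto simp: evens_def)
  let ?T = "{s. \<exists>k\<in>odds n - {1}. (of_nat k - 1) * (r + s) + 1 = (0::'k)}"
  have T: "finite ?T" by (rule finite_linear_roots) (use ko in auto)
  have "limit_coeff_single n r \<mu> 1 = poly 1 0"
  proof (rule regular_limit_unique_poly[OF regular_limit_coeff_single[OF assms(1,2) o] T])
    fix s assume s: "s \<notin> ?T"
    have "(\<Prod>k\<in>evens n. perturbed_point n r \<mu> s 1 - perturbed_point n r \<mu> s k - perturbed_point n r \<mu> s 0) = (\<Prod>k\<in>evens n. (of_nat k - 1 - 1) * (r + s) + 1)"
      by (rule prod.cong[OF refl], subst perturbed_point_diff_alt(2)) (use ke assms(3,4) in auto)
    moreover have "(\<Prod>k\<in>odds n - {1}. perturbed_point n r \<mu> s 1 - perturbed_point n r \<mu> s k) = (\<Prod>k\<in>odds n - {1}. (of_nat k - 1) * (r + s) + 1)"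
      by (rule prod.cong[OF refl], subst perturbed_point_diff_alt(1)) (use ko assms(3,4) in auto)
    moreover have "(if odd n then perturbed_point n r \<mu> s 1 else 1) = (if odd n then (of_nat n - 1) * (r + s) + 1 else 1)"
      using assms(3,4) by (simp add: perturbed_point_def of_nat_diff)
    moreover have "(\<Prod>k\<in>odds n - {1}. (of_nat k - 1) * (r + s) + 1) \<noteq> 0" using s by simp
    ultimately show "coeff_single n 1 (perturbed_point n r \<mu> s) = poly 1 s"
      unfolding coeff_single_def using prod_evens_eq_prod_odds[OF assms(3), of "r + s"] by simp
  qed
  then show ?thesis by simp
qed

lemma limit_coeff_pair_first:
  fixes r :: "'k::field_char_0"
  assumes "regular_parameter r" "decreasing 0 n \<mu>" "n \<ge> 2" "\<mu> 1 = 1" "\<mu> 2 = 1" "\<And>k. k \<in> {3..n} \<Longrightarrow> \<mu> k = 0"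
  shows "limit_coeff_pair n r \<mu> 1 2 = 1"
proof -
  have o: "1 \<in> odds n" "2 \<in> evens n" using assms(3) by (simp_all add: odds_def evens_def)
  have ko: "k \<in> {Suc 0..n} \<and> \<mu> k = 0 \<and> k \<noteq> 1" if "k \<in> odds n - {1}" for k
  proof -
    have "k \<in> {3..n}" using that by (auto simp: odds_def) presburger
    then show ?thesis using assms(6) by auto
  qed
  have ke: "k \<in> {Suc 0..n} \<and> \<mu> k = 0 \<and> k \<noteq> 2" if "k \<in> evens n - {2}" for k 
  proof -
    have "k \<in> {3..n}" using that by (auto simp: evens_def)
    then show ?thesis using assms(6) by auto
  qed
  let ?T = "{s. \<exists>k\<in>odds n - {1}. (of_nat k - 1) * (r + s) + 1 = (0::'k)}"
  let ?T' = "{s. \<exists>k\<in>evens n - {2}. (of_nat k - 2) * (r + s) + 1 = (0::'k)}"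
  have "of_nat k \<noteq> (2::'k)" if "k \<noteq> 2" for k using that of_nat_eq_iff[of k 2, where 'a = 'k] by simp
  then have T: "finite (?T \<union> ?T')" using ko ke by (intro finite_UnI finite_linear_roots) auto
  have "limit_coeff_pair n r \<mu> 1 2 = poly 1 0"
  proof (rule regular_limit_unique_poly[OF regular_limit_coeff_pair[OF assms(1,2) o] T])
    fix s assume s: "s \<notin> ?T \<union> ?T'"
    have "(\<Prod>k\<in>evens n - {2}. perturbed_point n r \<mu> s 1 - perturbed_point n r \<mu> s k - perturbed_point n r \<mu> s 0) = (\<Prod>k\<in>evens n - {2}. (of_nat k - 2) * (r + s) + 1)"
      by (rule prod.cong[OF refl], subst perturbed_point_diff_alt(2)) (use ke assms(3,4) in auto)
    moreover have "(\<Prod>k\<in>odds n - {1}. perturbed_point n r \<mu> s 2 - perturbed_point n r \<mu> s k - perturbed_point n r \<mu> s 0) = (\<Prod>k\<in>odds n - {1}. (of_nat k - 2 - 1) * (r + s) + 1)"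
      by (rule prod.cong[OF refl], subst perturbed_point_diff_alt(2)) (use ko assms(3,5) in auto)
    moreover have "(\<Prod>k\<in>odds n - {1}. perturbed_point n r \<mu> s 1 - perturbed_point n r \<mu> s k) = (\<Prod>k\<in>odds n - {1}. (of_nat k - 1) * (r + s) + 1)"
      by (rule prod.cong[OF refl], subst perturbed_point_diff_alt(1)) (use ko assms(3,4) in auto)
    moreover have "(\<Prod>k\<in>evens n - {2}. perturbed_point n r \<mu> s 2 - perturbed_point n r \<mu> s k) = (\<Prod>k\<in>evens n - {2}. (of_nat k - 2) * (r + s) + 1)"
      by (rule prod.cong[OF refl], subst perturbed_point_diff_alt(1)) (use ke assms(3,5) in auto)
    moreover have "(if odd n then perturbed_point n r \<mu> s 1 else perturbed_point n r \<mu> s 2)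
        = (if odd n then (of_nat n - 1) * (r + s) + 1 else (of_nat n - 2) * (r + s) + 1)"
      using assms(3-5) by (simp add: perturbed_point_def of_nat_diff)
    moreover have "(\<Prod>k\<in>odds n - {1}. (of_nat k - 1) * (r + s) + 1) \<noteq> 0" 
      "(\<Prod>k\<in>evens n - {2}. (of_nat k - 2) * (r + s) + 1) \<noteq> 0" using s by simp_all
    \<comment> \<open>\<open>E\<close> is the product over even indices, which occurs both above and
      below; what remains over odd indices cancels by the product identity.\<close>
    moreover have "b * E * P / (Q * E) = 1" if "Q \<noteq> 0" "E \<noteq> 0" "b * P = Q" for b E P Q :: 'k
      using that by (simp add: field_simps)
    ultimately show "coeff_pair n 1 2 (perturbed_point n r \<mu> s) = poly 1 s"
      unfolding coeff_pair_def using prod_odds_translate[OF assms(3), of "r + s"] by simp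
  qed
  then show ?thesis by simp
qed

subsection \<open>Extra vanishing\<close>

lemma tail_odd_size_odds: "tail_odd_size 0 n \<mu> = (\<Sum>i\<in>odds n. \<mu> i)"
  by (simp add: tail_odd_size_def odds_def)

lemma limit_coeff_zero:
  "i \<in> odds n \<Longrightarrow> \<mu> i = 0 \<Longrightarrow> limit_coeff_single n r \<mu> i = 0"
  "\<mu> i = 0 \<or> \<mu> j = 0 \<Longrightarrow> limit_coeff_pair n r \<mu> i j = 0"
  by (auto simp: limit_coeff_single_def limit_coeff_pair_def admissible_def)

text \<open>Apart from the empty weight, odd size at most one leaves only a first row of one box,
  with or without a box in the second row. In each of these two cases exactly one coefficient
  survives, and it is one.\<close>

lemma limit_coeff_sum_small:
  fixes r :: "'k::field_char_0"
  assumes n: "n \<ge> 1" and r: "regular_parameter r" and dec: "decreasing 0 n \<mu>" and small: "tail_odd_size 0 n \<mu> \<le> 1"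
  shows "(\<Sum>i\<in>odds n. limit_coeff_single n r \<mu> i) + (\<Sum>i\<in>odds n. \<Sum>j\<in>evens n. limit_coeff_pair n r \<mu> i j) = of_nat (tail_odd_size 0 n \<mu>)"
proof -
  have o: "1 \<in> odds n" using n by (simp add: odds_def)
  have le1: "\<mu> l \<le> \<mu> 1" if "l \<in> {Suc 0..n}" for l using decreasing_le[OF dec, of 1 l] that by simp
  have ts: "tail_odd_size 0 n \<mu> = \<mu> 1 + (\<Sum>i\<in>odds n - {1}. \<mu> i)"
    unfolding tail_odd_size_odds by (rule sum.remove[OF finite_odds o])
  show ?thesis
  proof (cases "\<mu> 1 = 0")
    case True
    have z: "\<mu> i = 0" if "i \<in> odds n" for i using le1[of i] True that by (simp add: odds_def)
    then show ?thesis by (simp add: tail_odd_size_odds limit_coeff_zero)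
  next
    case False
    then have m1: "\<mu> 1 = 1" and oth: "(\<Sum>i\<in>odds n - {1}. \<mu> i) = 0" using ts small by linarith+
    have zo: "\<mu> i = 0" if "i \<in> odds n - {1}" for i using oth that by simp
    have z3: "\<mu> k = 0" if "k \<in> {3..n}" for k
    proof -
      have "3 \<in> odds n - {1}" using that by (simp add: odds_def)
      then show ?thesis using zo[of 3] decreasing_le[OF dec, of 3 k] that by simp
    qed
    have s1: "(\<Sum>i\<in>odds n. limit_coeff_single n r \<mu> i) = limit_coeff_single n r \<mu> 1"
      using sum.remove[OF finite_odds o, of "limit_coeff_single n r \<mu>"] zo by (simp add: limit_coeff_zero)
    have s2: "(\<Sum>i\<in>odds n. \<Sum>j\<in>evens n. limit_coeff_pair n r \<mu> i j) = (\<Sum>j\<in>evens n. limit_coeff_pair n r \<mu> 1 j)"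
      using sum.remove[OF finite_odds o, of "\<lambda>i. \<Sum>j\<in>evens n. limit_coeff_pair n r \<mu> i j"] zo by (simp add: limit_coeff_zero)
    have ts1: "tail_odd_size 0 n \<mu> = 1" using ts m1 oth by simp
    have z2: "\<mu> j = 0" if "j \<in> evens n - {2}" for j
    proof (rule z3)
      have "j \<noteq> 0" "j \<noteq> 1" "j \<noteq> 2" "j \<le> n" using that by (auto simp: evens_def)
      then show "j \<in> {3..n}" by auto
    qed
    show ?thesis
    proof (cases "2 \<in> evens n \<and> \<mu> 2 \<noteq> 0")
      case True
      then have n2: "n \<ge> 2" by (simp add: evens_def)
      have m2: "\<mu> 2 = 1" using True le1[of 2] m1 n2 by simp
      have "\<not> decreasing 0 n (lower {1} \<mu>)"
      proof
        assume "decreasing 0 n (lower {1} \<mu>)"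
        from decreasing_le[OF this, of 1 2] show False using n2 m1 m2 by (simp add: lower_def)
      qed
      then have "limit_coeff_single n r \<mu> 1 = 0" by (simp add: limit_coeff_single_def admissible_def)
      moreover have "(\<Sum>j\<in>evens n. limit_coeff_pair n r \<mu> 1 j) = limit_coeff_pair n r \<mu> 1 2"
        using sum.remove[OF finite_evens conjunct1[OF True], of "limit_coeff_pair n r \<mu> 1"] z2 by (simp add: limit_coeff_zero)
      ultimately show ?thesis unfolding s1 s2 ts1 using limit_coeff_pair_first[OF r dec n2 m1 m2 z3] by simp
    next
      case False
      have z: "\<mu> j = 0" if "j \<in> evens n" for j using z2[of j] that False by (cases "j = 2") simp_all
      have "(\<Sum>j\<in>evens n. limit_coeff_pair n r \<mu> 1 j) = 0" using z by (simp add: limit_coeff_zero)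
      moreover have "\<mu> k = 0" if "k \<in> {2..n}" for k
        using z[of k] zo[of k] that by (cases "even k") (auto simp: evens_def odds_def)
      ultimately show ?thesis unfolding s1 s2 ts1 using limit_coeff_single_first[OF r dec n m1] by simp
    qed
  qed
qed

text \<open>Applying the operator to \<open>f0\<close>, the sum of the odd variables, returns the sum of the
  coefficients; by uniqueness in degree \<open>1\<close> it suffices to compute it for at most one box.\<close>

lemma limit_coeff_sum:
  fixes r :: "'k::field_char_0"
  assumes n: "n \<ge> 1" and r: "regular_parameter r" and dec: "decreasing 0 n \<mu>"
  shows "(\<Sum>i\<in>odds n. limit_coeff_single n r \<mu> i) + (\<Sum>i\<in>odds n. \<Sum>j\<in>evens n. limit_coeff_pair n r \<mu> i j) = of_nat (tail_odd_size 0 n \<mu>)"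
proof -
  let ?I = "{Suc 0..n}"
  define f0 :: "(nat \<Rightarrow> 'k) \<Rightarrow> 'k" where "f0 z = (\<Sum>i\<in>odds n. z i)" for z
  \<comment> \<open>\<open>C\<close> is the value of \<open>f0\<close> at the empty weight, so
    \<open>f0 - C\<close> is the odd size at every shifted weight.\<close>
  define C where "C = (\<Sum>i\<in>odds n. of_nat (n - i) * r)"
  have pf0: "polyfun ?I 1 f0" unfolding f0_def
    by (rule polyfun_sum) (use polyfun.var[of _ ?I 0] in \<open>auto simp: odds_def\<close>)
  have sym0: "parity_sym ?I f0" unfolding parity_sym_def
  proof (intro ballI impI allI)
    fix a b z assume "a \<in> ?I" "b \<in> ?I" "even (a + b)"
    from sum.reindex_bij_betw[OF coeff_transpose(3)[OF this], of z]
    show "f0 (z \<circ> transpose a b) = f0 z" by (simp add: f0_def)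
  qed
  have val: "f0 (shifted_point n r 0 \<mu>) = C + of_nat (tail_odd_size 0 n \<mu>)" for \<mu>
    by (simp add: f0_def C_def shifted_point_def tail_odd_size_odds sum.distrib)
  obtain h where hh: "polyfun ?I 1 h" "parity_sym ?I h"
    "\<forall>\<mu>. decreasing 0 n \<mu> \<longrightarrow> h (shifted_point n r 0 \<mu>) =
      (\<Sum>i\<in>odds n. limit_coeff_single n r \<mu> i * (f0 (shifted_point n r 0 \<mu>) - f0 (shifted_point n r 0 (lower {i} \<mu>))))
      + (\<Sum>i\<in>odds n. \<Sum>j\<in>evens n. limit_coeff_pair n r \<mu> i j * (f0 (shifted_point n r 0 \<mu>) - f0 (shifted_point n r 0 (lower {i, j} \<mu>))))"
    using difference_operator_at_shifted_points[OF n r pf0 sym0] by (elim exE conjE)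
  note h = hh(1,2) hh(3)[rule_format]
  have hval: "h (shifted_point n r 0 \<mu>) = (\<Sum>i\<in>odds n. limit_coeff_single n r \<mu> i) + (\<Sum>i\<in>odds n. \<Sum>j\<in>evens n. limit_coeff_pair n r \<mu> i j)"
    if dec: "decreasing 0 n \<mu>" for \<mu>
  proof -
    have "limit_coeff_single n r \<mu> i * (f0 (shifted_point n r 0 \<mu>) - f0 (shifted_point n r 0 (lower {i} \<mu>))) = limit_coeff_single n r \<mu> i" if "i \<in> odds n" for i
    proof (cases "admissible n {i} \<mu>")
      case True
      show ?thesis using admissible_tail_odd_size[OF True that] unfolding val by simp
    qed (simp add: limit_coeff_single_def)
    moreover have "limit_coeff_pair n r \<mu> i j * (f0 (shifted_point n r 0 \<mu>) - f0 (shifted_point n r 0 (lower {i, j} \<mu>))) = limit_coeff_pair n r \<mu> i j"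
      if "i \<in> odds n" "j \<in> evens n" for i j
    proof (cases "admissible n {i, j} \<mu>")
      case True
      have "tail_odd_size 0 n \<mu> = Suc (tail_odd_size 0 n (lower {i, j} \<mu>))"
        by (rule admissible_tail_odd_size[OF True that(1)]) (use that(2) in blast)
      then show ?thesis unfolding val by simp
    qed (simp add: limit_coeff_pair_def)
    ultimately show ?thesis unfolding h(3)[OF dec] by (simp only: cong: sum.cong)
  qed
  let ?F = "\<lambda>z. h z - (f0 z - C)"
  have "?F (shifted_point n r 0 \<mu>) = 0"
  proof (rule vanishing_unique[where f = ?F, OF r])
    show "polyfun ?I 1 ?F" by (intro polyfun_diff polyfun.const h(1) pf0)
    show "parity_sym ?I ?F" using h(2) sym0 by (simp add: parity_sym_def)
    fix \<mu> assume "decreasing 0 n \<mu>" "tail_odd_size 0 n \<mu> \<le> 1"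
    then show "?F (shifted_point n r 0 \<mu>) = 0" using limit_coeff_sum_small[OF n r] hval val by simp
  qed simp
  then show ?thesis using hval[OF dec] val by simp
qed

text \<open>By the sum of the coefficients, the operator at \<open>\<mu>\<close> is the odd size of
  \<open>\<mu>\<close> times \<open>f\<close> minus terms at smaller weights. Up to the size of
  \<open>\<kappa>\<close> these terms are zero, and uniqueness gives the eigenvalue. Beyond it, a
  nonzero value at \<open>\<mu>\<close> forces one at a weight contained in \<open>\<mu>\<close>,
  and the descent can only end at \<open>\<kappa>\<close>.\<close>

theorem extra_vanishing:
  fixes f :: "(nat \<Rightarrow> 'k::field_char_0) \<Rightarrow> 'k"
  assumes n: "n \<ge> 1" and r: "regular_parameter r" and f: "polyfun {Suc 0..n} (tail_odd_size 0 n \<kappa>) f" "parity_sym {Suc 0..n} f"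
    and van: "\<And>\<mu>. decreasing 0 n \<mu> \<Longrightarrow> tail_odd_size 0 n \<mu> \<le> tail_odd_size 0 n \<kappa> \<Longrightarrow> \<exists>l\<in>{Suc 0..n}. \<mu> l \<noteq> \<kappa> l \<Longrightarrow> f (shifted_point n r 0 \<mu>) = 0"
    and "decreasing 0 n \<mu>" "f (shifted_point n r 0 \<mu>) \<noteq> 0" "l \<in> {Suc 0..n}"
  shows "\<kappa> l \<le> \<mu> l"
proof -
  let ?I = "{Suc 0..n}" and ?d = "tail_odd_size 0 n \<kappa>"
  obtain h where hh: "polyfun ?I ?d h" "parity_sym ?I h"
    "\<forall>\<mu>. decreasing 0 n \<mu> \<longrightarrow> h (shifted_point n r 0 \<mu>) =
      (\<Sum>i\<in>odds n. limit_coeff_single n r \<mu> i * (f (shifted_point n r 0 \<mu>) - f (shifted_point n r 0 (lower {i} \<mu>))))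
      + (\<Sum>i\<in>odds n. \<Sum>j\<in>evens n. limit_coeff_pair n r \<mu> i j * (f (shifted_point n r 0 \<mu>) - f (shifted_point n r 0 (lower {i, j} \<mu>))))"
    using difference_operator_at_shifted_points[OF n r f] by (elim exE conjE)
  note h = hh(1,2) hh(3)[rule_format]
  have hval: "h (shifted_point n r 0 \<mu>) = of_nat (tail_odd_size 0 n \<mu>) * f (shifted_point n r 0 \<mu>)
      - (\<Sum>i\<in>odds n. limit_coeff_single n r \<mu> i * f (shifted_point n r 0 (lower {i} \<mu>)))
      - (\<Sum>i\<in>odds n. \<Sum>j\<in>evens n. limit_coeff_pair n r \<mu> i j * f (shifted_point n r 0 (lower {i, j} \<mu>)))"
    if dec: "decreasing 0 n \<mu>" for \<mu>
    unfolding h(3)[OF dec] limit_coeff_sum[OF n r dec, symmetric] right_diff_distrib sum_subtractf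
      distrib_right sum_distrib_right by simp
  have low: "tail_odd_size 0 n \<nu> < tail_odd_size 0 n \<mu> \<and> decreasing 0 n \<nu> \<and> (\<forall>l. \<nu> l \<le> \<mu> l)"
    if "admissible n A \<mu>" "i \<in> odds n" "A = {i} \<or> (\<exists>j\<in>evens n. A = {i, j})" "\<nu> = lower A \<mu>" for A i \<mu> \<nu>
    using admissible_tail_odd_size[OF that(1-3)] that(1) unfolding that(4) by (simp add: admissible_def lower_def)
  have eigen: "h z - of_nat ?d * f z = 0" for z
  proof (rule vanishing_unique[where f = "\<lambda>z. h z - of_nat ?d * f z", OF r])
    show "polyfun ?I ?d (\<lambda>z. h z - of_nat ?d * f z)"
      using polyfun.mult[OF polyfun.const[of ?I 0] f(1), of ?d] by (intro polyfun_diff h(1)) simp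
    show "parity_sym ?I (\<lambda>z. h z - of_nat ?d * f z)" using h(2) f(2) by (simp add: parity_sym_def)
    fix \<mu> assume mu: "decreasing 0 n \<mu>" "tail_odd_size 0 n \<mu> \<le> ?d"
    have z: "f (shifted_point n r 0 \<nu>) = 0" if "tail_odd_size 0 n \<nu> < tail_odd_size 0 n \<mu> \<and> decreasing 0 n \<nu> \<and> (\<forall>l. \<nu> l \<le> \<mu> l)" for \<nu>
    proof (rule van)
      have "tail_odd_size 0 n \<nu> \<noteq> ?d" using that mu by simp
      then show "\<exists>l\<in>?I. \<nu> l \<noteq> \<kappa> l" unfolding tail_odd_size_def by (metis (mono_tags, lifting) mem_Collect_eq sum.cong)
    qed (use that mu in auto)
    have "limit_coeff_single n r \<mu> i * f (shifted_point n r 0 (lower {i} \<mu>)) = 0" if "i \<in> odds n" for i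
      using z[OF low[of "{i}" \<mu> i]] that by (cases "admissible n {i} \<mu>") (simp_all add: limit_coeff_single_def)
    moreover have "limit_coeff_pair n r \<mu> i j * f (shifted_point n r 0 (lower {i, j} \<mu>)) = 0" if "i \<in> odds n" "j \<in> evens n" for i j
    proof (cases "admissible n {i, j} \<mu>")
      case True
      have "f (shifted_point n r 0 (lower {i, j} \<mu>)) = 0"
        by (rule z, rule low[OF True that(1) _ refl]) (use that(2) in blast)
      then show ?thesis by simp
    qed (simp add: limit_coeff_pair_def)
    moreover have "of_nat (tail_odd_size 0 n \<mu>) * f (shifted_point n r 0 \<mu>) = of_nat ?d * f (shifted_point n r 0 \<mu>)"
    proof (cases "tail_odd_size 0 n \<mu> = ?d")
      case False
      then have "\<exists>l\<in>?I. \<mu> l \<noteq> \<kappa> l" unfolding tail_odd_size_def by (metis (mono_tags, lifting) mem_Collect_eq sum.cong)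
      then show ?thesis using van[OF mu] by simp
    qed simp
    ultimately show "h (shifted_point n r 0 \<mu>) - of_nat ?d * f (shifted_point n r 0 \<mu>) = 0" unfolding hval[OF mu(1)]
      by (simp only: sum.neutral_const diff_self diff_zero cong: sum.cong)
  qed simp
  show ?thesis using assms(6-8)
  proof (induction "tail_odd_size 0 n \<mu>" arbitrary: \<mu> rule: less_induct)
    case less
    show ?case
    proof (cases "tail_odd_size 0 n \<mu> \<le> ?d")
      case True
      then show ?thesis using van[OF less.prems(1) True] less.prems(2,3) by fastforce
    next
      case False
      \<comment> \<open>In characteristic zero the factor in front of \<open>f\<close> is nonzero,
        so the eigenvalue equation expresses \<open>f\<close> at \<open>\<mu>\<close> through its
        values at the lowered weights.\<close>
      have "of_nat (tail_odd_size 0 n \<mu>) - of_nat ?d \<noteq> (0::'k)" using False by simp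
      then have "(of_nat (tail_odd_size 0 n \<mu>) - of_nat ?d) * f (shifted_point n r 0 \<mu>) \<noteq> 0" using less.prems(2) by simp
      moreover have "(of_nat (tail_odd_size 0 n \<mu>) - of_nat ?d) * f (shifted_point n r 0 \<mu>)
        = (\<Sum>i\<in>odds n. limit_coeff_single n r \<mu> i * f (shifted_point n r 0 (lower {i} \<mu>)))
        + (\<Sum>i\<in>odds n. \<Sum>j\<in>evens n. limit_coeff_pair n r \<mu> i j * f (shifted_point n r 0 (lower {i, j} \<mu>)))"
        using eigen[of "shifted_point n r 0 \<mu>"] unfolding hval[OF less.prems(1)] by (simp add: algebra_simps)
      ultimately have ne: "(\<Sum>i\<in>odds n. limit_coeff_single n r \<mu> i * f (shifted_point n r 0 (lower {i} \<mu>)))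
        + (\<Sum>i\<in>odds n. \<Sum>j\<in>evens n. limit_coeff_pair n r \<mu> i j * f (shifted_point n r 0 (lower {i, j} \<mu>))) \<noteq> 0"
        by simp
      have step: ?thesis if "tail_odd_size 0 n \<nu> < tail_odd_size 0 n \<mu> \<and> decreasing 0 n \<nu> \<and> (\<forall>l. \<nu> l \<le> \<mu> l)" "f (shifted_point n r 0 \<nu>) \<noteq> 0" for \<nu>
        using less.hyps[of \<nu>] that less.prems(3) le_trans by blast
      show ?thesis
      proof (rule ccontr)
        assume contra: "\<not> ?thesis"
        have "limit_coeff_single n r \<mu> i * f (shifted_point n r 0 (lower {i} \<mu>)) = 0" if "i \<in> odds n" for i
        proof (cases "admissible n {i} \<mu>")
          case True
          show ?thesis using step[OF low[OF True that _ refl]] contra by auto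
        qed (simp add: limit_coeff_single_def)
        moreover have "limit_coeff_pair n r \<mu> i j * f (shifted_point n r 0 (lower {i, j} \<mu>)) = 0" if "i \<in> odds n" "j \<in> evens n" for i j
        proof (cases "admissible n {i, j} \<mu>")
          case True
          show ?thesis using step[OF low[OF True that(1) _ refl]] that(2) contra by auto
        qed (simp add: limit_coeff_pair_def)
        ultimately have "(\<Sum>i\<in>odds n. limit_coeff_single n r \<mu> i * f (shifted_point n r 0 (lower {i} \<mu>)))
          + (\<Sum>i\<in>odds n. \<Sum>j\<in>evens n. limit_coeff_pair n r \<mu> i j * f (shifted_point n r 0 (lower {i, j} \<mu>))) = 0"
          by (simp only: sum.neutral_const add_0_left cong: sum.cong)
        with ne show False by (rule notE)
      qed
    qed
  qed
qed

subsection \<open>Leading terms of polynomials\<close>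

definition monomial :: "(nat \<Rightarrow>\<^sub>0 nat) \<Rightarrow> (nat \<Rightarrow> 'a) \<Rightarrow> 'a::comm_semiring_1" where
  "monomial m x = (\<Prod>i\<in>Poly_Mapping.keys m. x i ^ Poly_Mapping.lookup m i)"

lemma monomial_eq:
  assumes "finite A" "Poly_Mapping.keys m \<subseteq> A"
  shows "monomial m x = (\<Prod>i\<in>A. x i ^ Poly_Mapping.lookup m i)"
  unfolding monomial_def by (rule prod.mono_neutral_left) (use assms in \<open>auto simp: in_keys_iff\<close>)

lemma monomial_tuples:
  "m \<in> tuples n \<Longrightarrow> monomial m x = (\<Prod>i\<in>{Suc 0..n}. x i ^ Poly_Mapping.lookup m i)"
  by (rule monomial_eq) (simp_all add: tuples_def)

lemma monomial_add: "monomial (a + b) x = monomial a x * monomial b x"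
proof -
  let ?A = "Poly_Mapping.keys a \<union> Poly_Mapping.keys b"
  have "monomial c x = (\<Prod>i\<in>?A. x i ^ Poly_Mapping.lookup c i)" if "Poly_Mapping.keys c \<subseteq> ?A" for c
    by (rule monomial_eq) (use that in simp_all)
  then show ?thesis using Poly_Mapping.keys_add[of a b]
    by (simp add: lookup_add power_add prod.distrib)
qed

lemma monomial_zero: "monomial 0 x = 1"
  by (simp add: monomial_def)

lemma monomial_single: "monomial (Poly_Mapping.single i k) x = x i ^ k"
  by (cases "k = 0") (simp_all add: monomial_def)

lemma monomial_sum: "monomial (\<Sum>i\<in>A. g i) x = (\<Prod>i\<in>A. monomial (g i) x)"
  by (induction A rule: infinite_finite_induct) (simp_all add: monomial_zero monomial_add)

section \<open>Evaluation and degree of polynomials\<close>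

lemma eval_mpoly_eq:
  assumes "finite A" "Poly_Mapping.keys p \<subseteq> A"
  shows "eval_mpoly x p = (\<Sum>m\<in>A. Poly_Mapping.lookup p m * monomial m x)"
  unfolding eval_mpoly_def monomial_def[symmetric]
  by (rule sum.mono_neutral_left) (use assms in \<open>auto simp: in_keys_iff\<close>)

lemma eval_mpoly_add: "eval_mpoly x (p + q) = eval_mpoly x p + eval_mpoly x q"
proof -
  let ?A = "Poly_Mapping.keys p \<union> Poly_Mapping.keys q"
  have "eval_mpoly x c = (\<Sum>m\<in>?A. Poly_Mapping.lookup c m * monomial m x)" if "Poly_Mapping.keys c \<subseteq> ?A" for c
    by (rule eval_mpoly_eq) (use that in simp_all)
  then show ?thesis using Poly_Mapping.keys_add[of p q]
    by (simp add: lookup_add distrib_right sum.distrib)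
qed

lemma eval_mpoly_single: "eval_mpoly x (Poly_Mapping.single m c) = c * monomial m x"
  by (cases "c = 0") (simp_all add: eval_mpoly_def monomial_def)

lemma eval_mpoly_sum: "eval_mpoly x (\<Sum>a\<in>A. p a) = (\<Sum>a\<in>A. eval_mpoly x (p a))"
  by (induction A rule: infinite_finite_induct) (simp_all add: eval_mpoly_add, simp_all add: eval_mpoly_def)

lemma eval_permute_vars: "eval_mpoly x (permute_vars \<pi> p) = eval_mpoly (x \<circ> \<pi>) p"
  unfolding permute_vars_def eval_mpoly_sum eval_mpoly_single monomial_sum monomial_single
  by (simp add: eval_mpoly_def)

lemma msize_tuples: "m \<in> tuples n \<Longrightarrow> msize m = (\<Sum>i\<in>{Suc 0..n}. Poly_Mapping.lookup m i)"
  unfolding msize_def by (rule sum.mono_neutral_left) (auto simp: tuples_def in_keys_iff)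

lemma msize_le_total_degree: "m \<in> Poly_Mapping.keys p \<Longrightarrow> msize m \<le> total_degree p"
  unfolding total_degree_def by (intro Max_ge) auto

lemma polyfun_monomial_part:
  assumes "J \<subseteq> I"
  shows "polyfun I (\<Sum>i\<in>J. e i) (\<lambda>x. \<Prod>i\<in>J. x i ^ e i)"
proof (rule polyfun_prod)
  fix i assume "i \<in> J"
  then have "polyfun I 1 (\<lambda>x. x i)" using polyfun.var[of i I 0] assms by auto
  from polyfun_power[OF this, of "e i"] show "polyfun I (e i) (\<lambda>x. x i ^ e i)" by simp
qed

lemma polyfun_eval_mpoly:
  fixes p :: "'k::field_char_0 mpoly"
  assumes "p \<in> poly_ring n"
  shows "polyfun {Suc 0..n} (total_degree p) (\<lambda>x. eval_mpoly x p)"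
  unfolding eval_mpoly_def monomial_def[symmetric]
proof (rule polyfun_sum)
  fix m assume m: "m \<in> Poly_Mapping.keys p"
  then have t: "m \<in> tuples n" using assms by (auto simp: poly_ring_def)
  have "polyfun {Suc 0..n} (msize m) (monomial m)"
    unfolding msize_tuples[OF t] monomial_tuples[OF t, abs_def] by (rule polyfun_monomial_part) simp
  from polyfun.mult[OF polyfun.const[of _ 0 "Poly_Mapping.lookup p m"] polyfun_mono[OF this msize_le_total_degree[OF m]], of "total_degree p"]
  show "polyfun {Suc 0..n} (total_degree p) (\<lambda>x. Poly_Mapping.lookup p m * monomial m x)" by simp
qed

lemma parity_sym_eval_mpoly:
  assumes "p \<in> W_invariants n"
  shows "parity_sym {Suc 0..n} (\<lambda>x. eval_mpoly x p)"
  unfolding parity_sym_def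
proof (intro ballI impI allI)
  fix a b x assume ab: "a \<in> {Suc 0..n}" "b \<in> {Suc 0..n}" "even (a + b)"
  have "a mod 2 = b mod 2" using ab(3) by presburger
  then have "transpose a b i mod 2 = i mod 2" for i by (simp add: transpose_def)
  moreover have "transpose a b permutes {1..n}" using ab(1,2) by (intro permutes_swap_id) simp_all
  ultimately have "transpose a b \<in> W n" by (simp add: W_def)
  then have "permute_vars (transpose a b) p = p" using assms by (simp add: W_invariants_def)
  then show "eval_mpoly (x \<circ> transpose a b) p = eval_mpoly x p" by (metis eval_permute_vars)
qed

text \<open>Comparison of the coefficients of \<open>t ^ b\<close>. It transfers identities valid
  for all rescalings of some variables to the part of fixed degree in them.\<close>

lemma scaling_coeff:
  fixes c :: "'i \<Rightarrow> 'k::field_char_0"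
  assumes "finite K" "\<And>t. (\<Sum>k\<in>K. t ^ e k * c k) = 0"
  shows "(\<Sum>k | k \<in> K \<and> e k = b. c k) = 0"
proof -
  have "(\<Sum>k\<in>K. monom (c k) (e k)) = 0"
    by (rule poly_cofinite_eq[of "{}"]) (simp_all add: poly_sum poly_monom assms(2) mult.commute[of "c _"])
  then have "coeff (\<Sum>k\<in>K. monom (c k) (e k)) b = 0" by simp
  then show ?thesis using assms(1)
    by (simp add: coeff_sum sum.If_cases Int_def conj_commute)
qed

lemma monomial_scale:
  fixes x :: "nat \<Rightarrow> 'k::field_char_0"
  assumes "m \<in> tuples n" "A \<subseteq> {Suc 0..n}"
  shows "monomial m (\<lambda>l. if l \<in> A then t * x l else x l) = t ^ (\<Sum>l\<in>A. Poly_Mapping.lookup m l) * monomial m x"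
proof -
  have "monomial m (\<lambda>l. if l \<in> A then t * x l else x l)
     = (\<Prod>l\<in>{Suc 0..n}. (if l \<in> A then t ^ Poly_Mapping.lookup m l else 1) * x l ^ Poly_Mapping.lookup m l)"
    unfolding monomial_tuples[OF assms(1)] by (rule prod.cong) (simp_all add: power_mult_distrib)
  also have "\<dots> = (\<Prod>l\<in>{Suc 0..n}. if l \<in> A then t ^ Poly_Mapping.lookup m l else 1) * monomial m x"
    unfolding monomial_tuples[OF assms(1)] by (rule prod.distrib)
  also have "(\<Prod>l\<in>{Suc 0..n}. if l \<in> A then t ^ Poly_Mapping.lookup m l else 1) = (\<Prod>l\<in>A. t ^ Poly_Mapping.lookup m l)"
    by (rule prod.mono_neutral_cong_right) (use assms(2) in auto)
  finally show ?thesis by (simp add: power_sum)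
qed

text \<open>Rescaling one variable at a time isolates the monomials with the same exponent as
  \<open>m0\<close> in it; after all \<open>n\<close> variables only \<open>m0\<close> is
  left.\<close>

lemma monomials_independent:
  fixes c :: "(nat \<Rightarrow>\<^sub>0 nat) \<Rightarrow> 'k::field_char_0"
  assumes "finite K" "K \<subseteq> tuples n" "\<And>x. (\<Sum>m\<in>K. c m * monomial m x) = 0" "m0 \<in> K"
  shows "c m0 = 0"
proof -
  let ?K = "\<lambda>k. {m \<in> K. \<forall>i\<in>{Suc 0..k}. Poly_Mapping.lookup m i = Poly_Mapping.lookup m0 i}"
  have "\<forall>x. (\<Sum>m\<in>?K k. c m * monomial m x) = 0" if "k \<le> n" for k
    using that
  proof (induction k)
    case 0 then show ?case using assms(3) by simp
  next
    case (Suc k)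
    show ?case
    proof
      fix x
      have "(\<Sum>m | m \<in> ?K k \<and> (\<Sum>l\<in>{Suc k}. Poly_Mapping.lookup m l) = Poly_Mapping.lookup m0 (Suc k). c m * monomial m x) = 0"
      proof (rule scaling_coeff)
        show "finite (?K k)" using assms(1) by simp
        fix t
        have "(\<Sum>m\<in>?K k. t ^ (\<Sum>l\<in>{Suc k}. Poly_Mapping.lookup m l) * (c m * monomial m x))
          = (\<Sum>m\<in>?K k. c m * monomial m (\<lambda>l. if l \<in> {Suc k} then t * x l else x l))"
        proof (rule sum.cong[OF refl])
          fix m assume "m \<in> ?K k"
          then have "m \<in> tuples n" using assms(2) by blast
          then show "t ^ (\<Sum>l\<in>{Suc k}. Poly_Mapping.lookup m l) * (c m * monomial m x) = c m * monomial m (\<lambda>l. if l \<in> {Suc k} then t * x l else x l)"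
            using Suc.prems by (subst monomial_scale[of m n]) (simp_all add: mult.left_commute)
        qed
        also have "\<dots> = 0" using Suc.IH Suc.prems by simp
        finally show "(\<Sum>m\<in>?K k. t ^ (\<Sum>l\<in>{Suc k}. Poly_Mapping.lookup m l) * (c m * monomial m x)) = 0" .
      qed
      also have "{m. m \<in> ?K k \<and> (\<Sum>l\<in>{Suc k}. Poly_Mapping.lookup m l) = Poly_Mapping.lookup m0 (Suc k)} = ?K (Suc k)"
        by (auto simp: le_Suc_eq)
      finally show "(\<Sum>m\<in>?K (Suc k). c m * monomial m x) = 0" .
    qed
  qed
  then have "(\<Sum>m\<in>?K n. c m * monomial m (\<lambda>_. 1)) = 0" by blast
  moreover have "?K n = {m0}"
  proof -
    have "m = m0" if m: "m \<in> ?K n" for m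
    proof (rule poly_mapping_eqI)
      fix i
      have "m \<in> tuples n" "m0 \<in> tuples n" using m assms(2,4) by auto
      then have "i \<notin> {Suc 0..n} \<Longrightarrow> Poly_Mapping.lookup m i = 0 \<and> Poly_Mapping.lookup m0 i = 0"
        by (auto simp: tuples_def in_keys_iff)
      then show "Poly_Mapping.lookup m i = Poly_Mapping.lookup m0 i" using m by (cases "i \<in> {Suc 0..n}") auto
    qed
    then show ?thesis using assms(4) by blast
  qed
  ultimately show ?thesis by (simp add: monomial_def)
qed

text \<open>An entry of the bracket is an alternating sum, hence the difference of the odd sizes of
  two consecutive tails, and the partial sums telescope. This turns dominance into a statement about
  tails.\<close>

lemma bracket_partial_sums:
  assumes "lam \<in> Lam n" "m \<le> n"
  shows "(\<Sum>i = 1..m. Poly_Mapping.lookup (bracket n lam) i) + tail_odd_size m n (Poly_Mapping.lookup lam) = tail_odd_size 0 n (Poly_Mapping.lookup lam)"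
  using assms(2)
proof (induction m)
  case (Suc m)
  let ?l = "Poly_Mapping.lookup lam"
  have 1: "int (tail_odd_size m n ?l) = (\<Sum>j = Suc m..n. if odd (j + m) then int (?l j) else 0)"
    unfolding tail_odd_size_def of_nat_sum by (rule sum.mono_neutral_cong_left) auto
  have 2: "int (tail_odd_size (Suc m) n ?l) = (\<Sum>j = Suc m..n. if even (j + m) then int (?l j) else 0)"
    unfolding tail_odd_size_def of_nat_sum by (rule sum.mono_neutral_cong_left) (auto simp: Suc_le_eq order.order_iff_strict)
  have "int (Poly_Mapping.lookup (bracket n lam) (Suc m)) = (\<Sum>j = Suc m..n. (-1) ^ (j - Suc m) * int (?l j))"
    by (rule lookup_bracket[OF assms(1)]) (use Suc.prems in simp)
  also have "\<dots> = (\<Sum>j = Suc m..n. (if odd (j + m) then int (?l j) else 0) - (if even (j + m) then int (?l j) else 0))"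
  proof (rule sum.cong[OF refl])
    fix j assume "j \<in> {Suc m..n}"
    then obtain e where "j = Suc m + e" by (auto simp: le_iff_add)
    then show "(-1) ^ (j - Suc m) * int (?l j) = (if odd (j + m) then int (?l j) else 0) - (if even (j + m) then int (?l j) else 0)"
      by (cases "even e") simp_all
  qed
  also have "\<dots> = int (tail_odd_size m n ?l) - int (tail_odd_size (Suc m) n ?l)" unfolding 1 2 by (rule sum_subtractf)
  finally have "Poly_Mapping.lookup (bracket n lam) (Suc m) + tail_odd_size (Suc m) n ?l = tail_odd_size m n ?l" by linarith
  then show ?case using Suc by simp
qed simp

text \<open>In view of the telescoped partial sums of the bracket this is dominance at
  \<open>m\<close>, written without subtraction.\<close>

lemma partial_degree_bound:
  fixes r :: "'k::field_char_0"
  assumes n: "n \<ge> 1" and r: "regular_parameter r" and lam: "lam \<in> Lam n" and R: "is_R n r lam R"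
    and m: "m \<le> n" and "\<mu>0 \<in> Poly_Mapping.keys R"
  shows "(\<Sum>i = 1..m. Poly_Mapping.lookup \<mu>0 i) + tail_odd_size m n (Poly_Mapping.lookup lam) \<le> tail_odd_size 0 n (Poly_Mapping.lookup lam)"
proof (rule ccontr)
  let ?l = "Poly_Mapping.lookup lam" and ?I = "{Suc 0..n}" and ?A = "{Suc 0..m}" and ?K = "Poly_Mapping.keys R"
  define T d where "T = tail_odd_size m n ?l" and "d = tail_odd_size 0 n ?l"
  define e where "e \<mu> = (\<Sum>i\<in>?A. Poly_Mapping.lookup \<mu> i)" for \<mu> :: "nat \<Rightarrow>\<^sub>0 nat"
  define b where "b = Max (e ` ?K)"
  define f where "f x = eval_mpoly x R" for x
  have AI: "?A \<subseteq> ?I" using m by auto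
  have d: "d = odd_size n lam" by (simp add: d_def tail_odd_size_odds odd_size_def odds_def)
  have K: "finite ?K" "?K \<subseteq> tuples n" and deg: "total_degree R = d" and inv: "R \<in> W_invariants n"
    using R by (auto simp: is_R_def W_invariants_def poly_ring_def d)
  have pff: "polyfun ?I d f" unfolding f_def deg[symmetric]
    by (rule polyfun_eval_mpoly) (use inv in \<open>simp add: W_invariants_def\<close>)
  have symf: "parity_sym ?I f" unfolding f_def by (rule parity_sym_eval_mpoly[OF inv])
  have decl: "decreasing 0 n ?l" using lam by (simp add: Lam_def decreasing_def)
  have van: "f (shifted_point n r 0 \<mu>) = 0"
    if mu: "decreasing 0 n \<mu>" "tail_odd_size 0 n \<mu> \<le> d" "\<exists>l\<in>?I. \<mu> l \<noteq> ?l l" for \<mu>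
  proof -
    \<comment> \<open>The vanishing conditions concern finitely supported weights, whereas
      \<open>\<mu>\<close> may take any values outside \<open>{1..n}\<close>; both give the same
      value of \<open>f\<close>.\<close>
    define \<mu>' where "\<mu>' = (\<Sum>l\<in>?I. Poly_Mapping.single l (\<mu> l))"
    have look: "Poly_Mapping.lookup \<mu>' l = (if l \<in> ?I then \<mu> l else 0)" for l
      by (simp add: \<mu>'_def lookup_sum lookup_single when_def)
    have "\<mu>' \<in> Lam n" using mu(1)
      by (auto simp: Lam_def tuples_def decreasing_def look in_keys_iff split: if_splits)
    moreover have "odd_size n \<mu>' = tail_odd_size 0 n \<mu>"
      unfolding odd_size_def tail_odd_size_def by (rule sum.cong) (auto simp: look)
    moreover have "\<mu>' \<noteq> lam" using mu(3) look by metis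
    ultimately have "eval_mpoly (\<lambda>i. rho n r i + of_nat (Poly_Mapping.lookup \<mu>' i)) R = 0"
      using R mu(2) by (simp add: is_R_def d)
    moreover have "f (shifted_point n r 0 \<mu>) = f (\<lambda>i. rho n r i + of_nat (Poly_Mapping.lookup \<mu>' i))"
      by (rule polyfun_cong[OF pff]) (simp add: shifted_point_def rho_def look)
    ultimately show ?thesis by (simp add: f_def)
  qed
  have extra: "?l l \<le> \<mu> l" if "decreasing 0 n \<mu>" "f (shifted_point n r 0 \<mu>) \<noteq> 0" "l \<in> ?I" for \<mu> l
    by (rule extra_vanishing[where f = f and \<kappa> = ?l, OF n r _ symf _ that]) (use pff van in \<open>simp_all add: d_def\<close>)

  assume "\<not> ?thesis"
  then have "e \<mu>0 + T > d" by (simp add: e_def T_def d_def)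
  moreover have "e \<mu>0 \<le> b" unfolding b_def using assms(6) by (intro Max_ge) auto
  ultimately have bT: "b + T > d" by simp
  obtain \<mu>1 where mu1: "\<mu>1 \<in> ?K" "e \<mu>1 = b"
  proof -
    have "b \<in> e ` ?K" unfolding b_def using assms(6) by (intro Max_in) auto
    then show ?thesis using that by blast
  qed
  have msz: "msize \<mu> = e \<mu> + (\<Sum>i\<in>{Suc m..n}. Poly_Mapping.lookup \<mu> i)" if "\<mu> \<in> ?K" for \<mu>
  proof -
    have "\<mu> \<in> tuples n" using that K by blast
    moreover have "?I = ?A \<union> {Suc m..n}" using m by auto
    ultimately show ?thesis unfolding e_def by (simp add: msize_tuples sum.union_disjoint[symmetric])
  qed
  have msd: "msize \<mu> \<le> d" if "\<mu> \<in> ?K" for \<mu> using msize_le_total_degree[OF that] deg by simp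
  have bd: "b \<le> d" using msz[OF mu1(1)] msd[OF mu1(1)] mu1(2) by simp
  have mn: "m < n"
  proof (rule ccontr)
    assume "\<not> m < n"
    then have "T = 0" using m by (simp add: T_def tail_odd_size_def)
    then show False using bT bd by simp
  qed
  define mix where "mix z y = (\<lambda>l. if l \<in> ?A then z l else y l :: 'k)" for z y
  \<comment> \<open>No weight ending in \<open>\<kappa>\<close> contains the tail of
    \<open>lam\<close>, because \<open>d - b < T\<close>; so \<open>f\<close> vanishes at all of
    them, whatever the first \<open>m\<close> rows are, and hence on the whole slice.\<close>
  have tail: "f (mix z (shifted_point n r 0 \<kappa>)) = 0" if kap: "decreasing m n \<kappa>" "tail_odd_size m n \<kappa> \<le> d - b" for z \<kappa>
  proof -
    \<comment> \<open>The first \<open>m\<close> rows will be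
      \<open>\<kappa> (Suc m) + \<nu>\<close>, which keeps the joined weight decreasing;
      \<open>c\<close> is the matching offset, including the part \<open>(n - m) * r\<close> of the
      staircase.\<close>
    define c where "c = of_nat (n - m) * r + of_nat (\<kappa> (Suc m))"
    show ?thesis
    proof (rule vanishing_unique[where f = "\<lambda>z. f (mix z (shifted_point n r 0 \<kappa>))" and m = 0 and n = m and c = c, OF r])
      show "polyfun ?A d (\<lambda>z. f (mix z (shifted_point n r 0 \<kappa>)))"
      proof (rule polyfun_subst[OF pff])
        fix i show "polyfun ?A 1 (\<lambda>z. mix z (shifted_point n r 0 \<kappa>) i)"
          using polyfun.var[of i ?A 0] by (cases "i \<in> ?A") (simp_all add: mix_def polyfun.const del: atLeastAtMost_iff)
      qed
      show "parity_sym ?A (\<lambda>z. f (mix z (shifted_point n r 0 \<kappa>)))" unfolding parity_sym_def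
      proof (intro ballI impI allI)
        fix a b z assume ab: "a \<in> ?A" "b \<in> ?A" "even (a + b)"
        have "mix (z \<circ> transpose a b) (shifted_point n r 0 \<kappa>) = mix z (shifted_point n r 0 \<kappa>) \<circ> transpose a b"
        proof
          fix l show "mix (z \<circ> transpose a b) (shifted_point n r 0 \<kappa>) l = (mix z (shifted_point n r 0 \<kappa>) \<circ> transpose a b) l"
            using ab(1,2) by (cases "l = a"; cases "l = b") (simp_all add: mix_def del: atLeastAtMost_iff)
        qed
        moreover have "f (mix z (shifted_point n r 0 \<kappa>) \<circ> transpose a b) = f (mix z (shifted_point n r 0 \<kappa>))"
          by (rule parity_symD[OF symf _ _ ab(3)]) (use ab(1,2) AI in blast)+
        ultimately show "f (mix (z \<circ> transpose a b) (shifted_point n r 0 \<kappa>)) = f (mix z (shifted_point n r 0 \<kappa>))" by simp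
      qed
      fix \<nu> assume nu: "decreasing 0 m \<nu>"
      define \<mu> where "\<mu> l = (if l \<in> ?A then \<kappa> (Suc m) + \<nu> l else \<kappa> l)" for l
      have "mix (shifted_point m r c \<nu>) (shifted_point n r 0 \<kappa>) = shifted_point n r 0 \<mu>"
      proof
        fix l
        have "of_nat (n - m) * r + of_nat (m - l) * r = of_nat (n - l) * r" if "l \<in> ?A"
        proof -
          have "n - l = (n - m) + (m - l)" using that m by auto
          then show ?thesis by (simp add: distrib_right)
        qed
        then show "mix (shifted_point m r c \<nu>) (shifted_point n r 0 \<kappa>) l = shifted_point n r 0 \<mu> l"
          by (cases "l \<in> ?A") (simp_all add: mix_def shifted_point_def c_def \<mu>_def algebra_simps del: atLeastAtMost_iff)
      qed
      moreover have "decreasing 0 n \<mu>" unfolding decreasing_def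
      proof
        fix i assume i: "i \<in> {Suc 0..<n}"
        show "\<mu> (Suc i) \<le> \<mu> i"
        proof (cases "i < m")
          case True then show ?thesis using nu i by (simp add: \<mu>_def decreasing_def)
        next
          case False then show ?thesis using kap(1) i by (cases "i = m") (simp_all add: \<mu>_def decreasing_def)
        qed
      qed
      moreover have "f (shifted_point n r 0 \<mu>) = 0" if "decreasing 0 n \<mu>"
      proof (rule ccontr)
        assume "f (shifted_point n r 0 \<mu>) \<noteq> 0"
        then have le: "?l l \<le> \<mu> l" if "l \<in> ?I" for l using extra that \<open>decreasing 0 n \<mu>\<close> by blast
        have "T \<le> tail_odd_size m n \<kappa>" unfolding T_def tail_odd_size_def
        proof (rule sum_mono)
          fix l assume "l \<in> {l \<in> {Suc m..n}. odd (l + m)}"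
          then have "l \<in> ?I" "l \<notin> ?A" by auto
          then show "?l l \<le> \<kappa> l" using le[of l] unfolding \<mu>_def by simp
        qed
        then show False using kap(2) bT bd by simp
      qed
      ultimately show "f (mix (shifted_point m r c \<nu>) (shifted_point n r 0 \<kappa>)) = 0" by simp
    qed simp
  qed
  \<comment> \<open>This is the coefficient of \<open>t ^ b\<close> when the first \<open>m\<close>
    variables are multiplied by \<open>t\<close>, so it inherits from \<open>f\<close> the vanishing
    on slices and the symmetry in the tail.\<close>
  define g where "g x = (\<Sum>\<mu> | \<mu> \<in> ?K \<and> e \<mu> = b. Poly_Mapping.lookup R \<mu> * monomial \<mu> x)" for x
  have fsum: "f x = (\<Sum>\<mu>\<in>?K. Poly_Mapping.lookup R \<mu> * monomial \<mu> x)" for x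
    unfolding f_def by (rule eval_mpoly_eq) simp_all
  have fmix: "f (mix (\<lambda>l. t * z l) y) = (\<Sum>\<mu>\<in>?K. t ^ e \<mu> * (Poly_Mapping.lookup R \<mu> * monomial \<mu> (mix z y)))" for t z y
    unfolding fsum
  proof (rule sum.cong[OF refl])
    fix \<mu> assume "\<mu> \<in> ?K"
    then have "\<mu> \<in> tuples n" using K by blast
    from monomial_scale[OF this AI, of t "mix z y"]
    have "monomial \<mu> (\<lambda>l. if l \<in> ?A then t * mix z y l else mix z y l) = t ^ e \<mu> * monomial \<mu> (mix z y)"
      by (simp add: e_def)
    moreover have "(\<lambda>l. if l \<in> ?A then t * mix z y l else mix z y l) = mix (\<lambda>l. t * z l) y"
      by (simp add: mix_def fun_eq_iff)
    ultimately show "Poly_Mapping.lookup R \<mu> * monomial \<mu> (mix (\<lambda>l. t * z l) y)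
      = t ^ e \<mu> * (Poly_Mapping.lookup R \<mu> * monomial \<mu> (mix z y))" by simp
  qed
  have gzero: "g (mix z y) = 0" for z y
  proof (rule vanishing_unique[where f = "\<lambda>y. g (mix z y)" and m = m and n = n and c = 0, OF r m])
    let ?J = "{Suc m..n}"
    show "polyfun ?J (d - b) (\<lambda>y. g (mix z y))" unfolding g_def
    proof (rule polyfun_sum)
      fix \<mu> assume "\<mu> \<in> {\<mu>. \<mu> \<in> ?K \<and> e \<mu> = b}"
      then have mu: "\<mu> \<in> ?K" "e \<mu> = b" "\<mu> \<in> tuples n" using K by auto
      let ?p = "\<Prod>l\<in>?A. z l ^ Poly_Mapping.lookup \<mu> l"
      have "monomial \<mu> (mix z y) = ?p * (\<Prod>l\<in>?J. y l ^ Poly_Mapping.lookup \<mu> l)" for y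
      proof -
        have "?I = ?A \<union> ?J" using m by auto
        then have "monomial \<mu> (mix z y) = (\<Prod>l\<in>?A. mix z y l ^ Poly_Mapping.lookup \<mu> l) * (\<Prod>l\<in>?J. mix z y l ^ Poly_Mapping.lookup \<mu> l)"
          unfolding monomial_tuples[OF mu(3)] by (simp add: prod.union_disjoint)
        then show ?thesis by (simp add: mix_def)
      qed
      note eq = this
      \<comment> \<open>Of the total degree, at most \<open>d\<close>, the first \<open>m\<close>
        variables already use \<open>b\<close>.\<close>
      have "(\<Sum>l\<in>?J. Poly_Mapping.lookup \<mu> l) \<le> d - b" using msz[OF mu(1)] msd[OF mu(1)] mu(2) by simp
      then have "polyfun ?J (d - b) (\<lambda>y. \<Prod>l\<in>?J. y l ^ Poly_Mapping.lookup \<mu> l)"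
        by (rule polyfun_mono[OF polyfun_monomial_part[OF order_refl]])
      from polyfun.mult[OF polyfun.const[of _ 0 "Poly_Mapping.lookup R \<mu> * ?p"] this, of "d - b"]
      show "polyfun ?J (d - b) (\<lambda>y. Poly_Mapping.lookup R \<mu> * monomial \<mu> (mix z y))"
        unfolding eq by (simp add: mult.assoc)
    qed
    show "parity_sym ?J (\<lambda>y. g (mix z y))" unfolding parity_sym_def
    proof (intro ballI impI allI)
      fix a b' and y :: "nat \<Rightarrow> 'k" assume ab: "a \<in> ?J" "b' \<in> ?J" "even (a + b')"
      let ?y = "y \<circ> transpose a b'"
      have fs: "f (mix z ?y) = f (mix z y)" for z
      proof -
        have "mix z ?y = mix z y \<circ> transpose a b'"
        proof
          fix l show "mix z ?y l = (mix z y \<circ> transpose a b') l"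
            using ab(1,2) by (cases "l = a"; cases "l = b'") (simp_all add: mix_def)
        qed
        moreover have "f (mix z y \<circ> transpose a b') = f (mix z y)"
          by (rule parity_symD[OF symf _ _ ab(3)]) (use ab(1,2) in simp_all)
        ultimately show ?thesis by simp
      qed
      have "(\<Sum>\<mu> | \<mu> \<in> ?K \<and> e \<mu> = b. Poly_Mapping.lookup R \<mu> * monomial \<mu> (mix z ?y) - Poly_Mapping.lookup R \<mu> * monomial \<mu> (mix z y)) = 0"
        by (rule scaling_coeff[OF K(1)]) (simp only: right_diff_distrib sum_subtractf fmix[symmetric] fs diff_self)
      then show "g (mix z ?y) = g (mix z y)" by (simp add: g_def sum_subtractf)
    qed
    fix \<kappa> assume "decreasing m n \<kappa>" "tail_odd_size m n \<kappa> \<le> d - b"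
    then show "g (mix z (shifted_point n r 0 \<kappa>)) = 0" unfolding g_def
      by (intro scaling_coeff[OF K(1)]) (simp only: fmix[symmetric] tail)
  qed
  have "g x = 0" for x
  proof -
    have "mix x x = x" by (simp add: mix_def fun_eq_iff)
    then show ?thesis using gzero[of x x] by simp
  qed
  then have g0: "(\<Sum>\<mu> | \<mu> \<in> ?K \<and> e \<mu> = b. Poly_Mapping.lookup R \<mu> * monomial \<mu> x) = 0" for x
    by (simp add: g_def)
  have "Poly_Mapping.lookup R \<mu>1 = 0"
  proof (rule monomials_independent[where c = "Poly_Mapping.lookup R" and n = n, OF _ _ g0])
    show "{\<mu>. \<mu> \<in> ?K \<and> e \<mu> = b} \<subseteq> tuples n" using K(2) by blast
  qed (use K(1) mu1 in simp_all)
  then show False using mu1(1) by (simp add: in_keys_iff)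
qed

section \<open>The two expansions\<close>

lemma regular_parameterI:
  fixes r :: "'k::field_char_0"
  assumes "r \<notin> of_rat ` {q. q < 0}"
  shows "regular_parameter r"
  unfolding regular_parameter_def
proof (intro allI impI)
  fix a b :: nat assume b: "b > 0"
  show "of_nat a * r + of_nat b \<noteq> 0"
  proof
    assume eq: "of_nat a * r + of_nat b = 0"
    have a: "a \<noteq> 0" using eq b by (intro notI) simp
    have "of_nat a * r = - of_nat b" using eq by (simp add: eq_neg_iff_add_eq_0)
    then have "r = of_rat (- (of_nat b / of_nat a))" using a by (simp add: of_rat_minus of_rat_divide field_simps)
    moreover have "- (of_nat b / of_nat a) < (0::rat)" using a b by simp
    ultimately show False using assms by blast
  qed
qed

theorem theorem6p1:
  fixes n :: nat and r :: "'k::field_char_0"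
    and lam :: "nat \<Rightarrow>\<^sub>0 nat" and R :: "'k mpoly"
  assumes "n \<ge> 1"
    and "r \<notin> of_rat ` {q. q < 0}"
    and "lam \<in> Lam n"
    and "is_R n r lam R"
  shows "\<exists>a :: (nat \<Rightarrow>\<^sub>0 nat) \<Rightarrow> 'k.
     R = (\<Sum>\<mu>\<in>{\<mu> \<in> tuples n. dominated n \<mu> (bracket n lam)}. Poly_Mapping.single \<mu> (a \<mu>)) \<and>
     hom_component (odd_size n lam) R =
       (\<Sum>\<mu>\<in>{\<mu> \<in> tuples n. dominated n \<mu> (bracket n lam) \<and> msize \<mu> = msize (bracket n lam)}.
          Poly_Mapping.single \<mu> (a \<mu>))"
proof (intro exI[of _ "Poly_Mapping.lookup R"] conjI)
  let ?S = "{\<mu> \<in> tuples n. dominated n \<mu> (bracket n lam)}"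
  let ?l = "Poly_Mapping.lookup lam"
  \<comment> \<open>The coefficients are those of \<open>R\<close> itself, so both expansions reduce
    to the claim that every exponent of \<open>R\<close> is dominated by the bracket.\<close>
  have sub: "Poly_Mapping.keys R \<subseteq> ?S"
  proof
    fix \<mu> assume mu: "\<mu> \<in> Poly_Mapping.keys R"
    have "dominated n \<mu> (bracket n lam)" unfolding dominated_def
    proof
      fix m assume "m \<in> {1..n}"
      then have m: "m \<le> n" by simp
      show "(\<Sum>i = 1..m. Poly_Mapping.lookup \<mu> i) \<le> (\<Sum>i = 1..m. Poly_Mapping.lookup (bracket n lam) i)"
        using partial_degree_bound[OF assms(1) regular_parameterI[OF assms(2)] assms(3,4) m mu]
          bracket_partial_sums[OF assms(3) m] by simp
    qed
    then show "\<mu> \<in> ?S" using mu assms(4) by (auto simp: is_R_def W_invariants_def poly_ring_def)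
  qed
  have fin: "finite ?S" by (rule finite_dominated)
  show "R = (\<Sum>\<mu>\<in>?S. Poly_Mapping.single \<mu> (Poly_Mapping.lookup R \<mu>))"
  proof (rule poly_mapping_eqI)
    fix \<mu>
    have "Poly_Mapping.lookup (\<Sum>\<mu>\<in>?S. Poly_Mapping.single \<mu> (Poly_Mapping.lookup R \<mu>)) \<mu>
      = (if \<mu> \<in> ?S then Poly_Mapping.lookup R \<mu> else 0)"
      using fin by (simp add: lookup_sum lookup_single when_def del: mem_Collect_eq)
    then show "Poly_Mapping.lookup R \<mu> = Poly_Mapping.lookup (\<Sum>\<mu>\<in>?S. Poly_Mapping.single \<mu> (Poly_Mapping.lookup R \<mu>)) \<mu>"
      using sub by (auto simp: in_keys_iff subset_iff simp del: mem_Collect_eq)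
  qed
  \<comment> \<open>For \<open>m = n\<close> the tail is empty, so the total size of the bracket is
    the odd size of \<open>lam\<close>, which is the degree of the component.\<close>
  have "bracket n lam \<in> tuples n" by (auto simp: tuples_def in_keys_iff lookup_bracket_nat split: if_splits)
  then have "msize (bracket n lam) = (\<Sum>i = 1..n. Poly_Mapping.lookup (bracket n lam) i)" by (simp add: msize_tuples)
  also have "\<dots> = tail_odd_size 0 n ?l" using bracket_partial_sums[OF assms(3) order_refl] by (simp add: tail_odd_size_def)
  also have "\<dots> = odd_size n lam" by (simp add: tail_odd_size_odds odd_size_def odds_def)
  finally have ms: "msize (bracket n lam) = odd_size n lam" .
  show "hom_component (odd_size n lam) R =
     (\<Sum>\<mu>\<in>{\<mu> \<in> tuples n. dominated n \<mu> (bracket n lam) \<and> msize \<mu> = msize (bracket n lam)}.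
          Poly_Mapping.single \<mu> (Poly_Mapping.lookup R \<mu>))"
    unfolding hom_component_def ms
  proof (rule sum.mono_neutral_left)
    show "finite {\<mu> \<in> tuples n. dominated n \<mu> (bracket n lam) \<and> msize \<mu> = odd_size n lam}"
      by (rule finite_subset[OF _ fin]) blast
  qed (use sub in \<open>auto simp: in_keys_iff\<close>)
qed

end
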